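(* The class of W-GDW-metrics is closed under projective change. That is: let $F$ and $\bar F$ be two projectively equivalent Finsler metrics on a manifold $M$. If $F$ is a W-GDW-metric (weakly generalized Douglas-Weyl metric), then $\bar F$ is a W-GDW-metric.
   Context: Let $M$ be an $n$-dimensional smooth manifold. A Finsler metric on $M$ is a non-negative function $F$ on $TM$ that is $C^\infty$ on $TM_0=TM\setminus\{0\}$, positively homogeneous of degree one in $y$, and such that $g_{ij}=\frac12\frac{\partial^2F^2}{\partial y^i\partial y^j}$ is positive definite at every $y\neq 0$. Its spray coefficients are $G^i(x,y)=\frac14 g^{il}\left\{\frac{\partial^2F^2}{\partial x^k\partial y^l}y^k-\frac{\partial F^2}{\partial x^l}\right\}$. Notation: "$._k$" denotes $\partial/\partial y^k$ (vertical derivative); "$|_m$" denotes the horizontal covariant derivative with respect to the Berwald connection of $F$, e.g. $T^i{}_{j|m}=\frac{\partial T^i{}_j}{\partial x^m}-G^r{}_{.m}T^i{}_{j.r}+T^r{}_jG^i{}_{.r.m}-T^i{}_rG^r{}_{.j.m}$, and similarly for other tensors on $TM_0$. A subscript $0$ denotes contraction with $y$: $T_{|0}=T_{|m}y^m$. The Douglas tensor is $D_j{}^i{}_{kl}=\frac{\partial^3}{\partial y^j\partial y^k\partial y^l}\left(G^i-\frac1{n+1}\frac{\partial G^m}{\partial y^m}y^i\right)$. Put $\tilde D_j{}^i{}_{kl}=D_j{}^i{}_{kl|0}$. $F$ is a W-GDW-metric if there are a scalar function $\lambda=\lambda(x,y)$ on $TM$ and coefficients $U_{jkl}$ of some tensor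 field such that $\tilde D_j{}^i{}_{kl|0}+\lambda F\tilde D_j{}^i{}_{kl}=U_{jkl}y^i$. Two Finsler metrics $F,\bar F$ on $M$ with spray coefficients $G^i,\bar G^i$ are projectively equivalent (projectively related) if $\bar G^i=G^i+Py^i$ for some function $P=P(x,y)$ that is positively homogeneous of degree one in $y$. *)

theory Defs
  imports "HOL-Analysis.Analysis"
begin

section \<open>Smooth maps and smooth manifolds\<close>

text \<open>\<open>C_k_on k S f\<close> is the usual notion of a map of class \<open>C\<^sup>k\<close> on an open set \<open>S\<close>: continuity of
  all directional derivatives up to order \<open>k\<close>.\<close>

fun C_k_on :: "nat \<Rightarrow> 'a::euclidean_space set \<Rightarrow> ('a \<Rightarrow> 'b::real_normed_vector) \<Rightarrow> bool" where
  "C_k_on 0 S f \<longleftrightarrow> continuous_on S f"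
| "C_k_on (Suc k) S f \<longleftrightarrow>
     (\<forall>x\<in>S. f differentiable (at x)) \<and> (\<forall>v. C_k_on k S (\<lambda>x. frechet_derivative f (at x) v))"

definition smooth_on :: "'a::euclidean_space set \<Rightarrow> ('a \<Rightarrow> 'b::real_normed_vector) \<Rightarrow> bool" where
  "smooth_on S f \<longleftrightarrow> (\<forall>k. C_k_on k S f)"

text \<open>A chart is a pair of its domain and its coordinate map; the values of the coordinate map off the
  domain are irrelevant.  The manifold is the whole (Hausdorff, second countable) type \<open>'m\<close>, and its
  dimension \<open>n\<close> is \<open>CARD('n)\<close>.\<close>

type_synonym ('m, 'n) chart = "'m set \<times> ('m \<Rightarrow> real ^ 'n)"

definition is_chart :: "('m::topological_space, 'n::finite) chart \<Rightarrow> bool" where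
  "is_chart c \<longleftrightarrow> open (fst c) \<and> open (snd c ` fst c) \<and>
     homeomorphism (fst c) (snd c ` fst c) (snd c) (inv_into (fst c) (snd c))"

definition transition :: "('m, 'n::finite) chart \<Rightarrow> ('m, 'n) chart \<Rightarrow> real ^ 'n \<Rightarrow> real ^ 'n" where
  "transition c c' = snd c' \<circ> inv_into (fst c) (snd c)"

definition smooth_atlas ::
    "('m::{t2_space, second_countable_topology}, 'n::finite) chart set \<Rightarrow> bool" where
  "smooth_atlas A \<longleftrightarrow> (\<forall>c\<in>A. is_chart c) \<and> (\<Union>c\<in>A. fst c) = UNIV \<and>
     (\<forall>c\<in>A. \<forall>c'\<in>A. smooth_on (snd c ` (fst c \<inter> fst c')) (transition c c'))"


section \<open>The tangent bundle\<close>

text \<open>A tangent vector at \<open>p\<close> is the family \<open>\<xi>\<close> of its coordinate vectors \<open>\<xi> c\<close> in the charts \<open>c\<close> around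
  \<open>p\<close>, related by the differentials of the transition maps.  The value 0 at all other arguments
  makes the family unique.\<close>

type_synonym ('m, 'n) tvector = "'m \<times> (('m, 'n) chart \<Rightarrow> real ^ 'n)"

definition tangent_bundle :: "('m, 'n::finite) chart set \<Rightarrow> ('m, 'n) tvector set" where
  "tangent_bundle A = {(p, \<xi>).
     (\<forall>c\<in>A. \<forall>c'\<in>A. p \<in> fst c \<inter> fst c' \<longrightarrow>
        \<xi> c' = frechet_derivative (transition c c') (at (snd c p)) (\<xi> c)) \<and>
     (\<forall>c. \<not> (c \<in> A \<and> p \<in> fst c) \<longrightarrow> \<xi> c = 0)}"

definition bundle_chart :: "('m, 'n::finite) chart \<Rightarrow> ('m, 'n) tvector \<Rightarrow> (real ^ 'n) \<times> (real ^ 'n)" where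
  "bundle_chart c v = (snd c (fst v), snd v c)"

definition bundle_point ::
    "('m, 'n::finite) chart set \<Rightarrow> ('m, 'n) chart \<Rightarrow> (real ^ 'n) \<times> (real ^ 'n) \<Rightarrow> ('m, 'n) tvector" where
  "bundle_point A c = inv_into {v \<in> tangent_bundle A. fst v \<in> fst c} (bundle_chart c)"

text \<open>The coordinate range of \<open>TM\<^sub>0\<close> over a chart.\<close>

definition slit_domain :: "('m, 'n::finite) chart \<Rightarrow> ((real ^ 'n) \<times> (real ^ 'n)) set" where
  "slit_domain c = (snd c ` fst c) \<times> (UNIV - {0})"

definition local_rep ::
    "('m, 'n::finite) chart set \<Rightarrow> (('m, 'n) tvector \<Rightarrow> real) \<Rightarrow> ('m, 'n) chart \<Rightarrow>
     (real ^ 'n) \<times> (real ^ 'n) \<Rightarrow> real" where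
  "local_rep A f c = (\<lambda>z. f (bundle_point A c z))"

definition smooth_on_TM0 :: "('m, 'n::finite) chart set \<Rightarrow> (('m, 'n) tvector \<Rightarrow> real) \<Rightarrow> bool" where
  "smooth_on_TM0 A f \<longleftrightarrow> (\<forall>c\<in>A. smooth_on (slit_domain c) (local_rep A f c))"

definition pos_homogeneous1 :: "('m, 'n::finite) chart set \<Rightarrow> (('m, 'n) tvector \<Rightarrow> real) \<Rightarrow> bool" where
  "pos_homogeneous1 A f \<longleftrightarrow>
     (\<forall>(p, \<xi>)\<in>tangent_bundle A. \<forall>t>0. f (p, \<lambda>c. t *\<^sub>R \<xi> c) = t * f (p, \<xi>))"

lemma tangent_bundle_trans:
  assumes "(p, \<xi>) \<in> tangent_bundle A" "c \<in> A" "c' \<in> A" "p \<in> fst c" "p \<in> fst c'"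
  shows "\<xi> c' = frechet_derivative (transition c c') (at (snd c p)) (\<xi> c)"
  using assms unfolding tangent_bundle_def by blast

lemma tangent_bundle_zero:
  assumes "(p, \<xi>) \<in> tangent_bundle A" "\<not> (c \<in> A \<and> p \<in> fst c)"
  shows "\<xi> c = 0"
  using assms unfolding tangent_bundle_def by blast

lemma is_chart_inv [simp]:
  assumes "is_chart c" "p \<in> fst c"
  shows "inv_into (fst c) (snd c) (snd c p) = p"
  using assms unfolding is_chart_def homeomorphism_def by blast

lemma open_chart_overlap:
  assumes "is_chart c" "is_chart c'"
  shows "open (snd c ` (fst c \<inter> fst c'))"
proof -
  let ?g = "inv_into (fst c) (snd c)"
  have "continuous_on (snd c ` fst c) ?g" "open (snd c ` fst c)" "open (fst c')"
    using assms unfolding is_chart_def homeomorphism_def by blast+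
  then have "open (snd c ` fst c \<inter> ?g -` fst c')"
    by (rule continuous_open_preimage)
  moreover have "snd c ` fst c \<inter> ?g -` fst c' = snd c ` (fst c \<inter> fst c')"
    using is_chart_inv[OF assms(1)] by auto
  ultimately show ?thesis by simp
qed

lemma transition_has_derivative:
  assumes "smooth_atlas A" "c \<in> A" "c' \<in> A" "p \<in> fst c \<inter> fst c'"
  shows "(transition c c' has_derivative frechet_derivative (transition c c') (at (snd c p)))
           (at (snd c p))"
proof -
  have "C_k_on (Suc 0) (snd c ` (fst c \<inter> fst c')) (transition c c')"
    using assms by (auto simp only: smooth_atlas_def smooth_on_def)
  then have "transition c c' differentiable (at (snd c p))"
    using assms(4) by auto
  then show ?thesis by (simp add: frechet_derivative_works)
qed

lemma transition_cocycle:
  assumes A: "smooth_atlas A" and c: "c \<in> A" "c' \<in> A" "c'' \<in> A"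
    and p: "p \<in> fst c" "p \<in> fst c'" "p \<in> fst c''"
  shows "frechet_derivative (transition c' c'') (at (snd c' p))
           (frechet_derivative (transition c c') (at (snd c p)) v)
         = frechet_derivative (transition c c'') (at (snd c p)) v"
proof -
  have ch: "is_chart c" "is_chart c'" "is_chart c''" using A c by (auto simp: smooth_atlas_def)
  have t: "transition c c' (snd c p) = snd c' p"
    using ch p by (simp add: transition_def)
  have 1: "(transition c c' has_derivative frechet_derivative (transition c c') (at (snd c p)))
             (at (snd c p))"
    using transition_has_derivative[OF A] c p by blast
  have 2: "(transition c' c'' has_derivative frechet_derivative (transition c' c'') (at (snd c' p)))
             (at (transition c c' (snd c p)))"
    using transition_has_derivative[OF A] c p t by simp
  from diff_chain_at[OF 1 2]
  have "(transition c' c'' \<circ> transition c c' has_derivative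
          frechet_derivative (transition c' c'') (at (snd c' p)) \<circ>
          frechet_derivative (transition c c') (at (snd c p))) (at (snd c p))" .
  then have "(transition c c'' has_derivative
          frechet_derivative (transition c' c'') (at (snd c' p)) \<circ>
          frechet_derivative (transition c c') (at (snd c p))) (at (snd c p))"
    by (rule has_derivative_transform_within_open[OF _ open_chart_overlap[OF ch(1,2)]])
       (use ch p in \<open>auto simp: transition_def\<close>)
  from fun_cong[OF frechet_derivative_at[OF this], of v] show ?thesis by simp
qed

lemma transition_self:
  assumes "is_chart c" "p \<in> fst c"
  shows "frechet_derivative (transition c c) (at (snd c p)) v = v"
proof -
  have "((\<lambda>x. x) has_derivative (\<lambda>v. v)) (at (snd c p))" by simp
  moreover have "open (snd c ` fst c)" using assms(1) unfolding is_chart_def by blast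
  ultimately have "(transition c c has_derivative (\<lambda>v. v)) (at (snd c p))"
    by (rule has_derivative_transform_within_open)
       (use assms(2) in \<open>auto simp: transition_def f_inv_into_f\<close>)
  from fun_cong[OF frechet_derivative_at[OF this], of v] show ?thesis by simp
qed

text \<open>Hence \<open>bundle_point A c\<close> is a genuine inverse of the bundle chart.\<close>

lemma bundle_chart_bij:
  assumes A: "smooth_atlas A" and c: "c \<in> A"
  shows "bij_betw (bundle_chart c) {v \<in> tangent_bundle A. fst v \<in> fst c} ((snd c ` fst c) \<times> UNIV)"
  unfolding bij_betw_def
proof
  have ch: "\<And>c. c \<in> A \<Longrightarrow> is_chart c" using A by (auto simp: smooth_atlas_def)
  show "inj_on (bundle_chart c) {v \<in> tangent_bundle A. fst v \<in> fst c}"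
  proof (rule inj_onI)
    fix v w
    assume vw: "v \<in> {v \<in> tangent_bundle A. fst v \<in> fst c}"
      "w \<in> {v \<in> tangent_bundle A. fst v \<in> fst c}" "bundle_chart c v = bundle_chart c w"
    obtain p \<xi> q \<eta> where v: "v = (p, \<xi>)" and w: "w = (q, \<eta>)" by (metis prod.exhaust)
    have *: "(p, \<xi>) \<in> tangent_bundle A" "(q, \<eta>) \<in> tangent_bundle A" "p \<in> fst c" "q \<in> fst c"
      "snd c p = snd c q" "\<xi> c = \<eta> c"
      using vw unfolding v w bundle_chart_def by simp_all
    have pq: "p = q"
      using is_chart_inv[OF ch[OF c] *(3)] unfolding *(5) is_chart_inv[OF ch[OF c] *(4)] by (rule sym)
    have "\<xi> d = \<eta> d" for d
    proof (cases "d \<in> A \<and> p \<in> fst d")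
      case True
      have "\<xi> d = frechet_derivative (transition c d) (at (snd c p)) (\<xi> c)"
        "\<eta> d = frechet_derivative (transition c d) (at (snd c p)) (\<eta> c)"
        using tangent_bundle_trans[OF *(1) c _ *(3), of d] True apply blast
        using tangent_bundle_trans[OF *(2) c _ *(4), of d] True unfolding pq apply blast
        done
      then show ?thesis unfolding *(6) by (rule trans[OF _ sym])
    next
      case False
      then show ?thesis
        using tangent_bundle_zero[OF *(1)] tangent_bundle_zero[OF *(2)] pq by metis
    qed
    then show "v = w" unfolding v w using pq by blast
  qed
  show "bundle_chart c ` {v \<in> tangent_bundle A. fst v \<in> fst c} = (snd c ` fst c) \<times> UNIV"
  proof (intro equalityI subsetI)
    fix z assume "z \<in> (snd c ` fst c) \<times> (UNIV :: (real ^ 'b) set)"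
    then obtain p y where z: "z = (snd c p, y)" and p: "p \<in> fst c" by auto
    define \<xi> where "\<xi> d = (if d \<in> A \<and> p \<in> fst d
        then frechet_derivative (transition c d) (at (snd c p)) y else 0)" for d
    have "(p, \<xi>) \<in> tangent_bundle A"
      unfolding tangent_bundle_def \<xi>_def using p c transition_cocycle[OF A] by simp
    moreover have "\<xi> c = y" using p c ch by (simp add: \<xi>_def transition_self)
    ultimately show "z \<in> bundle_chart c ` {v \<in> tangent_bundle A. fst v \<in> fst c}"
      using z p by (intro image_eqI[where x = "(p, \<xi>)"]) (auto simp: bundle_chart_def)
  qed (auto simp: bundle_chart_def)
qed


section \<open>Local formulas of Finsler geometry\<close>

text \<open>In the induced coordinates \<open>(x, y)\<close> of \<open>TM\<close>: \<open>dx k\<close> is \<open>\<partial>/\<partial>x\<^sup>k\<close> and \<open>dy k\<close> is \<open>\<partial>/\<partial>y\<^sup>k\<close>.\<close>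

type_synonym 'n coords = "(real ^ 'n) \<times> (real ^ 'n)"

definition dx :: "'n::finite \<Rightarrow> ('n coords \<Rightarrow> real) \<Rightarrow> 'n coords \<Rightarrow> real" where
  "dx k f z = frechet_derivative f (at z) (axis k 1, 0)"

definition dy :: "'n::finite \<Rightarrow> ('n coords \<Rightarrow> real) \<Rightarrow> 'n coords \<Rightarrow> real" where
  "dy k f z = frechet_derivative f (at z) (0, axis k 1)"

definition fundamental_tensor :: "('n::finite coords \<Rightarrow> real) \<Rightarrow> 'n coords \<Rightarrow> real ^ 'n ^ 'n" where
  "fundamental_tensor f z = (\<chi> i j. 1/2 * dy i (dy j (\<lambda>z. (f z)\<^sup>2)) z)"

definition spray :: "('n::finite coords \<Rightarrow> real) \<Rightarrow> 'n \<Rightarrow> 'n coords \<Rightarrow> real" where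
  "spray f i z = 1/4 * (\<Sum>l\<in>UNIV. matrix_inv (fundamental_tensor f z) $ i $ l *
     ((\<Sum>k\<in>UNIV. dx k (dy l (\<lambda>z. (f z)\<^sup>2)) z * snd z $ k) - dx l (\<lambda>z. (f z)\<^sup>2) z))"

text \<open>Components of a tensor \<open>T\<^sub>j\<^sup>i\<^sub>k\<^sub>l\<close> are written \<open>T j i k l\<close>.\<close>

type_synonym 'n tensor13 = "'n \<Rightarrow> 'n \<Rightarrow> 'n \<Rightarrow> 'n \<Rightarrow> 'n coords \<Rightarrow> real"

definition douglas :: "('n::finite coords \<Rightarrow> real) \<Rightarrow> 'n tensor13" where
  "douglas f j i k l = dy j (dy k (dy l (\<lambda>z.
     spray f i z - 1 / (real CARD('n) + 1) * (\<Sum>m\<in>UNIV. dy m (spray f m) z) * snd z $ i)))"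

text \<open>The horizontal Berwald derivative \<open>T\<^sub>j\<^sup>i\<^sub>k\<^sub>l\<^sub>|\<^sub>m\<close> and its contraction with \<open>y\<close>.\<close>

definition berwald_hderiv :: "('n::finite coords \<Rightarrow> real) \<Rightarrow> 'n \<Rightarrow> 'n tensor13 \<Rightarrow> 'n tensor13" where
  "berwald_hderiv f m T j i k l z =
     dx m (T j i k l) z
     - (\<Sum>r\<in>UNIV. dy m (spray f r) z * dy r (T j i k l) z)
     + (\<Sum>r\<in>UNIV. T j r k l z * dy m (dy r (spray f i)) z)
     - (\<Sum>r\<in>UNIV. T r i k l z * dy m (dy j (spray f r)) z)
     - (\<Sum>r\<in>UNIV. T j i r l z * dy m (dy k (spray f r)) z)
     - (\<Sum>r\<in>UNIV. T j i k r z * dy m (dy l (spray f r)) z)"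

definition berwald_hderiv0 :: "('n::finite coords \<Rightarrow> real) \<Rightarrow> 'n tensor13 \<Rightarrow> 'n tensor13" where
  "berwald_hderiv0 f T j i k l z = (\<Sum>m\<in>UNIV. berwald_hderiv f m T j i k l z * snd z $ m)"

definition douglas_tilde :: "('n::finite coords \<Rightarrow> real) \<Rightarrow> 'n tensor13" where
  "douglas_tilde f = berwald_hderiv0 f (douglas f)"


section \<open>Finsler metrics, projective equivalence and W-GDW-metrics\<close>

definition finsler_metric :: "('m, 'n::finite) chart set \<Rightarrow> (('m, 'n) tvector \<Rightarrow> real) \<Rightarrow> bool" where
  "finsler_metric A F \<longleftrightarrow>
     (\<forall>v\<in>tangent_bundle A. 0 \<le> F v) \<and>
     smooth_on_TM0 A F \<and>
     pos_homogeneous1 A F \<and>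
     (\<forall>c\<in>A. \<forall>z\<in>slit_domain c. \<forall>w. w \<noteq> 0 \<longrightarrow>
        0 < (\<Sum>i\<in>UNIV. \<Sum>j\<in>UNIV. fundamental_tensor (local_rep A F c) z $ i $ j * w $ i * w $ j))"

definition projectively_equivalent ::
    "('m, 'n::finite) chart set \<Rightarrow> (('m, 'n) tvector \<Rightarrow> real) \<Rightarrow> (('m, 'n) tvector \<Rightarrow> real) \<Rightarrow> bool" where
  "projectively_equivalent A F Fbar \<longleftrightarrow> (\<exists>P. pos_homogeneous1 A P \<and>
     (\<forall>c\<in>A. \<forall>z\<in>slit_domain c. \<forall>i.
        spray (local_rep A Fbar c) i z
          = spray (local_rep A F c) i z + local_rep A P c z * snd z $ i))"

text \<open>A covariant tensor field of degree 3 along \<open>TM\<^sub>0\<close>: its components \<open>U c j k l (x, y)\<close> in the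
  charts \<open>c\<close> transform with the Jacobian matrix of the coordinate change on \<open>M\<close>.\<close>

definition jacobian :: "('m, 'n::finite) chart \<Rightarrow> ('m, 'n) chart \<Rightarrow> 'm \<Rightarrow> 'n \<Rightarrow> 'n \<Rightarrow> real" where
  "jacobian c c' p a j = frechet_derivative (transition c c') (at (snd c p)) (axis j 1) $ a"

type_synonym ('m, 'n) components3 =
  "('m, 'n) chart \<Rightarrow> 'n \<Rightarrow> 'n \<Rightarrow> 'n \<Rightarrow> 'n coords \<Rightarrow> real"

definition tensor_field3 :: "('m, 'n::finite) chart set \<Rightarrow> ('m, 'n) components3 \<Rightarrow> bool" where
  "tensor_field3 A U \<longleftrightarrow>
     (\<forall>c\<in>A. \<forall>c'\<in>A. \<forall>v\<in>tangent_bundle A. fst v \<in> fst c \<inter> fst c' \<and> snd v c \<noteq> 0 \<longrightarrow>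
        (\<forall>j k l. U c j k l (bundle_chart c v) =
           (\<Sum>a\<in>UNIV. \<Sum>b\<in>UNIV. \<Sum>d\<in>UNIV.
              jacobian c c' (fst v) a j * jacobian c c' (fst v) b k * jacobian c c' (fst v) d l *
              U c' a b d (bundle_chart c' v))))"

definition W_GDW_equation ::
    "('m, 'n::finite) chart set \<Rightarrow> (('m, 'n) tvector \<Rightarrow> real) \<Rightarrow> (('m, 'n) tvector \<Rightarrow> real) \<Rightarrow>
     ('m, 'n) components3 \<Rightarrow> bool" where
  "W_GDW_equation A F lam U \<longleftrightarrow> (\<forall>c\<in>A. \<forall>z\<in>slit_domain c. \<forall>j i k l.
     (let f = local_rep A F c in
        berwald_hderiv0 f (douglas_tilde f) j i k l z
          + local_rep A lam c z * f z * douglas_tilde f j i k l z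
        = U c j k l z * snd z $ i))"

text \<open>No regularity of the scalar function \<open>\<lambda>\<close> and the tensor field \<open>U\<close> is required in the first notion;
  the second one asks both to be smooth on \<open>TM\<^sub>0\<close>.\<close>

definition W_GDW_metric :: "('m, 'n::finite) chart set \<Rightarrow> (('m, 'n) tvector \<Rightarrow> real) \<Rightarrow> bool" where
  "W_GDW_metric A F \<longleftrightarrow> finsler_metric A F \<and>
     (\<exists>lam U. tensor_field3 A U \<and> W_GDW_equation A F lam U)"

definition smooth_W_GDW_metric :: "('m, 'n::finite) chart set \<Rightarrow> (('m, 'n) tvector \<Rightarrow> real) \<Rightarrow> bool" where
  "smooth_W_GDW_metric A F \<longleftrightarrow> finsler_metric A F \<and>
     (\<exists>lam U. smooth_on_TM0 A lam \<and>
        tensor_field3 A U \<and> (\<forall>c\<in>A. \<forall>j k l. smooth_on (slit_domain c) (U c j k l)) \<and>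
        W_GDW_equation A F lam U)"

end

theory Submission
  imports Defs
begin

text \<open>
  Writing \<open>T\<^sub>|\<^sub>0\<close> as the derivative of \<open>T\<close> along the spray plus connection terms, a projective change
  \<open>G + P y\<close> of the spray alters it, for \<open>T\<close> of degree \<open>s\<close> in \<open>y\<close> and annihilated by \<open>y\<close> in its lower
  indices, only by \<open>- (2 s + 2) P T\<close> and a multiple of \<open>y\<close>.  The Douglas tensor is invariant and has
  degree \<open>-1\<close>, so its derivative changes by a multiple of \<open>y\<close>; that derivative has degree 0, so the second
  derivative changes by \<open>-2 P\<close> times the first and a multiple of \<open>y\<close>.  Hence the W-GDW equation
  persists with \<open>(\<lambda> F + 2 P) / F'\<close> in place of \<open>\<lambda>\<close>, \<open>F'\<close> being the new metric.

  The new coefficients \<open>U\<close> form a tensor because the left-hand side of the equation does.  That rests on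
  the transformation law of the spray, obtained from its characterization by the Euler--Lagrange equations.
\<close>

section \<open>Smooth functions\<close>

text \<open>The vector \<open>y\<close> is parallel along a spray \<open>G\<close>: the spray vector
  field takes \<open>y^i\<close> to \<open>- 2 G^i\<close>, and the connection term restores
  \<open>2 G^i\<close>. So multiples of \<open>y\<close> in the upper index stay multiples of
  \<open>y\<close> under differentiation, and tensors annihilated by \<open>y\<close> in their lower
  indices stay so. Both facts are indispensable because the first derivative of the Douglas tensor
  is invariant only modulo \<open>y\<close> and then has to be differentiated again. Regularity is
  the other obstacle. \<open>P\<close> is given only as a homogeneous function; it can be
  differentiated once \<open>P y\<close> is recognised as the difference of two smooth sprays. The
  scalar and the coefficients \<open>U\<close> may be arbitrary functions and are never
  differentiated. The new \<open>U\<close> is chosen separately for each chart, point and index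
  triple, which is why its tensor law has to be read off the equation afterwards. Division by the
  new metric is legitimate because \<open>g_ij y^i y^j = F^2\<close> keeps a Finsler metric away
  from 0 off the zero section.\<close>

definition dd :: "'a::euclidean_space \<Rightarrow> ('a \<Rightarrow> 'b::real_normed_vector) \<Rightarrow> 'a \<Rightarrow> 'b" where
  "dd v f x = frechet_derivative f (at x) v"

lemma dd_eqI: "(f has_derivative f') (at x) \<Longrightarrow> dd v f x = f' v"
  unfolding dd_def using frechet_derivative_at by metis

lemma has_derivative_dd:
  "f differentiable (at x) \<Longrightarrow> (f has_derivative (\<lambda>v. dd v f x)) (at x)"
  unfolding dd_def by (simp add: frechet_derivative_works)

text \<open>No differentiability is assumed: functions agreeing near \<open>x\<close> satisfy the
  same \<open>has_derivative\<close> statements, so the choice inside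
  \<open>frechet_derivative\<close> selects the same map for both.\<close>

lemma dd_cong:
  assumes "open S" "x \<in> S" "\<And>x. x \<in> S \<Longrightarrow> f x = g x"
  shows "dd v f x = dd v g x"
proof -
  have "(f has_derivative f') (at x) \<longleftrightarrow> (g has_derivative f') (at x)" for f'
    using has_derivative_transform_within_open[OF _ assms(1,2)] assms(3) by metis
  then show ?thesis by (simp add: dd_def frechet_derivative_def)
qed

lemma differentiable_cong_open:
  assumes "open S" "x \<in> S" "\<And>x. x \<in> S \<Longrightarrow> f x = g x" "f differentiable (at x)"
  shows "g differentiable (at x)"
  using has_derivative_transform_within_open[OF _ assms(1,2)] assms(3,4)
  unfolding differentiable_def by metis

lemma dd_const [simp]: "dd v (\<lambda>x. c) = (\<lambda>x. 0)"
  by (rule ext) (simp add: dd_def)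

lemma dd_bounded_linear: "bounded_linear f \<Longrightarrow> dd v f x = f v"
  by (rule dd_eqI) (rule bounded_linear_imp_has_derivative)

lemma dd_plus:
  assumes "f differentiable (at x)" "g differentiable (at x)"
  shows "dd v (\<lambda>x. f x + g x) x = dd v f x + dd v g x"
  by (rule dd_eqI) (intro has_derivative_add has_derivative_dd assms)

lemma dd_minus:
  assumes "f differentiable (at x)" "g differentiable (at x)"
  shows "dd v (\<lambda>x. f x - g x) x = dd v f x - dd v g x"
  by (rule dd_eqI) (intro has_derivative_diff has_derivative_dd assms)

lemma dd_mult:
  fixes f g :: "_ \<Rightarrow> real"
  assumes "f differentiable (at x)" "g differentiable (at x)"
  shows "dd v (\<lambda>x. f x * g x) x = f x * dd v g x + dd v f x * g x"
  by (rule dd_eqI) (intro has_derivative_mult has_derivative_dd assms)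

lemma dd_sum:
  assumes "\<And>i. i \<in> I \<Longrightarrow> f i differentiable (at x)"
  shows "dd v (\<lambda>x. \<Sum>i\<in>I. f i x) x = (\<Sum>i\<in>I. dd v (f i) x)"
  by (rule dd_eqI) (intro has_derivative_sum has_derivative_dd assms)

lemma dd_chain:
  assumes "g differentiable (at x)" "f differentiable (at (g x))"
  shows "dd v (\<lambda>x. f (g x)) x = dd (dd v g x) f (g x)"
  using has_derivative_compose[OF has_derivative_dd[OF assms(1)] has_derivative_dd[OF assms(2)]]
  by (rule dd_eqI)

lemma dd_direction_add: "f differentiable (at x) \<Longrightarrow> dd (v + w) f x = dd v f x + dd w f x"
  unfolding dd_def by (intro linear_add linear_frechet_derivative)

lemma dd_direction_scaleR: "f differentiable (at x) \<Longrightarrow> dd (r *\<^sub>R v) f x = r *\<^sub>R dd v f x"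
  unfolding dd_def by (intro linear_cmul linear_frechet_derivative)

lemma dd_direction_sum:
  "f differentiable (at x) \<Longrightarrow> dd (\<Sum>i\<in>I. v i) f x = (\<Sum>i\<in>I. dd (v i) f x)"
  unfolding dd_def by (intro linear_sum linear_frechet_derivative)

lemma C_k_on_Suc_dd:
  "C_k_on (Suc k) S f \<longleftrightarrow> (\<forall>x\<in>S. f differentiable (at x)) \<and> (\<forall>v. C_k_on k S (dd v f))"
  by (simp add: dd_def[abs_def])

lemma C_k_on_cong:
  assumes "open S" "\<And>x. x \<in> S \<Longrightarrow> f x = g x"
  shows "C_k_on k S f \<longleftrightarrow> C_k_on k S g"
  using assms(2)
proof (induction k arbitrary: f g)
  case 0
  then show ?case by (simp cong: continuous_on_cong)
next
  case (Suc k)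
  have "C_k_on k S (dd v f) \<longleftrightarrow> C_k_on k S (dd v g)" for v
    using dd_cong[OF assms(1) _ Suc.prems] by (intro Suc.IH) auto
  moreover have "(\<forall>x\<in>S. f differentiable (at x)) \<longleftrightarrow> (\<forall>x\<in>S. g differentiable (at x))"
    using differentiable_cong_open[OF assms(1)] Suc.prems by metis
  ultimately show ?case unfolding C_k_on_Suc_dd by blast
qed

lemma C_k_on_transform:
  assumes "open S" "C_k_on k S g" "\<And>x. x \<in> S \<Longrightarrow> f x = g x"
  shows "C_k_on k S f"
  using C_k_on_cong[OF assms(1), of f g] assms(2,3) by blast

lemma C_k_on_SucD: "C_k_on (Suc k) S f \<Longrightarrow> C_k_on k S f"
proof (induction k arbitrary: f)
  case 0
  then show ?case
    by (auto intro!: continuous_at_imp_continuous_on differentiable_imp_continuous_within)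
next
  case (Suc k)
  then show ?case unfolding C_k_on_Suc_dd by blast
qed

lemma smooth_on_differentiable: "smooth_on S f \<Longrightarrow> x \<in> S \<Longrightarrow> f differentiable (at x)"
  unfolding smooth_on_def using C_k_on.simps(2) by blast

lemma smooth_on_dd: "smooth_on S f \<Longrightarrow> smooth_on S (dd v f)"
  unfolding smooth_on_def using C_k_on_Suc_dd by blast

lemma smooth_on_continuous: "smooth_on S f \<Longrightarrow> continuous_on S f"
  unfolding smooth_on_def using C_k_on.simps(1) by blast

lemma smooth_on_transform:
  assumes "open S" "smooth_on S g" "\<And>x. x \<in> S \<Longrightarrow> f x = g x"
  shows "smooth_on S f"
  using C_k_on_transform[OF assms(1), of _ g f] assms(2,3) unfolding smooth_on_def by blast

lemma smooth_on_subset: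
  assumes "smooth_on S f" "T \<subseteq> S"
  shows "smooth_on T f"
proof -
  have "C_k_on k S f \<Longrightarrow> C_k_on k T f" for k
    using assms(2) by (induction k arbitrary: f) (auto intro: continuous_on_subset)
  with assms(1) show ?thesis by (simp add: smooth_on_def)
qed

lemma C_k_on_const: "C_k_on k S (\<lambda>x. c)"
  by (induction k arbitrary: c) (simp_all add: continuous_on_const)

lemma smooth_on_const: "smooth_on S (\<lambda>x. c)"
  by (simp add: smooth_on_def C_k_on_const)

lemma smooth_on_bounded_linear:
  assumes "bounded_linear f"
  shows "smooth_on S f"
proof -
  have "C_k_on k S f" for k
  proof (cases k)
    case 0
    then show ?thesis using assms by (simp add: linear_continuous_on)
  next
    case (Suc n)
    have "f differentiable (at x)" for x
      using assms by (rule bounded_linear_imp_differentiable)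
    moreover have "dd v f = (\<lambda>x. f v)" for v
      using dd_bounded_linear[OF assms] by blast
    ultimately show ?thesis unfolding Suc C_k_on_Suc_dd by (simp add: C_k_on_const)
  qed
  then show ?thesis by (simp add: smooth_on_def)
qed

lemma C_k_on_add:
  assumes "open S" "C_k_on k S f" "C_k_on k S g"
  shows "C_k_on k S (\<lambda>x. f x + g x)"
  using assms(2,3)
proof (induction k arbitrary: f g)
  case 0
  then show ?case by (simp add: continuous_on_add)
next
  case (Suc k)
  have "C_k_on k S (dd v (\<lambda>x. f x + g x))" for v
    using Suc C_k_on_cong[OF assms(1), of "dd v (\<lambda>x. f x + g x)" "\<lambda>x. dd v f x + dd v g x"]
    unfolding C_k_on_Suc_dd by (simp add: dd_plus)
  then show ?case using Suc.prems unfolding C_k_on_Suc_dd by (simp add: differentiable_add)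
qed

lemma C_k_on_mult:
  fixes f g :: "_ \<Rightarrow> real"
  assumes "open S" "C_k_on k S f" "C_k_on k S g"
  shows "C_k_on k S (\<lambda>x. f x * g x)"
  using assms(2,3)
proof (induction k arbitrary: f g)
  case 0
  then show ?case by (simp add: continuous_on_mult)
next
  case (Suc k)
  have "C_k_on k S (dd v (\<lambda>x. f x * g x))" for v
  proof -
    have "C_k_on k S (\<lambda>x. f x * dd v g x + dd v f x * g x)"
    proof (intro C_k_on_add assms(1) Suc.IH)
      show "C_k_on k S f" "C_k_on k S g"
        using Suc.prems C_k_on_SucD by blast+
      show "C_k_on k S (dd v f)" "C_k_on k S (dd v g)"
        using Suc.prems unfolding C_k_on_Suc_dd by blast+
    qed
    moreover have "dd v (\<lambda>x. f x * g x) x = f x * dd v g x + dd v f x * g x" if "x \<in> S" for x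
      using Suc.prems that unfolding C_k_on_Suc_dd by (simp add: dd_mult)
    ultimately show ?thesis by (rule C_k_on_transform[OF assms(1)])
  qed
  then show ?case using Suc.prems unfolding C_k_on_Suc_dd by (simp add: differentiable_mult)
qed

text \<open>In the derivative \<open>- (1/f) * Df * (1/f)\<close> the reciprocal occurs only to
  order \<open>k\<close>, where the induction hypothesis covers it; the product rule for class C^k
  does the rest.\<close>

lemma C_k_on_inverse:
  fixes f :: "_ \<Rightarrow> real"
  assumes "open S" "\<And>x. x \<in> S \<Longrightarrow> f x \<noteq> 0" "C_k_on k S f"
  shows "C_k_on k S (\<lambda>x. inverse (f x))"
  using assms(3)
proof (induction k)
  case 0
  then show ?case using assms(2) by (simp add: continuous_on_inverse)
next
  case (Suc k)
  have *: "C_k_on k S (\<lambda>x. inverse (f x))" using Suc C_k_on_SucD by blast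
  have "C_k_on k S (dd v (\<lambda>x. inverse (f x)))" for v
  proof -
    have "C_k_on k S (\<lambda>x. (-1) * (inverse (f x) * dd v f x * inverse (f x)))"
      using Suc.prems by (intro C_k_on_mult C_k_on_const assms(1) *) (simp only: C_k_on_Suc_dd)
    moreover have "dd v (\<lambda>x. inverse (f x)) x = (-1) * (inverse (f x) * dd v f x * inverse (f x))"
      if "x \<in> S" for x
    proof -
      have "f differentiable (at x)" using Suc.prems that unfolding C_k_on_Suc_dd by blast
      from Deriv.has_derivative_inverse[OF assms(2)[OF that] has_derivative_dd[OF this]]
      show ?thesis by (subst dd_eqI) simp_all
    qed
    ultimately show ?thesis by (rule C_k_on_transform[OF assms(1)])
  qed
  then show ?case using Suc.prems assms(2) unfolding C_k_on_Suc_dd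
    by (simp add: differentiable_inverse)
qed

lemma smooth_on_add:
  "open S \<Longrightarrow> smooth_on S f \<Longrightarrow> smooth_on S g \<Longrightarrow> smooth_on S (\<lambda>x. f x + g x)"
  by (simp add: smooth_on_def C_k_on_add)

lemma smooth_on_mult:
  fixes f g :: "_ \<Rightarrow> real"
  shows "open S \<Longrightarrow> smooth_on S f \<Longrightarrow> smooth_on S g \<Longrightarrow> smooth_on S (\<lambda>x. f x * g x)"
  by (simp add: smooth_on_def C_k_on_mult)

lemma smooth_on_diff:
  fixes f g :: "_ \<Rightarrow> real"
  assumes "open S" "smooth_on S f" "smooth_on S g"
  shows "smooth_on S (\<lambda>x. f x - g x)"
  using smooth_on_add[OF assms(1,2) smooth_on_mult[OF assms(1) smooth_on_const[of S "-1"] assms(3)]]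
  by simp

lemma smooth_on_divide:
  fixes f g :: "_ \<Rightarrow> real"
  assumes "open S" "smooth_on S f" "smooth_on S g" "\<And>x. x \<in> S \<Longrightarrow> g x \<noteq> 0"
  shows "smooth_on S (\<lambda>x. f x / g x)"
  unfolding divide_inverse using assms
  by (intro smooth_on_mult) (auto simp: smooth_on_def intro: C_k_on_inverse)

lemma smooth_on_sum:
  assumes "open S" "\<And>i. i \<in> I \<Longrightarrow> smooth_on S (f i)"
  shows "smooth_on S (\<lambda>x. \<Sum>i\<in>I. f i x)"
  using assms(2)
  by (induction I rule: infinite_finite_induct)
    (simp_all add: smooth_on_const smooth_on_add assms(1))

lemma smooth_on_prod:
  fixes f :: "_ \<Rightarrow> _ \<Rightarrow> real"
  assumes "open S" "\<And>i. i \<in> I \<Longrightarrow> smooth_on S (f i)"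
  shows "smooth_on S (\<lambda>x. \<Prod>i\<in>I. f i x)"
  using assms(2)
  by (induction I rule: infinite_finite_induct)
    (simp_all add: smooth_on_const smooth_on_mult assms(1))

text \<open>Differentiating in direction \<open>v\<close> replaces \<open>f\<close> by
  \<open>dd (L v) f\<close> under the same \<open>L\<close>, so the induction runs over
  \<open>f\<close> and the chain rule produces no sum. The main use is to lift functions of the base
  point along \<open>fst\<close>.\<close>

lemma smooth_on_compose_linear:
  fixes L :: "'a::euclidean_space \<Rightarrow> 'b::euclidean_space"
  assumes "bounded_linear L" "open S" "smooth_on T f" "L ` S \<subseteq> T"
  shows "smooth_on S (\<lambda>x. f (L x))"
proof -
  have "C_k_on k T f \<Longrightarrow> C_k_on k S (\<lambda>x. f (L x))" for k
  proof (induction k arbitrary: f)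
    case 0
    then show ?case using assms(1,4)
      by (auto intro: continuous_on_compose2[of T f S L] linear_continuous_on)
  next
    case (Suc k)
    have L: "L differentiable (at x)" for x
      using assms(1) by (rule bounded_linear_imp_differentiable)
    have f: "f differentiable (at (L x))" if "x \<in> S" for x
      using Suc.prems that assms(4) unfolding C_k_on_Suc_dd by blast
    have eq: "dd v (\<lambda>x. f (L x)) x = dd (L v) f (L x)" if "x \<in> S" for x v
      using dd_chain[OF L f[OF that]] dd_bounded_linear[OF assms(1)] by simp
    have "C_k_on k S (\<lambda>x. dd (L v) f (L x))" for v
      using Suc unfolding C_k_on_Suc_dd by blast
    then have "C_k_on k S (dd v (\<lambda>x. f (L x)))" for v
      by (subst C_k_on_cong[OF assms(2) eq])
    then show ?case
      unfolding C_k_on_Suc_dd using f L differentiable_compose[of f L] by blast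
  qed
  with assms(3) show ?thesis by (simp add: smooth_on_def)
qed

lemma smooth_on_linear_compose:
  assumes "bounded_linear L" "open S" "smooth_on S f"
  shows "smooth_on S (\<lambda>x. L (f x))"
proof -
  have "C_k_on k S f \<Longrightarrow> C_k_on k S (\<lambda>x. L (f x))" for k
  proof (induction k arbitrary: f)
    case 0
    then show ?case using assms(1) by (simp add: bounded_linear.continuous_on)
  next
    case (Suc k)
    have f: "((\<lambda>x. L (f x)) has_derivative (\<lambda>v. L (dd v f x))) (at x)" if "x \<in> S" for x
      using Suc.prems that unfolding C_k_on_Suc_dd
      by (intro bounded_linear.has_derivative[OF assms(1)] has_derivative_dd) blast
    have "C_k_on k S (\<lambda>x. L (dd v f x))" for v
      using Suc unfolding C_k_on_Suc_dd by blast
    then have "C_k_on k S (dd v (\<lambda>x. L (f x)))" for v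
      by (subst C_k_on_cong[OF assms(2) dd_eqI[OF f]])
    then show ?case
      unfolding C_k_on_Suc_dd using f differentiable_def by blast
  qed
  with assms(3) show ?thesis by (simp add: smooth_on_def)
qed

section \<open>Determinants and inverse matrices with smooth entries\<close>

lemma smooth_on_det:
  fixes M :: "'a::euclidean_space \<Rightarrow> real ^ 'n ^ 'n"
  assumes "open S" "\<And>i j. smooth_on S (\<lambda>x. M x $ i $ j)"
  shows "smooth_on S (\<lambda>x. det (M x))"
  unfolding det_def
  by (intro smooth_on_sum smooth_on_mult smooth_on_prod smooth_on_const assms)

lemma matrix_inv_works:
  assumes "invertible M"
  shows "M ** matrix_inv M = mat 1" "matrix_inv M ** M = mat 1"
  using someI_ex[OF assms[unfolded invertible_def]] unfolding matrix_inv_def by blast+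

text \<open>Cramer's rule, column by column. \<open>matrix_inv\<close> is defined by choice, so
  smoothness of its entries has to come from an explicit quotient of determinants.\<close>

lemma matrix_inv_entry:
  fixes M :: "real ^ 'n ^ 'n"
  assumes "invertible M"
  shows "matrix_inv M $ i $ j =
    det (\<chi> a b. if b = i then (if a = j then 1 else 0) else M $ a $ b) / det M"
proof -
  have "M ** matrix_inv M = mat 1"
    using assms by (rule matrix_inv_works)
  then have "M *v (column j (matrix_inv M)) = axis j 1"
    by (simp add: vec_eq_iff matrix_vector_mult_def matrix_matrix_mult_def column_def mat_def axis_def)
  moreover have det: "det M \<noteq> 0" using assms by (simp add: invertible_det_nz)
  ultimately have "column j (matrix_inv M) =
      (\<chi> k. det (\<chi> a b. if b = k then axis j 1 $ a else M $ a $ b) / det M)"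
    using cramer[OF det] by blast
  then have "column j (matrix_inv M) $ i =
      det (\<chi> a b. if b = i then axis j 1 $ a else M $ a $ b) / det M"
    by simp
  then show ?thesis by (simp add: column_def axis_def cong: if_cong)
qed

lemma smooth_on_matrix_inv:
  fixes M :: "'a::euclidean_space \<Rightarrow> real ^ 'n ^ 'n"
  assumes "open S" "\<And>i j. smooth_on S (\<lambda>x. M x $ i $ j)" "\<And>x. x \<in> S \<Longrightarrow> invertible (M x)"
  shows "smooth_on S (\<lambda>x. matrix_inv (M x) $ i $ j)"
proof -
  show ?thesis
  proof (rule smooth_on_transform[OF assms(1) _ matrix_inv_entry[OF assms(3)]])
    show "smooth_on S (\<lambda>x. det (\<chi> a b. if b = i then (if a = j then 1 else 0) else M x $ a $ b)
      / det (M x))"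
  proof (intro smooth_on_divide smooth_on_det assms(1,2))
    show "smooth_on S (\<lambda>x. (\<chi> a b. if b = i then (if a = j then 1 else 0) else M x $ a $ b) $ a $ b)"
      for a b
      using assms(2) by (cases "b = i") (simp_all add: smooth_on_const)
    show "det (M x) \<noteq> 0" if "x \<in> S" for x
      using assms(3)[OF that] by (simp add: invertible_det_nz)
  qed
qed
qed

section \<open>Symmetry of second derivatives and the chain rule for smooth maps\<close>

lemma second_difference_mean_value:
  fixes f :: "'a::euclidean_space \<Rightarrow> real"
  assumes "0 < h" and cv: "\<And>s t. 0 \<le> s \<Longrightarrow> s \<le> h \<Longrightarrow> 0 \<le> t \<Longrightarrow> t \<le> h \<Longrightarrow> x + s *\<^sub>R u + t *\<^sub>R v \<in> S"
    and f: "\<And>x. x \<in> S \<Longrightarrow> f differentiable (at x)"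
    and fu: "\<And>x. x \<in> S \<Longrightarrow> dd u f differentiable (at x)"
  obtains s t where "0 < s" "s < h" "0 < t" "t < h"
    "f (x + h *\<^sub>R u + h *\<^sub>R v) - f (x + h *\<^sub>R u) - f (x + h *\<^sub>R v) + f x
      = h * h * dd v (dd u f) (x + s *\<^sub>R u + t *\<^sub>R v)"
proof -
  have line: "((\<lambda>s. g (a + s *\<^sub>R w)) has_real_derivative dd w g (a + s *\<^sub>R w)) (at s)"
    if "g differentiable (at (a + s *\<^sub>R w))" for g :: "'a \<Rightarrow> real" and a w s
  proof -
    have "((\<lambda>s. a + s *\<^sub>R w) has_derivative (\<lambda>r. r *\<^sub>R w)) (at s)"
      by (auto intro!: derivative_eq_intros)
    from has_derivative_compose[OF this has_derivative_dd[OF that]]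
    show ?thesis
      using dd_direction_scaleR[OF that] by (simp add: has_field_derivative_def mult_commute_abs)
  qed
  \<comment> \<open>\<open>p s\<close> is the difference of \<open>f\<close> across the side
    \<open>h v\<close>. The mean value theorem in \<open>s\<close>, then in \<open>t\<close>, turns
    the second difference into a mixed derivative at an interior point.\<close>
  define p where "p s = f ((x + h *\<^sub>R v) + s *\<^sub>R u) - f (x + s *\<^sub>R u)" for s
  have in1: "x + s *\<^sub>R u + h *\<^sub>R v \<in> S" "x + s *\<^sub>R u \<in> S" if "0 \<le> s" "s \<le> h" for s
    using cv[of s h] cv[of s 0] that assms(1) by simp_all
  have "\<exists>s>0. s < h \<and> p h - p 0
      = (h - 0) * (dd u f ((x + h *\<^sub>R v) + s *\<^sub>R u) - dd u f (x + s *\<^sub>R u))"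
    unfolding p_def using assms(1)
    by (intro MVT2 DERIV_diff line f) (use in1 in \<open>auto simp: algebra_simps\<close>)
  then obtain s where s: "0 < s" "s < h"
    "p h - p 0 = h * (dd u f ((x + h *\<^sub>R v) + s *\<^sub>R u) - dd u f (x + s *\<^sub>R u))" by auto
  have "\<exists>t>0. t < h \<and> dd u f ((x + s *\<^sub>R u) + h *\<^sub>R v) - dd u f ((x + s *\<^sub>R u) + 0 *\<^sub>R v)
      = (h - 0) * dd v (dd u f) ((x + s *\<^sub>R u) + t *\<^sub>R v)"
    using assms(1) s by (intro MVT2 line fu) (auto simp: cv)
  then obtain t where t: "0 < t" "t < h"
    "dd u f (x + s *\<^sub>R u + h *\<^sub>R v) - dd u f (x + s *\<^sub>R u) = h * dd v (dd u f) (x + s *\<^sub>R u + t *\<^sub>R v)"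
    by auto
  have eq: "(x + h *\<^sub>R v) + r *\<^sub>R u = x + r *\<^sub>R u + h *\<^sub>R v" for r by (simp add: algebra_simps)
  have "p h - p 0 = h * (h * dd v (dd u f) (x + s *\<^sub>R u + t *\<^sub>R v))"
    using s(3) t(3) unfolding eq by simp
  then have "f (x + h *\<^sub>R u + h *\<^sub>R v) - f (x + h *\<^sub>R u) - f (x + h *\<^sub>R v) + f x
      = h * h * dd v (dd u f) (x + s *\<^sub>R u + t *\<^sub>R v)"
    unfolding p_def eq by simp
  with that s(1,2) t(1,2) show ?thesis by blast
qed

text \<open>The second difference over a parallelogram is symmetric in \<open>u\<close> and
  \<open>v\<close>, so each mixed derivative attains the same value somewhere in every small
  parallelogram at \<open>x\<close>; continuity then forces equality at \<open>x\<close>.\<close>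

lemma dd_commute:
  fixes f :: "'a::euclidean_space \<Rightarrow> real"
  assumes S: "open S" "x \<in> S" and f: "smooth_on S f"
  shows "dd u (dd v f) x = dd v (dd u f) x"
proof (rule ccontr)
  assume "dd u (dd v f) x \<noteq> dd v (dd u f) x"
  \<comment> \<open>Half of the supposed gap, so that two errors below \<open>e\<close> already
    contradict it.\<close>
  define e where "e = \<bar>dd u (dd v f) x - dd v (dd u f) x\<bar> / 2"
  have e: "e > 0" using \<open>_ \<noteq> _\<close> by (simp add: e_def)
  have near: "\<forall>\<^sub>F y in nhds x. \<bar>g y - g x\<bar> < e" if "smooth_on S g" for g :: "'a \<Rightarrow> real"
  proof -
    have "isCont g x"
      using smooth_on_continuous[OF that] S continuous_on_eq_continuous_at by blast
    then have "(g \<longlongrightarrow> g x) (nhds x)" by (simp add: continuous_at tendsto_at_iff_tendsto_nhds)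
    from tendstoD[OF this e] show ?thesis by (simp add: dist_real_def)
  qed
  have "\<forall>\<^sub>F y in nhds x. y \<in> S \<and> \<bar>dd u (dd v f) y - dd u (dd v f) x\<bar> < e
      \<and> \<bar>dd v (dd u f) y - dd v (dd u f) x\<bar> < e"
    using S by (intro eventually_conj near smooth_on_dd f eventually_nhds_in_open)
  then obtain d where d: "d > 0" and B: "\<And>y. dist y x < d \<Longrightarrow> y \<in> S \<and>
      \<bar>dd u (dd v f) y - dd u (dd v f) x\<bar> < e \<and> \<bar>dd v (dd u f) y - dd v (dd u f) x\<bar> < e"
    unfolding eventually_nhds_metric by blast
  \<comment> \<open>The parallelogram with sides \<open>h u\<close> and \<open>h v\<close> must fit
    into the ball of radius \<open>d\<close>; the summand 1 keeps the denominator positive when both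
    directions vanish.\<close>
  define h where "h = d / (2 * (norm u + norm v + 1))"
  have nn: "norm u + norm v + 1 > 0" by (smt (verit) norm_ge_zero)
  have h: "h > 0" using d nn by (simp add: h_def)
  have hd: "h * (norm u + norm v) < d"
  proof -
    have "h * (norm u + norm v) \<le> h * (norm u + norm v + 1)" using h by simp
    also have "\<dots> = d / 2" using nn unfolding h_def by (simp add: divide_simps)
    finally show ?thesis using d by linarith
  qed
  have ball: "dist (x + s *\<^sub>R a + t *\<^sub>R b) x < d"
    if "0 \<le> s" "s \<le> h" "0 \<le> t" "t \<le> h" "norm a + norm b = norm u + norm v" for s t a b
  proof -
    have "dist (x + s *\<^sub>R a + t *\<^sub>R b) x = norm (s *\<^sub>R a + t *\<^sub>R b)"
      by (simp add: dist_norm)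
    also have "\<dots> \<le> s * norm a + t * norm b"
      using norm_triangle_ineq[of "s *\<^sub>R a" "t *\<^sub>R b"] that by simp
    also have "\<dots> \<le> h * norm a + h * norm b"
      using that by (intro add_mono mult_right_mono) auto
    also have "\<dots> = h * (norm u + norm v)" using that(5) by (metis distrib_left)
    finally show ?thesis using hd by linarith
  qed
  have dif: "g differentiable (at y)" if "smooth_on S g" "y \<in> S" for g :: "'a \<Rightarrow> real" and y
    using smooth_on_differentiable that by blast
  obtain s t where st: "0 < s" "s < h" "0 < t" "t < h"
    "f (x + h *\<^sub>R u + h *\<^sub>R v) - f (x + h *\<^sub>R u) - f (x + h *\<^sub>R v) + f x
      = h * h * dd v (dd u f) (x + s *\<^sub>R u + t *\<^sub>R v)"
    by (rule second_difference_mean_value[OF h, of x u v S f])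
      (use B ball dif f smooth_on_dd[OF f] in blast)+
  obtain s' t' where st': "0 < s'" "s' < h" "0 < t'" "t' < h"
    "f (x + h *\<^sub>R v + h *\<^sub>R u) - f (x + h *\<^sub>R v) - f (x + h *\<^sub>R u) + f x
      = h * h * dd u (dd v f) (x + s' *\<^sub>R v + t' *\<^sub>R u)"
    by (rule second_difference_mean_value[OF h, of x v u S f])
      (use B ball[of _ _ v u] dif f smooth_on_dd[OF f] add.commute in metis)+
  have "x + h *\<^sub>R v + h *\<^sub>R u = x + h *\<^sub>R u + h *\<^sub>R v" by (simp add: algebra_simps)
  then have "h * h * dd v (dd u f) (x + s *\<^sub>R u + t *\<^sub>R v) = h * h * dd u (dd v f) (x + s' *\<^sub>R v + t' *\<^sub>R u)"
    using st(5) st'(5) by (simp add: algebra_simps)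
  then have "dd v (dd u f) (x + s *\<^sub>R u + t *\<^sub>R v) = dd u (dd v f) (x + s' *\<^sub>R v + t' *\<^sub>R u)"
    using h by simp
  moreover have "\<bar>dd v (dd u f) (x + s *\<^sub>R u + t *\<^sub>R v) - dd v (dd u f) x\<bar> < e"
    using B ball[of s t u v] st by simp
  moreover have "\<bar>dd u (dd v f) (x + s' *\<^sub>R v + t' *\<^sub>R u) - dd u (dd v f) x\<bar> < e"
    using B ball[of s' t' v u] st' by simp
  ultimately have "\<bar>dd u (dd v f) x - dd v (dd u f) x\<bar> < 2 * e" by linarith
  then show False by (simp add: e_def)
qed

text \<open>The chain rule is expanded over the standard basis: the coefficients are components of
  \<open>dd v f\<close>, hence smooth, and the factors \<open>dd b g\<close> composed with
  \<open>f\<close> fall under the induction hypothesis, which is why \<open>g\<close> is generalized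
  and \<open>f\<close> stays fixed.\<close>

lemma smooth_on_compose:
  fixes f :: "'a::euclidean_space \<Rightarrow> 'b::euclidean_space" and g :: "'b \<Rightarrow> real"
  assumes S: "open S" and f: "smooth_on S f" and g: "smooth_on T g" and fT: "f ` S \<subseteq> T"
  shows "smooth_on S (\<lambda>x. g (f x))"
proof -
  have "C_k_on k S f \<Longrightarrow> C_k_on k T g \<Longrightarrow> C_k_on k S (\<lambda>x. g (f x))" for k
  proof (induction k arbitrary: g)
    case 0
    then show ?case using fT by (auto intro: continuous_on_compose2[of T g S f])
  next
    case (Suc k)
    have df: "f differentiable (at x)" if "x \<in> S" for x
      using Suc.prems(1) that unfolding C_k_on_Suc_dd by blast
    have dg: "g differentiable (at (f x))" if "x \<in> S" for x
      using Suc.prems(2) that fT unfolding C_k_on_Suc_dd by blast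
    have "C_k_on k S (dd v (\<lambda>x. g (f x)))" for v
    proof (rule C_k_on_transform[OF S])
      have "C_k_on k S (\<lambda>x. dd v f x \<bullet> b)" for b
      proof -
        have "smooth_on S (dd v f)" by (rule smooth_on_dd[OF f])
        from smooth_on_linear_compose[OF bounded_linear_inner_left S this]
        show ?thesis by (simp add: smooth_on_def)
      qed
      moreover have "C_k_on k S (\<lambda>x. dd b g (f x))" for b
        using Suc.IH[of "dd b g"] C_k_on_SucD[OF Suc.prems(1)] Suc.prems(2)
        unfolding C_k_on_Suc_dd by blast
      ultimately have "C_k_on k S (\<lambda>x. (dd v f x \<bullet> b) * dd b g (f x))" for b
        by (intro C_k_on_mult S)
      then have "C_k_on k S (\<lambda>x. \<Sum>b\<in>B. (dd v f x \<bullet> b) * dd b g (f x))" for B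
        by (induction B rule: infinite_finite_induct) (simp_all add: C_k_on_const C_k_on_add[OF S])
      then show "C_k_on k S (\<lambda>x. \<Sum>b\<in>Basis. (dd v f x \<bullet> b) * dd b g (f x))" .
      show "dd v (\<lambda>x. g (f x)) x = (\<Sum>b\<in>Basis. (dd v f x \<bullet> b) * dd b g (f x))" if "x \<in> S" for x
      proof -
        have "dd v (\<lambda>x. g (f x)) x = dd (\<Sum>b\<in>Basis. (dd v f x \<bullet> b) *\<^sub>R b) g (f x)"
          using dd_chain[OF df dg] that by (simp add: euclidean_representation)
        then show ?thesis
          using dg[OF that] by (simp add: dd_direction_sum dd_direction_scaleR)
      qed
    qed
    then show ?case
      unfolding C_k_on_Suc_dd using df dg differentiable_compose[of g f] by blast
  qed
  with f g show ?thesis by (simp add: smooth_on_def)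
qed

lemma dd_bounded_linear_compose:
  assumes "bounded_linear L" "f differentiable (at x)"
  shows "dd v (\<lambda>x. L (f x)) x = L (dd v f x)"
  by (rule dd_eqI) (rule bounded_linear.has_derivative[OF assms(1) has_derivative_dd[OF assms(2)]])

text \<open>Along the vertical line through \<open>z\<close> the function is constant, and the chain
  rule computes the derivative of this restriction. This gives independence of \<open>y\<close> for
  the Jacobian and for its inverse.\<close>

lemma dd_base_function:
  fixes f :: "'a::euclidean_space \<times> 'b::euclidean_space \<Rightarrow> real"
  assumes "f differentiable (at z)" "\<And>z. f z = g (fst z)"
  shows "dd (0, v) f z = 0"
proof -
  have "((\<lambda>t::real. z + t *\<^sub>R (0, v)) has_derivative (\<lambda>t. t *\<^sub>R (0, v))) (at 0)"
    by (auto intro!: derivative_eq_intros)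
  moreover have "(f has_derivative (\<lambda>w. dd w f z)) (at (z + (0::real) *\<^sub>R (0, v)))"
    using has_derivative_dd[OF assms(1)] by (simp flip: zero_prod_def)
  ultimately have "((\<lambda>t::real. f (z + t *\<^sub>R (0, v))) has_derivative (\<lambda>t. dd (t *\<^sub>R (0, v)) f z)) (at 0)"
    by (rule has_derivative_compose)
  moreover have "f (z + t *\<^sub>R (0, v)) = g (fst z)" for t
    by (simp add: assms(2))
  ultimately have "((\<lambda>t::real. g (fst z)) has_derivative (\<lambda>t. dd (t *\<^sub>R (0, v)) f z)) (at 0)"
    by simp
  from has_derivative_unique[OF this has_derivative_const]
  have "dd (1 *\<^sub>R (0, v)) f z = 0" by (rule fun_cong)
  then show ?thesis by simp
qed

section \<open>Calculus in the induced coordinates\<close>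

text \<open>Coordinate derivatives, the Euler field and the spray vector field are all directional
  derivatives, so the product, chain and symmetry rules are needed for \<open>dd\<close>
  only.\<close>

lemma dx_eq_dd: "dx k = dd (axis k 1, 0)"
  by (intro ext) (simp add: dx_def dd_def)

lemma dy_eq_dd: "dy k = dd (0, axis k 1)"
  by (intro ext) (simp add: dy_def dd_def)

lemma vec_eq_sum_axis: "(v :: real ^ 'n) = (\<Sum>k\<in>UNIV. v $ k *\<^sub>R axis k 1)"
  using basis_expansion[of v] by (simp add: scalar_mult_eq_scaleR)

lemma dd_expand:
  fixes f :: "'n::finite coords \<Rightarrow> real"
  assumes "f differentiable (at z)"
  shows "dd w f z = (\<Sum>k\<in>UNIV. fst w $ k * dx k f z) + (\<Sum>k\<in>UNIV. snd w $ k * dy k f z)"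
proof -
  have "w = (fst w, 0) + (0, snd w)" by simp
  also have "(fst w, 0) = (\<Sum>k\<in>UNIV. fst w $ k *\<^sub>R (axis k 1, 0 :: real ^ 'n))"
    using vec_eq_sum_axis[of "fst w"] by (intro prod_eqI) (simp_all add: fst_sum snd_sum)
  also have "(0, snd w) = (\<Sum>k\<in>UNIV. snd w $ k *\<^sub>R (0 :: real ^ 'n, axis k 1))"
    using vec_eq_sum_axis[of "snd w"] by (intro prod_eqI) (simp_all add: fst_sum snd_sum)
  finally have "dd w f z = dd ((\<Sum>k\<in>UNIV. fst w $ k *\<^sub>R (axis k 1, 0))
      + (\<Sum>k\<in>UNIV. snd w $ k *\<^sub>R (0, axis k 1))) f z"
    by (rule arg_cong)
  then show ?thesis
    using assms by (simp add: dd_direction_add dd_direction_sum dd_direction_scaleR dx_eq_dd dy_eq_dd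
        del: scaleR_Pair)
qed

lemma bounded_linear_fibre_coordinate: "bounded_linear (\<lambda>z :: 'n::finite coords. snd z $ i)"
  by (rule bounded_linear_compose[OF bounded_linear_vec_nth bounded_linear_snd])

lemma dd_fibre_coordinate: "dd w (\<lambda>z :: 'n::finite coords. snd z $ i) z = snd w $ i"
  using dd_bounded_linear[OF bounded_linear_fibre_coordinate] .

lemma dy_fibre_coordinate:
  "dy k (\<lambda>z :: 'n::finite coords. snd z $ i) z = (if i = k then 1 else 0)"
  by (simp add: dy_eq_dd dd_fibre_coordinate axis_def)

text \<open>Positive homogeneity enters only through Euler's identity.\<close>

definition homog_on :: "'n::finite coords set \<Rightarrow> real \<Rightarrow> ('n coords \<Rightarrow> real) \<Rightarrow> bool" where
  "homog_on S s f \<longleftrightarrow> (\<forall>z\<in>S. dd (0, snd z) f z = s * f z)"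

text \<open>The spray vector field \<open>y^m d/dx^m - 2 G^r d/dy^r\<close>, whose integral curves
  are the solutions of \<open>x'' + 2 G = 0\<close>. As one directional derivative it obeys the
  product rule at once.\<close>

definition spray_derivative ::
    "('n::finite \<Rightarrow> 'n coords \<Rightarrow> real) \<Rightarrow> ('n coords \<Rightarrow> real) \<Rightarrow> 'n coords \<Rightarrow> real" where
  "spray_derivative G h z = dd (snd z, (- 2) *\<^sub>R (\<chi> r. G r z)) h z"

text \<open>The contraction with \<open>y\<close> of the horizontal Berwald derivative, simplified by homogeneity of
  the spray coefficients \<open>G\<close>.\<close>

definition dynamical_derivative ::
    "('n::finite \<Rightarrow> 'n coords \<Rightarrow> real) \<Rightarrow> 'n tensor13 \<Rightarrow> 'n tensor13" where
  "dynamical_derivative G T j i k l z = spray_derivative G (T j i k l) z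
     + (\<Sum>r\<in>UNIV. T j r k l z * dy r (G i) z)
     - (\<Sum>r\<in>UNIV. T r i k l z * dy j (G r) z)
     - (\<Sum>r\<in>UNIV. T j i r l z * dy k (G r) z)
     - (\<Sum>r\<in>UNIV. T j i k r z * dy l (G r) z)"

text \<open>Replacing \<open>G\<close> by \<open>G + P y\<close> raises the divergence of
  \<open>G\<close> by \<open>(n + 1) P\<close>: \<open>n\<close> from the trace of the identity, 1
  from Euler's identity for \<open>P\<close>. The factor \<open>1 / (n + 1)\<close> makes the two
  changes cancel.\<close>

definition projective_spray :: "('n::finite \<Rightarrow> 'n coords \<Rightarrow> real) \<Rightarrow> 'n \<Rightarrow> 'n coords \<Rightarrow> real" where
  "projective_spray G i z = G i z - 1 / (real CARD('n) + 1) * (\<Sum>m\<in>UNIV. dy m (G m) z) * snd z $ i"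

definition douglas_of :: "('n::finite \<Rightarrow> 'n coords \<Rightarrow> real) \<Rightarrow> 'n tensor13" where
  "douglas_of G j i k l = dy j (dy k (dy l (projective_spray G i)))"

lemma douglas_eq: "douglas f = douglas_of (spray f)"
  by (intro ext) (simp add: douglas_def douglas_of_def projective_spray_def[abs_def])

lemma sum_mult_delta:
  fixes t :: "'n::finite \<Rightarrow> real"
  shows "(\<Sum>r\<in>UNIV. t r * (if i = r then c else 0)) = t i * c"
    and "(\<Sum>r\<in>UNIV. t r * (if r = i then c else 0)) = t i * c"
  by (simp_all add: if_distrib cong: if_cong)

section \<open>Smooth and homogeneous functions on an open coordinate region\<close>

locale open_region =
  fixes S :: "'n::finite coords set"
  assumes open_S: "open S"
begin

lemma smooth_dx: "smooth_on S f \<Longrightarrow> smooth_on S (dx k f)"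
  by (simp add: dx_eq_dd smooth_on_dd)

lemma smooth_dy: "smooth_on S f \<Longrightarrow> smooth_on S (dy k f)"
  by (simp add: dy_eq_dd smooth_on_dd)

lemma smooth_fibre_coordinate: "smooth_on S (\<lambda>z. snd z $ i)"
  by (rule smooth_on_bounded_linear[OF bounded_linear_fibre_coordinate])

lemmas smooth_intros = smooth_on_add[OF open_S] smooth_on_mult[OF open_S] smooth_on_diff[OF open_S]
  smooth_on_sum[OF open_S] smooth_on_const smooth_dx smooth_dy smooth_fibre_coordinate

lemma dd_rules:
  assumes "z \<in> S"
  shows "smooth_on S f \<Longrightarrow> smooth_on S g \<Longrightarrow> dd w (\<lambda>z. f z + g z) z = dd w f z + dd w g z"
    and "smooth_on S f \<Longrightarrow> smooth_on S g \<Longrightarrow> dd w (\<lambda>z. f z - g z) z = dd w f z - dd w g z"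
    and "smooth_on S f \<Longrightarrow> smooth_on S g \<Longrightarrow>
           dd w (\<lambda>z. f z * g z) z = f z * dd w g z + dd w f z * (g z :: real)"
    and "(\<And>i. i \<in> I \<Longrightarrow> smooth_on S (h i)) \<Longrightarrow> dd w (\<lambda>z. \<Sum>i\<in>I. h i z) z = (\<Sum>i\<in>I. dd w (h i) z)"
  using assms smooth_on_differentiable by (blast intro: dd_plus dd_minus dd_mult dd_sum)+

lemma dy_rules:
  assumes "z \<in> S"
  shows "smooth_on S f \<Longrightarrow> smooth_on S g \<Longrightarrow> dy k (\<lambda>z. f z + g z) z = dy k f z + dy k g z"
    and "smooth_on S f \<Longrightarrow> smooth_on S g \<Longrightarrow> dy k (\<lambda>z. f z - g z) z = dy k f z - dy k g z"
    and "smooth_on S f \<Longrightarrow> smooth_on S g \<Longrightarrow>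
           dy k (\<lambda>z. f z * g z) z = f z * dy k g z + dy k f z * g z"
    and "(\<And>i. i \<in> I \<Longrightarrow> smooth_on S (h i)) \<Longrightarrow> dy k (\<lambda>z. \<Sum>i\<in>I. h i z) z = (\<Sum>i\<in>I. dy k (h i) z)"
  unfolding dy_eq_dd using assms by (simp_all add: dd_rules)

lemma dy_cong: "z \<in> S \<Longrightarrow> (\<And>z. z \<in> S \<Longrightarrow> f z = g z) \<Longrightarrow> dy k f z = dy k g z"
  unfolding dy_eq_dd by (rule dd_cong[OF open_S])

lemma expand:
  assumes "smooth_on S f" "z \<in> S"
  shows "dd w f z = (\<Sum>k\<in>UNIV. fst w $ k * dx k f z) + (\<Sum>k\<in>UNIV. snd w $ k * dy k f z)"
  using assms dd_expand smooth_on_differentiable by blast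

text \<open>Differentiate Euler's identity in direction \<open>w\<close> and exchange the second
  derivatives; the derivative of \<open>y\<close> itself leaves the term
  \<open>dd (0, snd w) f\<close>. It vanishes for directions along the base and lowers the degree by
  one for vertical ones.\<close>

lemma homog_dd:
  assumes f: "smooth_on S f" and h: "homog_on S s f" and z: "z \<in> S"
  shows "dd (0, snd z) (dd w f) z = s * dd w f z - dd (0, snd w) f z"
proof -
  have "dd w (\<lambda>z. \<Sum>k\<in>UNIV. snd z $ k * dy k f z) z = dd w (\<lambda>z. s * f z) z"
    using h expand[OF f] unfolding homog_on_def by (intro dd_cong[OF open_S z]) simp
  moreover have "dd w (\<lambda>z. s * f z) z = s * dd w f z"
    using z f by (simp add: dd_rules smooth_on_const)
  moreover have "dd w (\<lambda>z. \<Sum>k\<in>UNIV. snd z $ k * dy k f z) z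
      = (\<Sum>k\<in>UNIV. snd z $ k * dd w (dy k f) z + snd w $ k * dy k f z)"
    using z f by (simp add: dd_rules dd_fibre_coordinate smooth_intros)
  moreover have "dd w (dy k f) z = dy k (dd w f) z" for k
    unfolding dy_eq_dd by (rule dd_commute[OF open_S z f])
  ultimately show ?thesis
    using expand[OF f z, of "(0, snd w)"] expand[OF smooth_on_dd[OF f] z, of "(0, snd z)" w]
    by (simp add: sum.distrib)
qed

lemma homog_dx:
  assumes "smooth_on S f" "homog_on S s f"
  shows "homog_on S s (dx k f)"
proof -
  have "dd (0, snd (axis k 1, 0 :: real ^ 'n)) f z = 0" if "z \<in> S" for z
    using expand[OF assms(1) that] by simp
  then show ?thesis
    using homog_dd[OF assms, of _ "(axis k 1, 0)"] unfolding homog_on_def dx_eq_dd by simp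
qed

lemma homog_dy:
  assumes "smooth_on S f" "homog_on S (s + 1) f"
  shows "homog_on S s (dy k f)"
  unfolding homog_on_def dy_eq_dd using homog_dd[OF assms, of _ "(0, axis k 1)"]
  by (simp add: algebra_simps)

lemma homog_transform:
  assumes "homog_on S s g" "\<And>z. z \<in> S \<Longrightarrow> f z = g z"
  shows "homog_on S s f"
  using assms dd_cong[OF open_S, of _ f g] unfolding homog_on_def by metis

lemma homog_const: "homog_on S 0 (\<lambda>z. c)"
  by (simp add: homog_on_def)

lemma homog_fibre_coordinate: "homog_on S 1 (\<lambda>z. snd z $ i)"
  by (simp add: homog_on_def dd_fibre_coordinate)

lemma homog_add:
  assumes "smooth_on S f" "smooth_on S g" "homog_on S s f" "homog_on S s g"
  shows "homog_on S s (\<lambda>z. f z + g z)"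
  using assms unfolding homog_on_def by (simp add: dd_rules distrib_left)

lemma homog_diff:
  assumes "smooth_on S f" "smooth_on S g" "homog_on S s f" "homog_on S s g"
  shows "homog_on S s (\<lambda>z. f z - g z)"
  using assms unfolding homog_on_def by (simp add: dd_rules right_diff_distrib)

lemma homog_sum:
  assumes "\<And>i. i \<in> I \<Longrightarrow> smooth_on S (f i)" "\<And>i. i \<in> I \<Longrightarrow> homog_on S s (f i)"
  shows "homog_on S s (\<lambda>z. \<Sum>i\<in>I. f i z)"
  using assms unfolding homog_on_def by (simp add: dd_rules sum_distrib_left)

lemma homog_mult:
  assumes "smooth_on S f" "smooth_on S g" "homog_on S s f" "homog_on S t g" "r = s + t"
  shows "homog_on S r (\<lambda>z. f z * g z)"
  using assms unfolding homog_on_def by (simp add: dd_rules distrib_right)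

lemma euler:
  assumes "smooth_on S f" "homog_on S s f" "z \<in> S"
  shows "(\<Sum>k\<in>UNIV. snd z $ k * dy k f z) = s * f z"
  using assms(2,3) expand[OF assms(1,3), of "(0, snd z)"] unfolding homog_on_def by simp

lemma spray_derivative_expand:
  assumes "smooth_on S h" "z \<in> S"
  shows "spray_derivative G h z
    = (\<Sum>m\<in>UNIV. snd z $ m * dx m h z) - 2 * (\<Sum>r\<in>UNIV. G r z * dy r h z)"
  unfolding spray_derivative_def
  by (simp add: expand[OF assms] sum_negf sum_distrib_left mult.assoc)

lemma smooth_spray_derivative:
  assumes "\<And>i. smooth_on S (G i)" "smooth_on S h"
  shows "smooth_on S (spray_derivative G h)"
  by (rule smooth_on_transform[OF open_S _ spray_derivative_expand[OF assms(2)]])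
    (intro smooth_intros assms)

text \<open>In either part of the spray the degree rises by one: \<open>dx\<close> keeps it and is
  multiplied by \<open>y\<close>, while \<open>dy\<close> lowers it and is multiplied by
  \<open>G\<close>, of degree 2.\<close>

lemma homog_spray_derivative:
  assumes "\<And>i. smooth_on S (G i)" "\<And>i. homog_on S 2 (G i)" "smooth_on S h" "homog_on S s h"
  shows "homog_on S (s + 1) (spray_derivative G h)"
proof (rule homog_transform[OF _ spray_derivative_expand[OF assms(3)]])
  have "homog_on S (s - 1) (dy r h)" for r
    using assms(3,4) by (intro homog_dy) simp_all
  then have "homog_on S (s + 1) (\<lambda>z. G r z * dy r h z)" for r
    using assms by (intro homog_mult[of "G r" "dy r h" 2 "s - 1"] smooth_dy) simp_all
  then have 0: "homog_on S (s + 1) (\<lambda>z. \<Sum>r\<in>UNIV. G r z * dy r h z)"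
    by (intro homog_sum smooth_intros assms)
  have 1: "homog_on S (s + 1) (\<lambda>z. 2 * (\<Sum>r\<in>UNIV. G r z * dy r h z))"
    by (rule homog_mult[OF _ _ homog_const 0]) (intro smooth_intros assms | simp)+
  have "homog_on S (s + 1) (\<lambda>z. snd z $ m * dx m h z)" for m
    by (rule homog_mult[OF smooth_fibre_coordinate smooth_dx homog_fibre_coordinate homog_dx])
      (use assms in simp_all)
  then have 2: "homog_on S (s + 1) (\<lambda>z. \<Sum>m\<in>UNIV. snd z $ m * dx m h z)"
    by (intro homog_sum smooth_intros assms)
  show "homog_on S (s + 1)
      (\<lambda>z. (\<Sum>m\<in>UNIV. snd z $ m * dx m h z) - 2 * (\<Sum>r\<in>UNIV. G r z * dy r h z))"
    by (intro homog_diff 1 2 smooth_intros assms)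
qed

lemma spray_derivative_rules:
  assumes "z \<in> S"
  shows "smooth_on S f \<Longrightarrow> smooth_on S g \<Longrightarrow>
      spray_derivative G (\<lambda>z. f z + g z) z = spray_derivative G f z + spray_derivative G g z"
    and "smooth_on S f \<Longrightarrow> smooth_on S g \<Longrightarrow>
      spray_derivative G (\<lambda>z. f z * g z) z = f z * spray_derivative G g z + spray_derivative G f z * g z"
    and "(\<And>i. i \<in> I \<Longrightarrow> smooth_on S (h i)) \<Longrightarrow>
      spray_derivative G (\<lambda>z. \<Sum>i\<in>I. h i z) z = (\<Sum>i\<in>I. spray_derivative G (h i) z)"
  unfolding spray_derivative_def using assms by (simp_all add: dd_rules)

lemma spray_derivative_fibre_coordinate: "spray_derivative G (\<lambda>z. snd z $ i) z = - 2 * G i z"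
  by (simp add: spray_derivative_def dd_fibre_coordinate)

lemma spray_derivative_cong:
  "z \<in> S \<Longrightarrow> (\<And>z. z \<in> S \<Longrightarrow> f z = g z) \<Longrightarrow> spray_derivative G f z = spray_derivative G g z"
  unfolding spray_derivative_def by (rule dd_cong[OF open_S])

lemma dynamical_derivative_cong:
  assumes "z \<in> S" "\<And>j i k l z. z \<in> S \<Longrightarrow> T j i k l z = T' j i k l z"
  shows "dynamical_derivative G T j i k l z = dynamical_derivative G T' j i k l z"
  unfolding dynamical_derivative_def
  using assms spray_derivative_cong[OF assms(1), of "T j i k l" "T' j i k l"] by simp

lemma smooth_dynamical_derivative:
  assumes "\<And>i. smooth_on S (G i)" "\<And>j i k l. smooth_on S (T j i k l)"
  shows "smooth_on S (dynamical_derivative G T j i k l)"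
  unfolding dynamical_derivative_def[abs_def]
  by (intro smooth_intros smooth_spray_derivative assms)

end

text \<open>What the change formula for the derivative consumes: the degree for Euler's identity,
  and annihilation by \<open>y\<close> in each lower index to remove the terms with derivatives of
  \<open>P\<close>. The upper index is left unconstrained.\<close>

definition vertical_tensor :: "'n::finite coords set \<Rightarrow> real \<Rightarrow> 'n tensor13 \<Rightarrow> bool" where
  "vertical_tensor S s T \<longleftrightarrow>
     (\<forall>j i k l. smooth_on S (T j i k l) \<and> homog_on S s (T j i k l)) \<and>
     (\<forall>i k l. \<forall>z\<in>S. (\<Sum>j\<in>UNIV. snd z $ j * T j i k l z) = 0) \<and>
     (\<forall>j i l. \<forall>z\<in>S. (\<Sum>k\<in>UNIV. snd z $ k * T j i k l z) = 0) \<and>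
     (\<forall>j i k. \<forall>z\<in>S. (\<Sum>l\<in>UNIV. snd z $ l * T j i k l z) = 0)"

section \<open>The derivative along a homogeneous spray\<close>

locale spray_region = open_region S for S :: "'n::finite coords set" +
  fixes G :: "'n \<Rightarrow> 'n coords \<Rightarrow> real"
  assumes smooth_G: "smooth_on S (G i)"
    and homog_G: "homog_on S 2 (G i)"
begin

lemma euler_G: "z \<in> S \<Longrightarrow> (\<Sum>k\<in>UNIV. snd z $ k * dy k (G i) z) = 2 * G i z"
  by (rule euler[OF smooth_G homog_G])

lemma homog_dy_G: "homog_on S 1 (dy k (G i))"
  using smooth_G homog_G by (intro homog_dy) simp_all

text \<open>Contraction with \<open>y^m\<close> collapses the connection by Euler's identity:
  \<open>y^m G^r.m = 2 G^r\<close> produces the vertical part of the spray, and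
  \<open>y^m G^r.m.j = G^r.j\<close> removes one derivative from every index term.\<close>

lemma berwald_hderiv0_eq:
  assumes "G = spray f" "\<And>j i k l. smooth_on S (T j i k l)" "z \<in> S"
  shows "berwald_hderiv0 f T j i k l z = dynamical_derivative G T j i k l z"
proof -
  have N: "(\<Sum>m\<in>UNIV. snd z $ m * dy m (dy r (G i)) z) = dy r (G i) z" for r i
    using euler[OF smooth_dy[OF smooth_G] homog_dy_G assms(3)] by simp
  have *: "(\<Sum>m\<in>UNIV. (\<Sum>r\<in>UNIV. a r * b m r) * snd z $ m) = (\<Sum>r\<in>UNIV. a r * (\<Sum>m\<in>UNIV. snd z $ m * b m r))"
    for a and b :: "'n \<Rightarrow> 'n \<Rightarrow> real"
    unfolding sum_distrib_right sum_distrib_left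
    by (subst sum.swap) (simp add: ac_simps)
  have "(\<Sum>m\<in>UNIV. (\<Sum>r\<in>UNIV. dy m (G r) z * dy r (T j i k l) z) * snd z $ m)
      = (\<Sum>r\<in>UNIV. dy r (T j i k l) z * (\<Sum>m\<in>UNIV. snd z $ m * dy m (G r) z))"
    using *[of "\<lambda>r. dy r (T j i k l) z" "\<lambda>m r. dy m (G r) z"] by (simp add: mult.commute)
  then have **: "(\<Sum>m\<in>UNIV. (\<Sum>r\<in>UNIV. dy m (G r) z * dy r (T j i k l) z) * snd z $ m)
      = 2 * (\<Sum>r\<in>UNIV. G r z * dy r (T j i k l) z)"
    by (simp add: euler_G[OF assms(3)] sum_distrib_left ac_simps)
  show ?thesis
    unfolding berwald_hderiv0_def berwald_hderiv_def assms(1)[symmetric] dynamical_derivative_def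
      spray_derivative_expand[OF assms(2,3)]
    by (simp only: left_diff_distrib distrib_right sum.distrib sum_subtractf ** * N)
      (simp add: mult.commute)
qed

text \<open>Apply the spray to the identity \<open>y^j t_j = 0\<close>; since it takes
  \<open>y^j\<close> to \<open>- 2 G^j\<close>, the stated remainder is left over.
  \<open>contraction_lower_index\<close> yields the same amount from the connection term, with which
  it will cancel.\<close>

lemma contraction_spray_derivative:
  assumes "\<And>j. smooth_on S (t j)" "\<And>z. z \<in> S \<Longrightarrow> (\<Sum>j\<in>UNIV. snd z $ j * t j z) = 0" "z \<in> S"
  shows "(\<Sum>j\<in>UNIV. snd z $ j * spray_derivative G (t j) z) = 2 * (\<Sum>j\<in>UNIV. G j z * t j z)"
proof -
  have "spray_derivative G (\<lambda>z. \<Sum>j\<in>UNIV. snd z $ j * t j z) z = spray_derivative G (\<lambda>z. 0) z"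
    using assms by (intro spray_derivative_cong) auto
  also have "\<dots> = 0" by (simp add: spray_derivative_def)
  finally show ?thesis
    using assms by (simp add: spray_derivative_rules spray_derivative_fibre_coordinate smooth_intros
        sum.distrib sum_subtractf sum_negf sum_distrib_left mult.assoc)
qed

lemma contraction_lower_index:
  assumes "z \<in> S"
  shows "(\<Sum>j\<in>UNIV. snd z $ j * (\<Sum>r\<in>UNIV. t r * dy j (G r) z)) = 2 * (\<Sum>r\<in>UNIV. G r z * t r)"
proof -
  have "(\<Sum>j\<in>UNIV. snd z $ j * (\<Sum>r\<in>UNIV. t r * dy j (G r) z))
      = (\<Sum>r\<in>UNIV. t r * (\<Sum>j\<in>UNIV. snd z $ j * dy j (G r) z))"
    unfolding sum_distrib_left by (subst sum.swap) (simp add: ac_simps)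
  then show ?thesis by (simp add: euler_G[OF assms] sum_distrib_left ac_simps)
qed

lemma contraction_other_index:
  fixes t :: "'n \<Rightarrow> 'n \<Rightarrow> real"
  assumes "\<And>r. (\<Sum>j\<in>UNIV. snd z $ j * t j r) = 0"
  shows "(\<Sum>j\<in>UNIV. snd z $ j * (\<Sum>r\<in>UNIV. t j r * b r)) = 0"
proof -
  have "(\<Sum>j\<in>UNIV. snd z $ j * (\<Sum>r\<in>UNIV. t j r * b r))
      = (\<Sum>r\<in>UNIV. (\<Sum>j\<in>UNIV. snd z $ j * t j r) * b r)"
    unfolding sum_distrib_left sum_distrib_right by (subst sum.swap) (simp add: ac_simps)
  then show ?thesis by (simp add: assms)
qed

text \<open>In a contraction with \<open>y\<close>, the spray part cancels the connection term of
  the contracted index, and the connection terms of the other indices vanish because there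
  \<open>y\<close> still meets \<open>T\<close>. This allows the change formula to be applied a
  second time.\<close>

lemma vertical_dynamical_derivative:
  assumes T: "vertical_tensor S s T"
  shows "vertical_tensor S (s + 1) (dynamical_derivative G T)"
  unfolding vertical_tensor_def
proof (intro conjI allI ballI)
  have smooth_T: "smooth_on S (T j i k l)" and homog_T: "homog_on S s (T j i k l)" for j i k l
    using T by (simp_all add: vertical_tensor_def)
  have 0: "(\<Sum>j\<in>UNIV. snd z $ j * T j i k l z) = 0" "(\<Sum>j\<in>UNIV. snd z $ j * T k i j l z) = 0"
    "(\<Sum>j\<in>UNIV. snd z $ j * T k i l j z) = 0" if "z \<in> S" for i k l z
    using T that by (simp_all add: vertical_tensor_def)
  fix j i k l
  show "smooth_on S (dynamical_derivative G T j i k l)"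
    by (intro smooth_dynamical_derivative smooth_G smooth_T)
  show "homog_on S (s + 1) (dynamical_derivative G T j i k l)"
    unfolding dynamical_derivative_def[abs_def]
    by (intro homog_diff homog_add homog_sum homog_spray_derivative smooth_spray_derivative smooth_intros
        smooth_T smooth_G homog_G homog_T homog_mult[OF _ _ homog_T homog_dy_G] refl)
  fix z assume z: "z \<in> S"
  note c = contraction_spray_derivative[OF smooth_T, OF _ z] contraction_lower_index[OF z]
    contraction_other_index
  note e = dynamical_derivative_def distrib_left right_diff_distrib sum.distrib sum_subtractf
  show "(\<Sum>j\<in>UNIV. snd z $ j * dynamical_derivative G T j i k l z) = 0"
    unfolding e by (subst c, simp add: 0 z)+ simp
  show "(\<Sum>k\<in>UNIV. snd z $ k * dynamical_derivative G T j i k l z) = 0"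
    unfolding e by (subst c, simp add: 0 z)+ simp
  show "(\<Sum>l\<in>UNIV. snd z $ l * dynamical_derivative G T j i k l z) = 0"
    unfolding e by (subst c, simp add: 0 z)+ simp
qed

lemma smooth_projective_spray: "smooth_on S (projective_spray G i)"
  unfolding projective_spray_def[abs_def] by (intro smooth_intros smooth_G)

lemma homog_projective_spray: "homog_on S 2 (projective_spray G i)"
proof -
  have 0: "homog_on S 1 (\<lambda>z. \<Sum>m\<in>UNIV. dy m (G m) z)"
    by (intro homog_sum homog_dy_G smooth_dy smooth_G)
  have 1: "homog_on S 1 (\<lambda>z. 1 / (real CARD('n) + 1) * (\<Sum>m\<in>UNIV. dy m (G m) z))"
    by (rule homog_mult[OF _ _ homog_const 0]) (intro smooth_intros smooth_G | simp)+
  have 2: "homog_on S 2 (\<lambda>z. 1 / (real CARD('n) + 1) * (\<Sum>m\<in>UNIV. dy m (G m) z) * snd z $ i)"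
    by (rule homog_mult[OF _ _ 1 homog_fibre_coordinate]) (intro smooth_intros smooth_G | simp)+
  show ?thesis
    unfolding projective_spray_def[abs_def] by (intro homog_diff homog_G 2 smooth_intros smooth_G)
qed

text \<open>The projective spray has degree 2, so its second vertical derivatives have degree 0 and
  Euler's identity annihilates the outermost index. Symmetry of the derivatives carries this to the
  other two.\<close>

lemma vertical_douglas: "vertical_tensor S (- 1) (douglas_of G)"
  unfolding vertical_tensor_def
proof (intro conjI allI ballI)
  have h1: "homog_on S 1 (dy l (projective_spray G i))" for l i
    by (rule homog_dy[OF smooth_projective_spray]) (simp add: homog_projective_spray)
  have h2: "homog_on S 0 (dy k (dy l (projective_spray G i)))" for k l i
    by (rule homog_dy[OF smooth_dy[OF smooth_projective_spray]]) (simp add: h1)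
  show "smooth_on S (douglas_of G j i k l)" for j i k l
    unfolding douglas_of_def by (intro smooth_dy smooth_projective_spray)
  show "homog_on S (- 1) (douglas_of G j i k l)" for j i k l
    unfolding douglas_of_def
    by (rule homog_dy[OF smooth_dy[OF smooth_dy[OF smooth_projective_spray]]]) (simp add: h2)
  fix i k l z assume z: "z \<in> S"
  have jk: "douglas_of G j i k l z = douglas_of G k i j l z" for j k l
    unfolding douglas_of_def dy_eq_dd using z
    by (intro dd_commute[OF open_S]) (simp_all add: smooth_on_dd smooth_projective_spray)
  have kl: "douglas_of G j i k l z = douglas_of G j i l k z" for j k l
    unfolding douglas_of_def using z
    by (intro dy_cong) (simp_all add: dy_eq_dd dd_commute[OF open_S _ smooth_projective_spray])
  show 0: "(\<Sum>j\<in>UNIV. snd z $ j * douglas_of G j i k l z) = 0" for k l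
    unfolding douglas_of_def
    using euler[OF smooth_dy[OF smooth_dy[OF smooth_projective_spray]] h2 z] by simp
  show 1: "(\<Sum>j\<in>UNIV. snd z $ j * douglas_of G k i j l z) = 0" for k l
    unfolding jk[of k] by (rule 0)
  show "(\<Sum>j\<in>UNIV. snd z $ j * douglas_of G k i l j z) = 0"
    unfolding kl[of k l] by (rule 1)
qed

text \<open>Since \<open>y\<close> is parallel, the contributions \<open>- 2 G^i\<close> of the
  spray and \<open>2 G^i\<close> of the upper connection term cancel. The new coefficient of
  \<open>y\<close> is the derivative of \<open>V\<close> as a covariant tensor.\<close>

lemma dynamical_derivative_add_radial:
  assumes T: "\<And>j i k l. smooth_on S (T j i k l)" and V: "\<And>j k l. smooth_on S (V j k l)" and z: "z \<in> S"
  shows "dynamical_derivative G (\<lambda>j i k l z. T j i k l z + V j k l z * snd z $ i) j i k l z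
    = dynamical_derivative G T j i k l z + (spray_derivative G (V j k l) z
      - (\<Sum>r\<in>UNIV. V r k l z * dy j (G r) z) - (\<Sum>r\<in>UNIV. V j r l z * dy k (G r) z)
      - (\<Sum>r\<in>UNIV. V j k r z * dy l (G r) z)) * snd z $ i"
proof -
  have "(\<Sum>r\<in>UNIV. V j k l z * snd z $ r * dy r (G i) z) = V j k l z * (2 * G i z)"
    unfolding euler_G[OF z, symmetric] by (simp add: sum_distrib_left mult.assoc)
  then show ?thesis
    unfolding dynamical_derivative_def using z
    by (simp add: spray_derivative_rules spray_derivative_fibre_coordinate smooth_intros T V
        distrib_right left_diff_distrib sum.distrib sum_distrib_right mult.assoc mult.left_commute
        mult.commute[of _ "snd z $ i"] right_diff_distrib sum_distrib_left)
qed

end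

section \<open>Projective change of the spray\<close>

locale projective_change = spray_region S G for S :: "'n::finite coords set" and G +
  fixes P :: "'n coords \<Rightarrow> real" and G' :: "'n \<Rightarrow> 'n coords \<Rightarrow> real"
  assumes smooth_P: "smooth_on S P" and homog_P: "homog_on S 1 P"
    and G'_eq: "z \<in> S \<Longrightarrow> G' i z = G i z + P z * snd z $ i"
begin

lemma dy_G':
  assumes "z \<in> S"
  shows "dy k (G' i) z = dy k (G i) z + (if i = k then P z else 0) + dy k P z * snd z $ i"
proof -
  have "dy k (G' i) z = dy k (\<lambda>z. G i z + P z * snd z $ i) z"
    using G'_eq by (intro dy_cong assms)
  then show ?thesis
    using assms by (simp add: dy_rules dy_fibre_coordinate smooth_G smooth_P smooth_intros)
qed

sublocale G': spray_region S G'
proof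
  show "smooth_on S (G' i)" for i
    by (rule smooth_on_transform[OF open_S _ G'_eq]) (intro smooth_intros smooth_G smooth_P)
  show "homog_on S 2 (G' i)" for i
    by (rule homog_transform[OF _ G'_eq]) (intro homog_add smooth_intros smooth_G smooth_P homog_G
      homog_mult[OF _ _ homog_P homog_fibre_coordinate], simp)
qed

lemma projective_spray_invariant:
  assumes "z \<in> S"
  shows "projective_spray G' i z = projective_spray G i z"
proof -
  have "(\<Sum>m\<in>UNIV. dy m (G' m) z)
      = (\<Sum>m\<in>UNIV. dy m (G m) z) + real CARD('n) * P z + (\<Sum>m\<in>UNIV. snd z $ m * dy m P z)"
    by (simp add: dy_G'[OF assms] sum.distrib mult.commute)
  then have "(\<Sum>m\<in>UNIV. dy m (G' m) z) = (\<Sum>m\<in>UNIV. dy m (G m) z) + (real CARD('n) + 1) * P z"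
    using euler[OF smooth_P homog_P assms] by (simp add: algebra_simps)
  then show ?thesis
    unfolding projective_spray_def by (simp add: G'_eq[OF assms] field_simps)
qed

lemma douglas_invariant:
  assumes "z \<in> S"
  shows "douglas_of G' j i k l z = douglas_of G j i k l z"
  unfolding douglas_of_def using assms by (intro dy_cong projective_spray_invariant)

text \<open>The count behind the coefficient: the spray gives \<open>- 2 s P\<close> by Euler's
  identity, the upper index \<open>+ P\<close>, each of the three lower indices \<open>- P\<close>.
  Of the terms with derivatives of \<open>P\<close>, that of the upper index is radial, and those of
  the lower indices contain a contraction of \<open>T\<close> with \<open>y\<close>, which is
  zero.\<close>

lemma dynamical_derivative_change:
  assumes T: "vertical_tensor S s T" and z: "z \<in> S"
  shows "dynamical_derivative G' T j i k l z = dynamical_derivative G T j i k l z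
    - (2 * s + 2) * P z * T j i k l z + (\<Sum>r\<in>UNIV. dy r P z * T j r k l z) * snd z $ i"
proof -
  have T': "smooth_on S (T j i k l)" "homog_on S s (T j i k l)" for j i k l
    using T by (simp_all add: vertical_tensor_def)
  have "spray_derivative G' (T j i k l) z = spray_derivative G (T j i k l) z
      - 2 * P z * (\<Sum>r\<in>UNIV. snd z $ r * dy r (T j i k l) z)"
    by (simp add: spray_derivative_expand[OF T'(1) z] G'_eq[OF z] distrib_right sum.distrib
        sum_distrib_left algebra_simps)
  then have S: "spray_derivative G' (T j i k l) z = spray_derivative G (T j i k l) z
      - 2 * P z * (s * T j i k l z)"
    by (simp add: euler[OF T' z])
  have up: "(\<Sum>r\<in>UNIV. T j r k l z * dy r (G' i) z) = (\<Sum>r\<in>UNIV. T j r k l z * dy r (G i) z)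
      + P z * T j i k l z + (\<Sum>r\<in>UNIV. dy r P z * T j r k l z) * snd z $ i"
    by (simp add: dy_G'[OF z] distrib_left sum.distrib sum_distrib_right sum_mult_delta)
      (simp add: ac_simps)
  have low: "(\<Sum>r\<in>UNIV. t r * dy m (G' r) z) = (\<Sum>r\<in>UNIV. t r * dy m (G r) z) + P z * t m"
    if "(\<Sum>r\<in>UNIV. snd z $ r * t r) = 0" for t m
  proof -
    have "(\<Sum>r\<in>UNIV. t r * dy m (G' r) z) = (\<Sum>r\<in>UNIV. t r * dy m (G r) z) + P z * t m
        + dy m P z * (\<Sum>r\<in>UNIV. snd z $ r * t r)"
      by (simp add: dy_G'[OF z] distrib_left sum.distrib sum_distrib_left sum_mult_delta)
        (simp add: ac_simps)
    then show ?thesis using that by simp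
  qed
  have 0: "(\<Sum>j\<in>UNIV. snd z $ j * T j i k l z) = 0" "(\<Sum>k\<in>UNIV. snd z $ k * T j i k l z) = 0"
    "(\<Sum>l\<in>UNIV. snd z $ l * T j i k l z) = 0"
    using T z by (simp_all add: vertical_tensor_def)
  show ?thesis
    unfolding dynamical_derivative_def S up low[OF 0(1)] low[OF 0(2)] low[OF 0(3)]
    by (simp add: algebra_simps)
qed

text \<open>Both derivatives of the Douglas tensor change only by radial terms and by the multiple
  \<open>- 2 * P\<close> of the first derivative; the latter is absorbed into the scalar coefficient.\<close>

lemma second_derivative_change:
  assumes z: "z \<in> S"
  shows "\<exists>u. \<forall>i. dynamical_derivative G' (dynamical_derivative G' (douglas_of G')) j i k l z
      + (c + 2 * P z) * dynamical_derivative G' (douglas_of G') j i k l z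
    = dynamical_derivative G (dynamical_derivative G (douglas_of G)) j i k l z
      + c * dynamical_derivative G (douglas_of G) j i k l z + u * snd z $ i"
proof -
  let ?D = "dynamical_derivative G (douglas_of G)" and ?D' = "dynamical_derivative G' (douglas_of G')"
  define V where "V j k l z = (\<Sum>r\<in>UNIV. dy r P z * douglas_of G j r k l z)" for j k l z
  have sD: "smooth_on S (douglas_of G j i k l)" for j i k l
    using vertical_douglas by (simp add: vertical_tensor_def)
  have sV: "smooth_on S (V j k l)" for j k l
    unfolding V_def[abs_def] by (intro smooth_intros smooth_P sD)
  \<comment> \<open>At degree -1 the coefficient \<open>2 * s + 2\<close> vanishes, so only the
    radial term survives.\<close>
  have D': "?D' j i k l z = ?D j i k l z + V j k l z * snd z $ i" if "z \<in> S" for j i k l z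
  proof -
    have "?D' j i k l z = dynamical_derivative G' (douglas_of G) j i k l z"
      using that douglas_invariant by (intro dynamical_derivative_cong)
    then show ?thesis
      using dynamical_derivative_change[OF vertical_douglas that] by (simp add: V_def)
  qed
  \<comment> \<open>One derivative has raised the degree from -1 to 0, where
    \<open>2 * s + 2\<close> equals 2; this is the source of the term \<open>2 * P\<close>.\<close>
  have v: "vertical_tensor S 0 ?D'"
    using G'.vertical_dynamical_derivative[OF G'.vertical_douglas] by simp
  have sD1: "smooth_on S (?D j i k l)" for j i k l
    by (intro smooth_dynamical_derivative smooth_G sD)
  define u where "u = spray_derivative G (V j k l) z
      - (\<Sum>r\<in>UNIV. V r k l z * dy j (G r) z) - (\<Sum>r\<in>UNIV. V j r l z * dy k (G r) z)
      - (\<Sum>r\<in>UNIV. V j k r z * dy l (G r) z)"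
  have u: "dynamical_derivative G ?D' j i k l z = dynamical_derivative G ?D j i k l z + u * snd z $ i" for i
    unfolding u_def
    by (rule trans[OF dynamical_derivative_cong[OF z D'] dynamical_derivative_add_radial[OF sD1 sV z]])
  define w where "w = (\<Sum>r\<in>UNIV. dy r P z * ?D' j r k l z)"
  have w: "dynamical_derivative G' ?D' j i k l z
      = dynamical_derivative G ?D' j i k l z - 2 * P z * ?D' j i k l z + w * snd z $ i" for i
    using dynamical_derivative_change[OF v z, of j i k l] by (simp add: w_def)
  \<comment> \<open>In the witness, \<open>u\<close> comes from differentiating the radial part
    \<open>V y\<close>, \<open>w\<close> from the second change of spray, and \<open>c * V\<close>
    from exchanging the first derivatives in the scalar term.\<close>
  show ?thesis
    by (rule exI[of _ "u + w + c * V j k l z"]) (simp add: w u D'[OF z] algebra_simps)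
qed

end

section \<open>The spray of a Finsler metric in coordinates\<close>

text \<open>Contracting the linear system with \<open>w\<close> itself makes the quadratic form
  vanish at \<open>w\<close>. Applied to differences, it identifies solutions of the system that
  defines the spray.\<close>

lemma positive_definite_injective:
  fixes M :: "real ^ 'n::finite ^ 'n"
  assumes pos: "\<And>w. w \<noteq> 0 \<Longrightarrow> 0 < (\<Sum>i\<in>UNIV. \<Sum>j\<in>UNIV. M $ i $ j * w $ i * w $ j)"
    and "\<And>i. (\<Sum>j\<in>UNIV. M $ i $ j * w j) = 0"
  shows "w i = 0"
proof (rule ccontr)
  assume "w i \<noteq> 0"
  then have "(\<chi> i. w i) \<noteq> 0" by (auto simp: vec_eq_iff)
  from pos[OF this] have "0 < (\<Sum>i\<in>UNIV. w i * (\<Sum>j\<in>UNIV. M $ i $ j * w j))"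
    by (simp add: sum_distrib_left ac_simps)
  then show False by (simp add: assms(2))
qed

lemma positive_definite_invertible:
  fixes M :: "real ^ 'n::finite ^ 'n"
  assumes "\<And>w. w \<noteq> 0 \<Longrightarrow> 0 < (\<Sum>i\<in>UNIV. \<Sum>j\<in>UNIV. M $ i $ j * w $ i * w $ j)"
  shows "invertible M"
proof -
  have "x = 0" if "M *v x = 0" for x
    using positive_definite_injective[OF assms, of "($) x"] that
    by (simp add: vec_eq_iff matrix_vector_mult_def)
  then show ?thesis
    by (simp add: invertible_left_inverse matrix_left_invertible_ker)
qed

locale slit_region = open_region S for S :: "'n::finite coords set" +
  assumes slit: "z \<in> S \<Longrightarrow> snd z \<noteq> 0"
begin

lemma sum_squares_nonzero:
  assumes "z \<in> S"
  shows "(\<Sum>i\<in>UNIV. snd z $ i * snd z $ i) \<noteq> 0"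
proof
  assume "(\<Sum>i\<in>UNIV. snd z $ i * snd z $ i) = 0"
  then have "\<forall>i. snd z $ i = 0" by (subst (asm) sum_nonneg_eq_0_iff) auto
  with slit[OF assms] show False by (simp add: vec_eq_iff)
qed

text \<open>Contract \<open>H = u y\<close> with \<open>y\<close> and divide by the Euclidean square
  of \<open>y\<close>, which is nonzero on a slit region: \<open>u\<close> becomes an explicit
  smooth expression in \<open>H\<close>. Both \<open>P\<close> and the chosen coefficients
  \<open>U'\<close> obtain their regularity this way.\<close>

lemma smooth_radial_factor:
  assumes "\<And>i. smooth_on S (H i)" "\<And>z i. z \<in> S \<Longrightarrow> H i z = u z * snd z $ i"
  shows "smooth_on S u"
proof (rule smooth_on_transform[OF open_S])
  show "smooth_on S (\<lambda>z. (\<Sum>i\<in>UNIV. H i z * snd z $ i) / (\<Sum>i\<in>UNIV. snd z $ i * snd z $ i))"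
    by (intro smooth_on_divide[OF open_S] smooth_intros assms(1) sum_squares_nonzero)
  show "u z = (\<Sum>i\<in>UNIV. H i z * snd z $ i) / (\<Sum>i\<in>UNIV. snd z $ i * snd z $ i)"
    if "z \<in> S" for z
    using sum_squares_nonzero[OF that] assms(2)[OF that]
    by (simp add: mult.assoc sum_distrib_left[symmetric])
qed

text \<open>The Euler field fixes \<open>y^i\<close>, so the product rule splits off exactly one
  degree; dividing by a nonzero component of \<open>y\<close> leaves the claim for
  \<open>u\<close>.\<close>

lemma homog_radial_factor:
  assumes "smooth_on S u" "\<And>i. homog_on S (s + 1) (\<lambda>z. u z * snd z $ i)"
  shows "homog_on S s u"
  unfolding homog_on_def
proof
  fix z assume z: "z \<in> S"
  obtain i where i: "snd z $ i \<noteq> 0" using slit[OF z] by (auto simp: vec_eq_iff)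
  have "dd (0, snd z) (\<lambda>z. u z * snd z $ i) z = (s + 1) * (u z * snd z $ i)"
    using assms(2) z by (simp add: homog_on_def)
  then have "dd (0, snd z) u z * snd z $ i = (s * u z) * snd z $ i"
    using z assms(1) by (simp add: dd_rules smooth_intros dd_fibre_coordinate algebra_simps)
  with i show "dd (0, snd z) u z = s * u z" by simp
qed

end

section \<open>The energy, its Euler-Lagrange equations and the spray\<close>

locale finsler_region = slit_region S for S :: "'n::finite coords set" +
  fixes f :: "'n coords \<Rightarrow> real"
  assumes smooth_f: "smooth_on S f" and homog_f: "homog_on S 1 f"
    and positive: "z \<in> S \<Longrightarrow> w \<noteq> 0 \<Longrightarrow>
      0 < (\<Sum>i\<in>UNIV. \<Sum>j\<in>UNIV. fundamental_tensor f z $ i $ j * w $ i * w $ j)"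
begin

definition energy :: "'n coords \<Rightarrow> real" where "energy z = (f z)\<^sup>2"

lemma smooth_energy: "smooth_on S energy"
  unfolding energy_def[abs_def] power2_eq_square by (intro smooth_intros smooth_f)

lemma homog_energy: "homog_on S 2 energy"
  unfolding energy_def[abs_def] power2_eq_square
  by (rule homog_mult[OF smooth_f smooth_f homog_f homog_f]) simp

lemma fundamental_tensor_entry: "fundamental_tensor f z $ i $ j = 1 / 2 * dy i (dy j energy) z"
  by (simp add: fundamental_tensor_def energy_def[abs_def])

lemma dy_commute_energy: "z \<in> S \<Longrightarrow> dy i (dy j energy) z = dy j (dy i energy) z"
  unfolding dy_eq_dd by (rule dd_commute[OF open_S _ smooth_energy])

lemma homog_dy_energy: "homog_on S 1 (dy i energy)"
  by (rule homog_dy[OF smooth_energy]) (simp add: homog_energy)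

lemma homog_dy_dy_energy: "homog_on S 0 (dy j (dy i energy))"
  by (rule homog_dy[OF smooth_dy[OF smooth_energy]]) (simp add: homog_dy_energy)

text \<open>Two applications of Euler's identity give \<open>g_ij y^i y^j = F^2\<close>, so positive
  definiteness at \<open>w = y\<close> excludes zeros. The new scalar coefficient has this function
  as its denominator.\<close>

lemma nonzero:
  assumes z: "z \<in> S"
  shows "f z \<noteq> 0"
proof -
  have "0 < (\<Sum>i\<in>UNIV. \<Sum>j\<in>UNIV. fundamental_tensor f z $ i $ j * snd z $ i * snd z $ j)"
    by (rule positive[OF z slit[OF z]])
  also have "\<dots> = 1 / 2 * (\<Sum>j\<in>UNIV. snd z $ j * (\<Sum>i\<in>UNIV. snd z $ i * dy i (dy j energy) z))"
    by (subst sum.swap) (simp add: fundamental_tensor_entry sum_distrib_left ac_simps)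
  also have "\<dots> = energy z"
    using euler[OF smooth_dy[OF smooth_energy] homog_dy_energy z] euler[OF smooth_energy homog_energy z]
    by simp
  finally show ?thesis by (auto simp: energy_def)
qed

definition euler_lagrange_rhs :: "'n \<Rightarrow> 'n coords \<Rightarrow> real" where
  "euler_lagrange_rhs l z = (\<Sum>k\<in>UNIV. dx k (dy l energy) z * snd z $ k) - dx l energy z"

lemma spray_eq: "spray f i z = 1 / 4 * (\<Sum>l\<in>UNIV. matrix_inv (fundamental_tensor f z) $ i $ l *
    euler_lagrange_rhs l z)"
  by (simp add: spray_def euler_lagrange_rhs_def energy_def[abs_def])

lemma invertible_fundamental_tensor: "z \<in> S \<Longrightarrow> invertible (fundamental_tensor f z)"
  using positive by (intro positive_definite_invertible)

lemma smooth_euler_lagrange_rhs: "smooth_on S (euler_lagrange_rhs l)"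
  unfolding euler_lagrange_rhs_def[abs_def] by (intro smooth_intros smooth_energy)

lemma smooth_spray: "smooth_on S (spray f i)"
proof -
  have "smooth_on S (\<lambda>z. fundamental_tensor f z $ i $ j)" for i j
    unfolding fundamental_tensor_entry by (intro smooth_intros smooth_energy)
  then show ?thesis
    unfolding spray_eq[abs_def]
    by (intro smooth_intros smooth_euler_lagrange_rhs smooth_on_matrix_inv[OF open_S]
        invertible_fundamental_tensor)
qed

lemma fundamental_tensor_spray:
  assumes "z \<in> S"
  shows "(\<Sum>r\<in>UNIV. fundamental_tensor f z $ l $ r * spray f r z) = 1 / 4 * euler_lagrange_rhs l z"
proof -
  let ?g = "fundamental_tensor f z" and ?R = "\<chi> l. euler_lagrange_rhs l z"
  have "(\<chi> r. spray f r z) = (1 / 4) *\<^sub>R (matrix_inv ?g *v ?R)"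
    by (simp add: vec_eq_iff spray_eq matrix_vector_mult_def)
  then have "?g *v (\<chi> r. spray f r z) = (1 / 4) *\<^sub>R ((?g ** matrix_inv ?g) *v ?R)"
    by (simp add: matrix_vector_mult_scaleR matrix_vector_mul_assoc)
  then have "?g *v (\<chi> r. spray f r z) = (1 / 4) *\<^sub>R ?R"
    using matrix_inv_works[OF invertible_fundamental_tensor[OF assms]] by simp
  then show ?thesis by (simp add: vec_eq_iff matrix_vector_mult_def)
qed

lemma fundamental_tensor_sum:
  assumes "z \<in> S"
  shows "(\<Sum>r\<in>UNIV. fundamental_tensor f z $ l $ r * v r) = 1 / 2 * (\<Sum>r\<in>UNIV. v r * dy r (dy l energy) z)"
  unfolding fundamental_tensor_entry sum_distrib_left
  by (intro sum.cong refl) (simp add: dy_commute_energy[OF assms, of l])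

text \<open>The hypothesis is the Euler-Lagrange equation at the single point \<open>z\<close>. It
  is linear in the values \<open>H r z\<close> with matrix \<open>4 g\<close>, which is definite.
  Only these values enter, so coefficients frozen at \<open>z\<close> may be tested.\<close>

lemma spray_unique:
  assumes z: "z \<in> S"
    and H: "\<And>l. spray_derivative H (dy l energy) z = dx l energy z"
  shows "H i z = spray f i z"
proof -
  have "2 * (\<Sum>r\<in>UNIV. H r z * dy r (dy l energy) z) = euler_lagrange_rhs l z" for l
    using H[of l]
    by (simp add: spray_derivative_expand[OF smooth_dy[OF smooth_energy] z] euler_lagrange_rhs_def
        mult.commute)
  then have "(\<Sum>r\<in>UNIV. fundamental_tensor f z $ l $ r * H r z) = 1 / 4 * euler_lagrange_rhs l z" for l
    by (simp add: fundamental_tensor_sum[OF z])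
  then have "(\<Sum>r\<in>UNIV. fundamental_tensor f z $ l $ r * (H r z - spray f r z)) = 0" for l
    by (simp add: right_diff_distrib sum_subtractf fundamental_tensor_spray[OF z])
  from positive_definite_injective[OF positive[OF z] this] show ?thesis by simp
qed

lemma spray_derivative_dy_energy:
  assumes z: "z \<in> S"
  shows "spray_derivative (spray f) (dy l energy) z = dx l energy z"
proof -
  have "2 * (\<Sum>r\<in>UNIV. spray f r z * dy r (dy l energy) z) = euler_lagrange_rhs l z"
    using fundamental_tensor_spray[OF z, of l] by (simp add: fundamental_tensor_sum[OF z])
  then show ?thesis
    by (simp add: spray_derivative_expand[OF smooth_dy[OF smooth_energy] z] euler_lagrange_rhs_def
        mult.commute)
qed

text \<open>Instead of differentiating the inverse matrix, Euler's field is applied to the system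
  \<open>g G = R / 4\<close>, where \<open>g\<close> has degree 0 and \<open>R\<close> degree 2;
  definiteness of \<open>g\<close> then isolates \<open>G\<close>.\<close>

lemma homog_spray: "homog_on S 2 (spray f i)"
  unfolding homog_on_def
proof
  fix z assume z: "z \<in> S"
  have sg: "smooth_on S (\<lambda>z. fundamental_tensor f z $ l $ r)" for l r
    unfolding fundamental_tensor_entry by (intro smooth_intros smooth_energy)
  have hg: "homog_on S 0 (\<lambda>z. fundamental_tensor f z $ l $ r)" for l r
    unfolding fundamental_tensor_entry
    by (rule homog_mult[OF _ _ homog_const homog_dy_dy_energy]) (intro smooth_intros smooth_energy | simp)+
  have "homog_on S 2 (\<lambda>z. dx k (dy l energy) z * snd z $ k)" for k l
    by (rule homog_mult[OF _ _ homog_dx[OF _ homog_dy_energy] homog_fibre_coordinate])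
      (intro smooth_intros smooth_energy | simp)+
  then have "homog_on S 2 (euler_lagrange_rhs l)" for l
    unfolding euler_lagrange_rhs_def[abs_def]
    by (intro homog_diff homog_sum smooth_intros smooth_energy homog_dx homog_energy)
  then have "homog_on S 2 (\<lambda>z. 1 / 4 * euler_lagrange_rhs l z)" for l
    by (intro homog_mult[OF smooth_on_const smooth_euler_lagrange_rhs homog_const]) simp_all
  then have R: "dd (0, snd z) (\<lambda>z. 1 / 4 * euler_lagrange_rhs l z) z = 2 * (1 / 4 * euler_lagrange_rhs l z)" for l
    unfolding homog_on_def using z by blast
  have "(\<Sum>r\<in>UNIV. fundamental_tensor f z $ l $ r * (dd (0, snd z) (spray f r) z - 2 * spray f r z)) = 0" for l
  proof -
    have "dd (0, snd z) (\<lambda>z. \<Sum>r\<in>UNIV. fundamental_tensor f z $ l $ r * spray f r z) z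
        = (\<Sum>r\<in>UNIV. fundamental_tensor f z $ l $ r * dd (0, snd z) (spray f r) z)"
      using z hg[unfolded homog_on_def]
      by (simp add: dd_rules smooth_on_mult[OF open_S] sg smooth_spray)
    moreover have "dd (0, snd z) (\<lambda>z. \<Sum>r\<in>UNIV. fundamental_tensor f z $ l $ r * spray f r z) z
        = 2 * (\<Sum>r\<in>UNIV. fundamental_tensor f z $ l $ r * spray f r z)"
      unfolding fundamental_tensor_spray[OF z] R[symmetric]
      by (rule dd_cong[OF open_S z]) (rule fundamental_tensor_spray)
    ultimately show ?thesis
      by (simp add: right_diff_distrib sum_subtractf sum_distrib_left mult.left_commute)
  qed
  from positive_definite_injective[OF positive[OF z] this]
  show "dd (0, snd z) (spray f i) z = 2 * spray f i z" by simp
qed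

sublocale spray_region S "spray f"
  by unfold_locales (rule smooth_spray homog_spray)+

lemma douglas_tilde_eq:
  "z \<in> S \<Longrightarrow> douglas_tilde f j i k l z = dynamical_derivative (spray f) (douglas_of (spray f)) j i k l z"
  unfolding douglas_tilde_def douglas_eq
  using vertical_douglas by (intro berwald_hderiv0_eq) (simp_all add: vertical_tensor_def)

lemma smooth_douglas_tilde: "smooth_on S (douglas_tilde f j i k l)"
  using vertical_douglas by (intro smooth_on_transform[OF open_S _ douglas_tilde_eq]
    smooth_dynamical_derivative smooth_spray) (simp_all add: vertical_tensor_def)

lemma berwald_hderiv0_douglas_tilde:
  assumes "z \<in> S"
  shows "berwald_hderiv0 f (douglas_tilde f) j i k l z
    = dynamical_derivative (spray f) (dynamical_derivative (spray f) (douglas_of (spray f))) j i k l z"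
proof -
  have "berwald_hderiv0 f (douglas_tilde f) j i k l z = dynamical_derivative (spray f) (douglas_tilde f) j i k l z"
    using assms smooth_douglas_tilde by (intro berwald_hderiv0_eq) simp_all
  also have "\<dots> = dynamical_derivative (spray f) (dynamical_derivative (spray f) (douglas_of (spray f))) j i k l z"
    using assms douglas_tilde_eq by (rule dynamical_derivative_cong)
  finally show ?thesis .
qed

lemma smooth_berwald_hderiv0_douglas_tilde: "smooth_on S (berwald_hderiv0 f (douglas_tilde f) j i k l)"
proof (rule smooth_on_transform[OF open_S])
  show "smooth_on S (dynamical_derivative (spray f) (douglas_tilde f) j i k l)"
    by (intro smooth_dynamical_derivative smooth_spray smooth_douglas_tilde)
qed (simp add: berwald_hderiv0_eq smooth_douglas_tilde)

end

section \<open>Change of coordinates\<close>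

lemma dy_const: "dy k (\<lambda>z. c) z = 0"
  by (simp add: dy_eq_dd)

lemma sum_delta_mult:
  fixes t :: "'n::finite \<Rightarrow> real"
  shows "(\<Sum>r\<in>UNIV. (if i = r then c else 0) * t r) = c * t i"
    and "(\<Sum>r\<in>UNIV. (if r = i then c else 0) * t r) = c * t i"
  using sum_mult_delta[of t] by (simp_all add: mult.commute)

lemma sum_axis:
  fixes t :: "'n::finite \<Rightarrow> real"
  shows "(\<Sum>r\<in>UNIV. t r * axis k 1 $ r) = t k" "(\<Sum>r\<in>UNIV. axis k 1 $ r * t r) = t k"
  by (simp_all add: axis_def sum_mult_delta sum_delta_mult)

lemma sum_swap_factors:
  fixes a :: "'n::finite \<Rightarrow> real"
  shows "(\<Sum>r\<in>UNIV. a r * (\<Sum>b\<in>UNIV. c b * y b r)) = (\<Sum>b\<in>UNIV. c b * (\<Sum>r\<in>UNIV. a r * y b r))"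
  unfolding sum_distrib_left by (subst sum.swap) (simp add: mult.left_commute)

text \<open>\<open>O'\<close> is the overlap seen in the first chart and \<open>\<phi>\<close> the
  transition map. \<open>S'\<close> may exceed the image of \<open>S\<close>, so the whole slit
  domain of the second chart can serve. The tangent map is spelled out in the assumptions because
  \<open>\<Phi>\<close> is defined only inside the locale.\<close>

locale chart_change = finsler_region S f + tgt: finsler_region S' f'
  for S S' :: "'n::finite coords set" and f f' +
  fixes O' :: "(real ^ 'n) set" and \<phi> :: "real ^ 'n \<Rightarrow> real ^ 'n"
  assumes open_O: "open O'" and S_eq: "S = O' \<times> (UNIV - {0})" and smooth_\<phi>: "smooth_on O' \<phi>"
    and invertible_jacobian: "x \<in> O' \<Longrightarrow> invertible (\<chi> a k. dd (axis k 1) \<phi> x $ a)"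
    and maps_to: "z \<in> S \<Longrightarrow> (\<phi> (fst z), \<chi> a. \<Sum>k\<in>UNIV. dd (axis k 1) \<phi> (fst z) $ a * snd z $ k) \<in> S'"
    and f_eq: "z \<in> S \<Longrightarrow>
      f z = f' (\<phi> (fst z), \<chi> a. \<Sum>k\<in>UNIV. dd (axis k 1) \<phi> (fst z) $ a * snd z $ k)"
begin

definition J :: "'n \<Rightarrow> 'n \<Rightarrow> 'n coords \<Rightarrow> real" where
  "J a k z = dd (axis k 1) \<phi> (fst z) $ a"

definition \<Phi> :: "'n coords \<Rightarrow> 'n coords" where
  "\<Phi> z = (\<phi> (fst z), \<chi> a. \<Sum>k\<in>UNIV. J a k z * snd z $ k)"

lemma \<Phi>_in: "z \<in> S \<Longrightarrow> \<Phi> z \<in> S'"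
  using maps_to by (simp add: \<Phi>_def J_def)

lemma f_\<Phi>: "z \<in> S \<Longrightarrow> f z = f' (\<Phi> z)"
  using f_eq by (simp add: \<Phi>_def J_def)

lemma fst_in: "z \<in> S \<Longrightarrow> fst z \<in> O'"
  using S_eq by auto

lemma smooth_base: "smooth_on O' g \<Longrightarrow> smooth_on S (\<lambda>z. g (fst z))"
  using fst_in by (intro smooth_on_compose_linear[OF bounded_linear_fst open_S]) auto

lemma smooth_component: "smooth_on O' (\<lambda>x. \<phi> x $ a)"
  by (rule smooth_on_linear_compose[OF bounded_linear_vec_nth open_O smooth_\<phi>])

lemma smooth_J: "smooth_on S (J a k)"
  unfolding J_def[abs_def]
  by (intro smooth_base smooth_on_linear_compose[OF bounded_linear_vec_nth open_O] smooth_on_dd smooth_\<phi>)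

lemma J_component:
  assumes "z \<in> S"
  shows "J a k z = dd (axis k 1) (\<lambda>x. \<phi> x $ a) (fst z)"
  unfolding J_def using smooth_on_differentiable[OF smooth_\<phi> fst_in[OF assms]]
  by (simp add: dd_bounded_linear_compose[OF bounded_linear_vec_nth])

lemma dd_base:
  assumes "smooth_on O' g" "z \<in> S"
  shows "dd w (\<lambda>z. g (fst z)) z = dd (fst w) g (fst z)"
  using dd_chain[OF bounded_linear_imp_differentiable[OF bounded_linear_fst]
      smooth_on_differentiable[OF assms(1) fst_in[OF assms(2)]], of w]
  by (simp add: dd_bounded_linear[OF bounded_linear_fst])

lemma dy_base_function:
  assumes "smooth_on S h" "\<And>z. h z = g (fst z)" "z \<in> S"
  shows "dy k h z = 0"
  unfolding dy_eq_dd using dd_base_function[OF smooth_on_differentiable[OF assms(1,3)] assms(2)] .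

lemma dy_J: "z \<in> S \<Longrightarrow> dy s (J a k) z = 0"
  by (rule dy_base_function[OF smooth_J, of a k "\<lambda>x. dd (axis k 1) \<phi> x $ a"]) (simp_all add: J_def)

lemma dx_J_symmetric:
  assumes z: "z \<in> S"
  shows "dx m (J a k) z = dx k (J a m) z"
proof -
  have *: "dx m (J a k) z = dd (axis m 1) (dd (axis k 1) (\<lambda>x. \<phi> x $ a)) (fst z)" for m k
    using dd_cong[OF open_S z J_component, where v = "(axis m 1, 0)"]
      dd_base[OF smooth_on_dd[OF smooth_component] z, of "(axis m 1, 0)" "axis k 1" a]
    by (simp add: dx_eq_dd)
  show ?thesis
    unfolding * by (rule dd_commute[OF open_O fst_in[OF z] smooth_component])
qed

lemma dy_dx_J:
  assumes z: "z \<in> S"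
  shows "dy s (dx m (J a k)) z = 0"
proof -
  have "dy s (dx m (J a k)) z = dx m (dy s (J a k)) z"
    unfolding dx_eq_dd dy_eq_dd by (rule dd_commute[OF open_S z smooth_J])
  also have "\<dots> = dx m (\<lambda>z. 0) z"
    unfolding dx_eq_dd by (rule dd_cong[OF open_S z]) (simp add: dy_J)
  finally show ?thesis by (simp add: dx_eq_dd)
qed

text \<open>The Hessian of the transition map contracted once with \<open>y\<close>. It measures the
  failure of the spray to be a vector and of its connection to be a tensor.\<close>

definition H :: "'n \<Rightarrow> 'n \<Rightarrow> 'n coords \<Rightarrow> real" where
  "H a k z = (\<Sum>m\<in>UNIV. snd z $ m * dx m (J a k) z)"

lemma smooth_H: "smooth_on S (H a k)"
  unfolding H_def[abs_def] by (intro smooth_intros smooth_J)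

lemma H_symmetric: "z \<in> S \<Longrightarrow> H a k z = (\<Sum>m\<in>UNIV. snd z $ m * dx k (J a m) z)"
  unfolding H_def by (simp add: dx_J_symmetric[of z _ a k])

lemma spray_derivative_J: "z \<in> S \<Longrightarrow> spray_derivative Q (J a k) z = H a k z"
  by (simp add: spray_derivative_expand smooth_J H_def dy_J)

lemma smooth_\<Phi>: "smooth_on S \<Phi>"
proof -
  have "\<Phi> = (\<lambda>z. (\<Sum>i\<in>UNIV. \<phi> (fst z) $ i *\<^sub>R (axis i 1, 0))
      + (\<Sum>a\<in>UNIV. (\<Sum>k\<in>UNIV. J a k z * snd z $ k) *\<^sub>R (0, axis a 1)))" (is "_ = ?F")
  proof
    show "\<Phi> z = ?F z" for z
      using vec_eq_sum_axis[of "\<phi> (fst z)"] vec_eq_sum_axis[of "\<chi> a. \<Sum>k\<in>UNIV. J a k z * snd z $ k"]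
      by (intro prod_eqI) (simp_all add: \<Phi>_def fst_sum snd_sum)
  qed
  moreover have "smooth_on S ?F"
    by (intro smooth_on_add smooth_on_sum open_S smooth_base smooth_component
        smooth_on_linear_compose[OF bounded_linear_scaleR_left open_S] smooth_intros smooth_J)
  ultimately show ?thesis by simp
qed

lemma smooth_pullback:
  fixes h :: "'n coords \<Rightarrow> real"
  shows "smooth_on S' h \<Longrightarrow> smooth_on S (\<lambda>z. h (\<Phi> z))"
  using \<Phi>_in by (intro smooth_on_compose[OF open_S smooth_\<Phi>]) auto

lemma dd_\<Phi>:
  assumes z: "z \<in> S"
  shows "fst (dd w \<Phi> z) $ a = (\<Sum>k\<in>UNIV. fst w $ k * J a k z)"
    and "snd (dd w \<Phi> z) $ a = (\<Sum>k\<in>UNIV. J a k z * snd w $ k) + (\<Sum>k\<in>UNIV. dd w (J a k) z * snd z $ k)"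
proof -
  have d: "\<Phi> differentiable (at z)" by (rule smooth_on_differentiable[OF smooth_\<Phi> z])
  have "fst (dd w \<Phi> z) $ a = dd w (\<lambda>z. fst (\<Phi> z) $ a) z"
    using dd_bounded_linear_compose[OF bounded_linear_compose[OF bounded_linear_vec_nth bounded_linear_fst] d]
    by simp
  also have "\<dots> = dd (fst w) (\<lambda>x. \<phi> x $ a) (fst z)"
    using dd_base[OF smooth_component z] by (simp add: \<Phi>_def)
  also have "\<dots> = dd (\<Sum>k\<in>UNIV. fst w $ k *\<^sub>R axis k 1) (\<lambda>x. \<phi> x $ a) (fst z)"
    by (simp flip: vec_eq_sum_axis)
  finally show "fst (dd w \<Phi> z) $ a = (\<Sum>k\<in>UNIV. fst w $ k * J a k z)"
    using smooth_on_differentiable[OF smooth_component fst_in[OF z]]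
    by (simp add: dd_direction_sum dd_direction_scaleR J_component[OF z])
  have "snd (dd w \<Phi> z) $ a = dd w (\<lambda>z. snd (\<Phi> z) $ a) z"
    using dd_bounded_linear_compose[OF bounded_linear_compose[OF bounded_linear_vec_nth bounded_linear_snd] d]
    by simp
  also have "\<dots> = dd w (\<lambda>z. \<Sum>k\<in>UNIV. J a k z * snd z $ k) z"
    by (simp add: \<Phi>_def)
  finally show "snd (dd w \<Phi> z) $ a = (\<Sum>k\<in>UNIV. J a k z * snd w $ k) + (\<Sum>k\<in>UNIV. dd w (J a k) z * snd z $ k)"
    using z by (simp add: dd_rules smooth_intros smooth_J dd_fibre_coordinate sum.distrib)
qed

lemma dd_pullback:
  assumes "smooth_on S' h" "z \<in> S"
  shows "dd w (\<lambda>z. h (\<Phi> z)) z = dd (dd w \<Phi> z) h (\<Phi> z)"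
  using assms smooth_\<Phi> \<Phi>_in by (intro dd_chain smooth_on_differentiable)

lemma dy_pullback:
  assumes "smooth_on S' h" "z \<in> S"
  shows "dy k (\<lambda>z. h (\<Phi> z)) z = (\<Sum>a\<in>UNIV. J a k z * dy a h (\<Phi> z))"
proof -
  have "dd (0, axis k 1) (J a m) z = 0" for a m
    using dy_J[OF assms(2)] by (simp add: dy_eq_dd)
  then have "snd (dd (0, axis k 1) \<Phi> z) $ a = J a k z" for a
    by (simp add: dd_\<Phi>[OF assms(2)] sum_axis)
  moreover have "fst (dd (0, axis k 1) \<Phi> z) $ a = 0" for a
    by (simp add: dd_\<Phi>[OF assms(2)])
  ultimately show ?thesis
    unfolding dy_eq_dd[of k]
    by (simp add: dd_pullback[OF assms] tgt.expand[OF assms(1) \<Phi>_in[OF assms(2)]])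
qed

lemma dx_pullback:
  assumes "smooth_on S' h" "z \<in> S"
  shows "dx k (\<lambda>z. h (\<Phi> z)) z
    = (\<Sum>a\<in>UNIV. J a k z * dx a h (\<Phi> z)) + (\<Sum>a\<in>UNIV. H a k z * dy a h (\<Phi> z))"
proof -
  have "dd (axis k 1, 0) (J a m) z = dx k (J a m) z" for a m by (simp add: dx_eq_dd)
  then have "snd (dd (axis k 1, 0) \<Phi> z) $ a = H a k z" for a
    by (simp add: dd_\<Phi>[OF assms(2)] H_symmetric[OF assms(2)] mult.commute)
  moreover have "fst (dd (axis k 1, 0) \<Phi> z) $ a = J a k z" for a
    by (simp add: dd_\<Phi>[OF assms(2)] sum_axis)
  ultimately show ?thesis
    unfolding dx_eq_dd[of k]
    by (simp add: dd_pullback[OF assms] tgt.expand[OF assms(1) \<Phi>_in[OF assms(2)]])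
qed

text \<open>The hypothesis on \<open>Q\<close> makes the differential of \<open>\<Phi>\<close> carry
  the vector \<open>(y, - 2 Q)\<close> to \<open>(y', - 2 Q')\<close>. The Hessian enters that
  differential with coefficient 1 through the derivative of \<open>J\<close>, whence the factor 1/2
  in the law for \<open>Q\<close>.\<close>

lemma spray_derivative_pullback:
  assumes h: "smooth_on S' h" and z: "z \<in> S"
    and Q: "\<And>a. (\<Sum>r\<in>UNIV. J a r z * Q r z) = Q' a (\<Phi> z) + 1 / 2 * (\<Sum>k\<in>UNIV. H a k z * snd z $ k)"
  shows "spray_derivative Q (\<lambda>z. h (\<Phi> z)) z = spray_derivative Q' h (\<Phi> z)"
proof -
  let ?w = "(snd z, (- 2) *\<^sub>R (\<chi> r. Q r z))"
  have "dd ?w \<Phi> z = (snd (\<Phi> z), (- 2) *\<^sub>R (\<chi> r. Q' r (\<Phi> z)))"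
  proof (intro prod_eqI vec_eq_iff[THEN iffD2] allI)
    fix a
    show "fst (dd ?w \<Phi> z) $ a = fst (snd (\<Phi> z), (- 2) *\<^sub>R (\<chi> r. Q' r (\<Phi> z))) $ a"
      by (simp add: dd_\<Phi>[OF z] \<Phi>_def mult.commute)
    have "dd ?w (J a k) z = H a k z" for k
      using spray_derivative_J[OF z, of Q a k] by (simp add: spray_derivative_def)
    then have "snd (dd ?w \<Phi> z) $ a = - 2 * (\<Sum>r\<in>UNIV. J a r z * Q r z) + (\<Sum>k\<in>UNIV. H a k z * snd z $ k)"
      by (simp add: dd_\<Phi>[OF z] sum_distrib_left sum_negf mult.left_commute)
    then show "snd (dd ?w \<Phi> z) $ a = snd (snd (\<Phi> z), (- 2) *\<^sub>R (\<chi> r. Q' r (\<Phi> z))) $ a"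
      by (simp add: Q)
  qed
  then show ?thesis
    unfolding spray_derivative_def dd_pullback[OF h z] by simp
qed

section \<open>Transformation laws of the spray, its connection and its divergence\<close>

definition K :: "'n \<Rightarrow> 'n \<Rightarrow> 'n coords \<Rightarrow> real" where
  "K s a z = matrix_inv (\<chi> a k. J a k z) $ s $ a"

lemma invertible_J: "z \<in> S \<Longrightarrow> invertible (\<chi> a k. J a k z)"
  using invertible_jacobian[OF fst_in] by (simp add: J_def)

lemma smooth_K: "smooth_on S (K s a)"
  unfolding K_def[abs_def]
  by (intro smooth_on_matrix_inv[OF open_S] invertible_J) (simp_all add: smooth_J)

lemma dy_K: "z \<in> S \<Longrightarrow> dy k (K s a) z = 0"
  by (rule dy_base_function[OF smooth_K, of s a "\<lambda>x. matrix_inv (\<chi> a k. dd (axis k 1) \<phi> x $ a) $ s $ a"])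
    (simp_all add: K_def J_def)

lemma JK:
  assumes "z \<in> S"
  shows "(\<Sum>s\<in>UNIV. J b s z * K s a z) = (if b = a then 1 else 0)"
    and "(\<Sum>a\<in>UNIV. K s a z * J a r z) = (if s = r then 1 else 0)"
  using matrix_inv_works[OF invertible_J[OF assms]]
  by (simp_all add: vec_eq_iff matrix_matrix_mult_def mat_def K_def)

lemma energy_pullback: "z \<in> S \<Longrightarrow> energy z = tgt.energy (\<Phi> z)"
  by (simp add: energy_def tgt.energy_def f_\<Phi>)

text \<open>The transformed coefficients satisfy the Euler--Lagrange equations characterizing the spray.\<close>

lemma spray_change:
  assumes z: "z \<in> S"
  shows "(\<Sum>r\<in>UNIV. J a r z * spray f r z)
    = spray f' a (\<Phi> z) + 1 / 2 * (\<Sum>k\<in>UNIV. H a k z * snd z $ k)"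
proof -
  define c where "c a = spray f' a (\<Phi> z) + 1 / 2 * (\<Sum>k\<in>UNIV. H a k z * snd z $ k)" for a
  \<comment> \<open>The candidate solves \<open>J Q = c\<close> at the fixed \<open>z\<close>. Its
    argument \<open>z'\<close> is ignored: both the pullback rule and the uniqueness of the spray
    look at the value at \<open>z\<close> only.\<close>
  define Q where "Q r z' = (\<Sum>a\<in>UNIV. K r a z * c a)" for r and z' :: "'n coords"
  have JQ: "(\<Sum>r\<in>UNIV. J a r z * Q r z) = c a" for a
  proof -
    have "(\<Sum>r\<in>UNIV. J a r z * Q r z) = (\<Sum>b\<in>UNIV. (\<Sum>r\<in>UNIV. J a r z * K r b z) * c b)"
      unfolding Q_def sum_distrib_left sum_distrib_right by (subst sum.swap) (simp add: mult.assoc)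
    then show ?thesis by (simp add: JK[OF z] sum_delta_mult)
  qed
  have dyE: "dy l energy z = (\<Sum>a\<in>UNIV. J a l z * dy a tgt.energy (\<Phi> z))" if "z \<in> S" for l z
    using that dy_cong[OF that energy_pullback] by (simp add: dy_pullback tgt.smooth_energy)
  have E: "spray_derivative Q (\<lambda>z. dy a tgt.energy (\<Phi> z)) z = dx a tgt.energy (\<Phi> z)" for a
    using spray_derivative_pullback[OF tgt.smooth_dy[OF tgt.smooth_energy] z, of Q "spray f'" a]
    by (simp add: JQ c_def tgt.spray_derivative_dy_energy[OF \<Phi>_in[OF z]])
  have "spray_derivative Q (dy l energy) z = dx l energy z" for l
  proof -
    have "spray_derivative Q (dy l energy) z
        = spray_derivative Q (\<lambda>z. \<Sum>a\<in>UNIV. J a l z * dy a tgt.energy (\<Phi> z)) z"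
      by (rule spray_derivative_cong[OF z dyE])
    also have "\<dots> = (\<Sum>a\<in>UNIV. J a l z * spray_derivative Q (\<lambda>z. dy a tgt.energy (\<Phi> z)) z
        + H a l z * dy a tgt.energy (\<Phi> z))"
      using z by (simp add: spray_derivative_rules smooth_on_mult[OF open_S] smooth_J smooth_pullback
          tgt.smooth_dy tgt.smooth_energy spray_derivative_J)
    \<comment> \<open>The terms with \<open>H\<close> left by the product rule are precisely the
      Hessian terms of \<open>dx_pullback\<close>.\<close>
    finally show ?thesis
      unfolding E using dd_cong[OF open_S z energy_pullback] dx_pullback[OF tgt.smooth_energy z, of l]
      by (simp add: dx_eq_dd sum.distrib)
  qed
  then have "Q r z = spray f r z" for r by (rule spray_unique[OF z])
  then show ?thesis using JQ by (simp add: c_def)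
qed

lemma spray_derivative_spray_pullback:
  "smooth_on S' h \<Longrightarrow> z \<in> S \<Longrightarrow>
    spray_derivative (spray f) (\<lambda>z. h (\<Phi> z)) z = spray_derivative (spray f') h (\<Phi> z)"
  by (rule spray_derivative_pullback) (assumption | rule spray_change)+

text \<open>Take the vertical derivative of the spray law. In the quadratic term \<open>y\<close>
  can be differentiated explicitly or inside \<open>H\<close>; by symmetry of the Hessian both give
  \<open>H a s\<close>, and the factor 1/2 disappears.\<close>

lemma connection_change:
  assumes z: "z \<in> S"
  shows "(\<Sum>r\<in>UNIV. J a r z * dy s (spray f r) z)
    = (\<Sum>b\<in>UNIV. J b s z * dy b (spray f' a) (\<Phi> z)) + H a s z"
proof -
  have dH: "dy s (H a k) z = dx s (J a k) z" for k
    unfolding H_def[abs_def] using z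
    by (simp add: dy_rules smooth_intros smooth_J dy_dx_J dy_fibre_coordinate sum_delta_mult)
  have "dy s (\<lambda>z. \<Sum>r\<in>UNIV. J a r z * spray f r z) z
      = dy s (\<lambda>z. spray f' a (\<Phi> z) + 1 / 2 * (\<Sum>k\<in>UNIV. H a k z * snd z $ k)) z"
    by (rule dy_cong[OF z spray_change])
  moreover have "dy s (\<lambda>z. \<Sum>r\<in>UNIV. J a r z * spray f r z) z = (\<Sum>r\<in>UNIV. J a r z * dy s (spray f r) z)"
    using z by (simp add: dy_rules smooth_on_mult[OF open_S] smooth_J smooth_spray dy_J)
  moreover have "dy s (\<lambda>z. spray f' a (\<Phi> z) + 1 / 2 * (\<Sum>k\<in>UNIV. H a k z * snd z $ k)) z
      = (\<Sum>b\<in>UNIV. J b s z * dy b (spray f' a) (\<Phi> z))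
        + 1 / 2 * (\<Sum>k\<in>UNIV. H a k z * (if k = s then 1 else 0) + dx s (J a k) z * snd z $ k)"
    unfolding dy_pullback[OF tgt.smooth_spray z, symmetric] using z
    by (simp only: dy_rules smooth_pullback tgt.smooth_spray smooth_intros smooth_H
        dH dy_fibre_coordinate dy_const)
  moreover have "(\<Sum>k\<in>UNIV. H a k z * (if k = s then 1 else 0) + dx s (J a k) z * snd z $ k) = 2 * H a s z"
    by (simp add: sum.distrib sum_mult_delta) (simp add: H_symmetric[OF z, of a s] mult.commute)
  ultimately show ?thesis by simp
qed

text \<open>Contract the connection law with the inverse Jacobian. The extra term is the trace of
  the inverse Jacobian times its derivative along \<open>y\<close>, that is, the derivative of the
  logarithm of the absolute Jacobian determinant.\<close>

lemma trace_change:
  assumes z: "z \<in> S"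
  shows "(\<Sum>m\<in>UNIV. dy m (spray f m) z) = (\<Sum>b\<in>UNIV. dy b (spray f' b) (\<Phi> z))
    + (\<Sum>s\<in>UNIV. \<Sum>a\<in>UNIV. K s a z * H a s z)"
proof -
  have "(\<Sum>s\<in>UNIV. \<Sum>a\<in>UNIV. K s a z * (\<Sum>r\<in>UNIV. J a r z * dy s (spray f r) z))
      = (\<Sum>s\<in>UNIV. \<Sum>r\<in>UNIV. (\<Sum>a\<in>UNIV. K s a z * J a r z) * dy s (spray f r) z)"
    unfolding sum_distrib_left sum_distrib_right mult.assoc
    by (intro sum.cong refl sum.swap)
  also have "\<dots> = (\<Sum>m\<in>UNIV. dy m (spray f m) z)"
    by (simp add: JK[OF z] sum_delta_mult)
  finally have 1: "(\<Sum>s\<in>UNIV. \<Sum>a\<in>UNIV. K s a z * (\<Sum>r\<in>UNIV. J a r z * dy s (spray f r) z))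
      = (\<Sum>m\<in>UNIV. dy m (spray f m) z)" .
  have "(\<Sum>s\<in>UNIV. \<Sum>a\<in>UNIV. K s a z * (\<Sum>b\<in>UNIV. J b s z * dy b (spray f' a) (\<Phi> z)))
      = (\<Sum>a\<in>UNIV. \<Sum>s\<in>UNIV. \<Sum>b\<in>UNIV. (J b s z * K s a z) * dy b (spray f' a) (\<Phi> z))"
    unfolding sum_distrib_left by (subst sum.swap) (simp add: ac_simps)
  also have "\<dots> = (\<Sum>a\<in>UNIV. \<Sum>b\<in>UNIV. (\<Sum>s\<in>UNIV. J b s z * K s a z) * dy b (spray f' a) (\<Phi> z))"
    unfolding sum_distrib_right by (intro sum.cong refl sum.swap)
  also have "\<dots> = (\<Sum>b\<in>UNIV. dy b (spray f' b) (\<Phi> z))"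
    by (simp add: JK[OF z] sum_delta_mult)
  finally show ?thesis
    using 1 unfolding connection_change[OF z] by (simp add: distrib_left sum.distrib)
qed

text \<open>The coefficients, depending on the base point only, of the quadratic form in \<open>y\<close> by which the
  projective spray fails to be a vector.\<close>

definition inhomogeneity :: "'n \<Rightarrow> 'n \<Rightarrow> 'n \<Rightarrow> 'n coords \<Rightarrow> real" where
  "inhomogeneity a m k z = 1 / 2 * dx m (J a k) z
    - 1 / (real CARD('n) + 1) * (\<Sum>s\<in>UNIV. \<Sum>b\<in>UNIV. K s b z * dx m (J b s) z) * J a k z"

lemma smooth_inhomogeneity: "smooth_on S (inhomogeneity a m k)"
  unfolding inhomogeneity_def[abs_def] by (intro smooth_intros smooth_J smooth_K)

lemma dy_inhomogeneity:
  assumes z: "z \<in> S"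
  shows "dy l (inhomogeneity a m k) z = 0"
  unfolding inhomogeneity_def[abs_def] using z
  by (simp only: dy_rules smooth_intros smooth_J smooth_K dy_J dy_K dy_dx_J dy_const) simp

text \<open>Both corrections are quadratic in \<open>y\<close>: the Hessian term of the spray, and
  the trace term, linear in \<open>y\<close>, times the new fibre coordinate, also linear in
  \<open>y\<close>.\<close>

lemma projective_spray_change:
  assumes z: "z \<in> S"
  shows "(\<Sum>i\<in>UNIV. J a i z * projective_spray (spray f) i z)
    = projective_spray (spray f') a (\<Phi> z)
      + (\<Sum>m\<in>UNIV. \<Sum>k\<in>UNIV. inhomogeneity a m k z * (snd z $ m * snd z $ k))"
proof -
  define c where "c = 1 / (real CARD('n) + 1)"
  define t where "t = (\<Sum>m\<in>UNIV. dy m (spray f m) z)"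
  define t' where "t' = (\<Sum>m\<in>UNIV. dy m (spray f' m) (\<Phi> z))"
  have y': "snd (\<Phi> z) $ a = (\<Sum>k\<in>UNIV. J a k z * snd z $ k)" by (simp add: \<Phi>_def)
  have "(\<Sum>s\<in>UNIV. \<Sum>b\<in>UNIV. K s b z * H b s z)
      = (\<Sum>s\<in>UNIV. \<Sum>b\<in>UNIV. \<Sum>m\<in>UNIV. snd z $ m * (K s b z * dx m (J b s) z))"
    unfolding H_def sum_distrib_left by (simp add: mult.left_commute)
  also have "\<dots> = (\<Sum>m\<in>UNIV. snd z $ m * (\<Sum>s\<in>UNIV. \<Sum>b\<in>UNIV. K s b z * dx m (J b s) z))"
    unfolding sum_distrib_left
    by (rule trans[OF sum.cong[OF refl sum.swap] sum.swap])
  finally have k: "t = t' + (\<Sum>m\<in>UNIV. snd z $ m * (\<Sum>s\<in>UNIV. \<Sum>b\<in>UNIV. K s b z * dx m (J b s) z))"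
    unfolding t_def t'_def trace_change[OF z] by simp
  have *: "c * (\<Sum>m\<in>UNIV. snd z $ m * w m) * snd (\<Phi> z) $ a
      = (\<Sum>m\<in>UNIV. \<Sum>k\<in>UNIV. c * w m * J a k z * (snd z $ m * snd z $ k))" for w
    unfolding y' mult.assoc sum_product sum_distrib_left[of c] by (simp add: ac_simps)
  have "(\<Sum>i\<in>UNIV. J a i z * projective_spray (spray f) i z)
      = (\<Sum>i\<in>UNIV. J a i z * spray f i z) - c * t * snd (\<Phi> z) $ a"
    unfolding projective_spray_def c_def[symmetric] t_def[symmetric] y'
    by (simp add: right_diff_distrib sum_subtractf sum_distrib_left ac_simps)
  also have "\<dots> = projective_spray (spray f') a (\<Phi> z) + 1 / 2 * (\<Sum>k\<in>UNIV. H a k z * snd z $ k)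
      - c * (\<Sum>m\<in>UNIV. snd z $ m * (\<Sum>s\<in>UNIV. \<Sum>b\<in>UNIV. K s b z * dx m (J b s) z)) * snd (\<Phi> z) $ a"
    unfolding spray_change[OF z] projective_spray_def c_def[symmetric] t'_def[symmetric] k
    by (simp add: algebra_simps)
  also have "1 / 2 * (\<Sum>k\<in>UNIV. H a k z * snd z $ k)
      = (\<Sum>m\<in>UNIV. \<Sum>k\<in>UNIV. 1 / 2 * dx m (J a k) z * (snd z $ m * snd z $ k))"
    unfolding H_def sum_distrib_left sum_distrib_right by (subst sum.swap) (simp add: ac_simps)
  also have "c * (\<Sum>m\<in>UNIV. snd z $ m * (\<Sum>s\<in>UNIV. \<Sum>b\<in>UNIV. K s b z * dx m (J b s) z)) * snd (\<Phi> z) $ a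
      = (\<Sum>m\<in>UNIV. \<Sum>k\<in>UNIV. c * (\<Sum>s\<in>UNIV. \<Sum>b\<in>UNIV. K s b z * dx m (J b s) z) * J a k z * (snd z $ m * snd z $ k))"
    by (rule *)
  finally show ?thesis
    unfolding inhomogeneity_def c_def[symmetric]
    by (simp add: left_diff_distrib sum_subtractf)
qed

text \<open>This is why the Douglas tensor is a tensor although the projective spray is not a
  vector: three vertical derivatives remove a quadratic form in \<open>y\<close> whose coefficients
  are constant along the fibres.\<close>

lemma third_dy_quadratic:
  assumes C: "\<And>m k. smooth_on S (C m k)" "\<And>m k l z. z \<in> S \<Longrightarrow> dy l (C m k) z = 0" and z: "z \<in> S"
  shows "dy j (dy k (dy l (\<lambda>z. \<Sum>m\<in>UNIV. \<Sum>n\<in>UNIV. C m n z * (snd z $ m * snd z $ n)))) z = 0"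
proof -
  let ?d = "\<lambda>m l. (if m = l then 1 else 0) :: real"
  have 1: "dy l (\<lambda>z. \<Sum>m\<in>UNIV. \<Sum>n\<in>UNIV. C m n z * (snd z $ m * snd z $ n)) z
      = (\<Sum>m\<in>UNIV. \<Sum>n\<in>UNIV. C m n z * (snd z $ m * ?d n l + ?d m l * snd z $ n))" if "z \<in> S" for z
    using that by (simp only: dy_rules smooth_intros C dy_fibre_coordinate) simp
  have 2: "dy k (\<lambda>z. \<Sum>m\<in>UNIV. \<Sum>n\<in>UNIV. C m n z * (snd z $ m * ?d n l + ?d m l * snd z $ n)) z
      = (\<Sum>m\<in>UNIV. \<Sum>n\<in>UNIV. C m n z * (?d m k * ?d n l + ?d m l * ?d n k))" if "z \<in> S" for z
    using that by (simp only: dy_rules smooth_intros C dy_fibre_coordinate dy_const) simp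
  have "dy j (dy k (dy l (\<lambda>z. \<Sum>m\<in>UNIV. \<Sum>n\<in>UNIV. C m n z * (snd z $ m * snd z $ n)))) z
      = dy j (\<lambda>z. \<Sum>m\<in>UNIV. \<Sum>n\<in>UNIV. C m n z * (?d m k * ?d n l + ?d m l * ?d n k)) z"
    by (rule dy_cong[OF z]) (subst dy_cong[OF _ 1], simp_all only: 2)
  also have "\<dots> = 0"
    using z by (simp only: dy_rules smooth_intros C dy_const) simp
  finally show ?thesis .
qed

text \<open>The transformation law of a tensor of type (1,3), multiplied by the Jacobian in the
  contravariant index so that no inverse matrix occurs.\<close>

definition pull :: "('n \<Rightarrow> 'n \<Rightarrow> 'n \<Rightarrow> real) \<Rightarrow> 'n \<Rightarrow> 'n \<Rightarrow> 'n \<Rightarrow> 'n coords \<Rightarrow> real" where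
  "pull X j k l z = (\<Sum>b\<in>UNIV. J b j z * (\<Sum>c\<in>UNIV. J c k z * (\<Sum>d\<in>UNIV. J d l z * X b c d)))"

definition related :: "'n tensor13 \<Rightarrow> 'n tensor13 \<Rightarrow> bool" where
  "related T T' \<longleftrightarrow> (\<forall>z\<in>S. \<forall>a j k l.
     (\<Sum>i\<in>UNIV. J a i z * T j i k l z) = pull (\<lambda>b c d. T' b a c d (\<Phi> z)) j k l z)"

lemma relatedD:
  "related T T' \<Longrightarrow> z \<in> S \<Longrightarrow>
    (\<Sum>i\<in>UNIV. J a i z * T j i k l z) = pull (\<lambda>b c d. T' b a c d (\<Phi> z)) j k l z"
  by (simp add: related_def)

lemma dy_J_sum:
  assumes "\<And>i. smooth_on S (t i)" "z \<in> S"
  shows "dy k (\<lambda>z. \<Sum>i\<in>UNIV. J a i z * t i z) z = (\<Sum>i\<in>UNIV. J a i z * dy k (t i) z)"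
    and "dy k (\<lambda>z. \<Sum>i\<in>UNIV. J i a z * t i z) z = (\<Sum>i\<in>UNIV. J i a z * dy k (t i) z)"
  using assms by (simp_all add: dy_rules smooth_on_mult[OF open_S] smooth_J dy_J)

text \<open>Differentiate the law of the projective spray three times vertically. On the left
  \<open>J\<close> passes through, being constant along the fibres; on the right each derivative of
  a pullback brings out one covariant factor \<open>J\<close>; the inhomogeneity dies.\<close>

lemma douglas_related: "related (douglas_of (spray f)) (douglas_of (spray f'))"
  unfolding related_def
proof (intro ballI allI)
  fix z a j k l assume z: "z \<in> S"
  let ?p = "\<lambda>i. projective_spray (spray f) i" and ?p' = "projective_spray (spray f') a"
  let ?q = "\<lambda>z. \<Sum>m\<in>UNIV. \<Sum>k\<in>UNIV. inhomogeneity a m k z * (snd z $ m * snd z $ k)"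
  have sp: "smooth_on S (\<lambda>z. ?p' (\<Phi> z))" and sq: "smooth_on S ?q"
    by (intro smooth_pullback tgt.smooth_projective_spray smooth_intros smooth_inhomogeneity)+
  have s: "smooth_on S (?p i)" for i by (rule smooth_projective_spray)
  have s': "smooth_on S' ?p'" by (rule tgt.smooth_projective_spray)
  have L1: "dy l (\<lambda>z. \<Sum>i\<in>UNIV. J a i z * ?p i z) z = (\<Sum>i\<in>UNIV. J a i z * dy l (?p i) z)" if "z \<in> S" for z
    by (rule dy_J_sum[OF s that])
  have L2: "dy k (\<lambda>z. \<Sum>i\<in>UNIV. J a i z * dy l (?p i) z) z = (\<Sum>i\<in>UNIV. J a i z * dy k (dy l (?p i)) z)" if "z \<in> S" for z
    by (rule dy_J_sum[OF smooth_dy[OF s] that])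
  have L: "dy j (dy k (dy l (\<lambda>z. \<Sum>i\<in>UNIV. J a i z * ?p i z))) z
      = (\<Sum>i\<in>UNIV. J a i z * douglas_of (spray f) j i k l z)"
    unfolding douglas_of_def dy_J_sum(1)[OF smooth_dy[OF smooth_dy[OF s]] z, symmetric]
    by (rule dy_cong[OF z]) (subst dy_cong[OF _ L1], simp_all only: L2)
  have R1: "dy l (\<lambda>z. ?p' (\<Phi> z)) z = (\<Sum>d\<in>UNIV. J d l z * dy d ?p' (\<Phi> z))" if "z \<in> S" for z
    by (rule dy_pullback[OF s' that])
  have R2: "dy k (\<lambda>z. \<Sum>d\<in>UNIV. J d l z * dy d ?p' (\<Phi> z)) z
      = (\<Sum>d\<in>UNIV. J d l z * (\<Sum>c\<in>UNIV. J c k z * dy c (dy d ?p') (\<Phi> z)))" if "z \<in> S" for z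
    unfolding dy_J_sum(2)[OF smooth_pullback[OF tgt.smooth_dy[OF s']] that]
    by (simp only: dy_pullback[OF tgt.smooth_dy[OF s'] that])
  have R3: "dy j (\<lambda>z. \<Sum>d\<in>UNIV. J d l z * (\<Sum>c\<in>UNIV. J c k z * dy c (dy d ?p') (\<Phi> z))) z
      = (\<Sum>d\<in>UNIV. J d l z * (\<Sum>c\<in>UNIV. J c k z * (\<Sum>b\<in>UNIV. J b j z * dy b (dy c (dy d ?p')) (\<Phi> z))))"
    by (subst dy_J_sum(2) dy_pullback, (intro smooth_intros smooth_J smooth_pullback tgt.smooth_dy s' z)+)+ (rule refl)
  have R: "dy j (dy k (dy l (\<lambda>z. ?p' (\<Phi> z)))) z
      = (\<Sum>d\<in>UNIV. J d l z * (\<Sum>c\<in>UNIV. J c k z * (\<Sum>b\<in>UNIV. J b j z * dy b (dy c (dy d ?p')) (\<Phi> z))))"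
    unfolding R3[symmetric] by (rule dy_cong[OF z]) (subst dy_cong[OF _ R1], simp_all only: R2)
  have A1: "dy l (\<lambda>z. \<Sum>i\<in>UNIV. J a i z * ?p i z) z = dy l (\<lambda>z. ?p' (\<Phi> z)) z + dy l ?q z" if "z \<in> S" for z
    by (rule trans[OF dy_cong[OF that projective_spray_change] dy_rules(1)[OF that sp sq]])
  have A2: "dy k (dy l (\<lambda>z. \<Sum>i\<in>UNIV. J a i z * ?p i z)) z
      = dy k (dy l (\<lambda>z. ?p' (\<Phi> z))) z + dy k (dy l ?q) z" if "z \<in> S" for z
    by (rule trans[OF dy_cong[OF that A1] dy_rules(1)[OF that smooth_dy[OF sp] smooth_dy[OF sq]]])
  have "dy j (dy k (dy l (\<lambda>z. \<Sum>i\<in>UNIV. J a i z * ?p i z))) z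
      = dy j (dy k (dy l (\<lambda>z. ?p' (\<Phi> z)))) z + dy j (dy k (dy l ?q)) z"
    by (rule trans[OF dy_cong[OF z A2]
          dy_rules(1)[OF z smooth_dy[OF smooth_dy[OF sp]] smooth_dy[OF smooth_dy[OF sq]]]])
  also have "dy j (dy k (dy l ?q)) z = 0"
    by (rule third_dy_quadratic[OF smooth_inhomogeneity dy_inhomogeneity z])
  finally have "(\<Sum>i\<in>UNIV. J a i z * douglas_of (spray f) j i k l z)
      = (\<Sum>d\<in>UNIV. J d l z * (\<Sum>c\<in>UNIV. J c k z * (\<Sum>b\<in>UNIV. J b j z * dy b (dy c (dy d ?p')) (\<Phi> z))))"
    unfolding L R by simp
  \<comment> \<open>The chain rule delivers the summations in the order \<open>d\<close>,
    \<open>c\<close>, \<open>b\<close>, while \<open>pull\<close> has \<open>b\<close>,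
    \<open>c\<close>, \<open>d\<close>.\<close>
  also have "\<dots> = (\<Sum>d\<in>UNIV. J d l z * (\<Sum>b\<in>UNIV. J b j z * (\<Sum>c\<in>UNIV. J c k z * dy b (dy c (dy d ?p')) (\<Phi> z))))"
    by (subst sum_swap_factors) (rule refl)
  also have "\<dots> = (\<Sum>b\<in>UNIV. J b j z * (\<Sum>d\<in>UNIV. J d l z * (\<Sum>c\<in>UNIV. J c k z * dy b (dy c (dy d ?p')) (\<Phi> z))))"
    by (rule sum_swap_factors)
  also have "\<dots> = pull (\<lambda>b c d. douglas_of (spray f') b a c d (\<Phi> z)) j k l z"
    unfolding pull_def douglas_of_def by (intro sum.cong refl arg_cong2[where f = "(*)"] sum_swap_factors)
  finally show "(\<Sum>i\<in>UNIV. J a i z * douglas_of (spray f) j i k l z)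
    = pull (\<lambda>b c d. douglas_of (spray f') b a c d (\<Phi> z)) j k l z" .
qed

section \<open>Covariance of the derivative along the spray\<close>

lemma pull_add: "pull X j k l z + pull Y j k l z = pull (\<lambda>b c d. X b c d + Y b c d) j k l z"
  by (simp add: pull_def distrib_left sum.distrib)

lemma pull_diff: "pull X j k l z - pull Y j k l z = pull (\<lambda>b c d. X b c d - Y b c d) j k l z"
  by (simp add: pull_def right_diff_distrib sum_subtractf)

lemma pull_mult: "r * pull X j k l z = pull (\<lambda>b c d. r * X b c d) j k l z"
  by (simp add: pull_def sum_distrib_left mult.left_commute)

lemma pull_sum:
  "(\<Sum>e\<in>UNIV. r e * pull (\<lambda>b c d. X b c d e) j k l z)
    = pull (\<lambda>b c d. \<Sum>e\<in>(UNIV :: 'n set). r e * X b c d e) j k l z"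
  unfolding pull_def sum_swap_factors[of r] ..

text \<open>The connection law contracted with a pulled-back covector: it carries a connection term
  past one factor \<open>J\<close> of \<open>pull\<close>, at the price of a Hessian term.\<close>

lemma connection_pull:
  assumes z: "z \<in> S"
  shows "(\<Sum>r\<in>UNIV. dy s (spray f r) z * (\<Sum>b\<in>UNIV. J b r z * x b))
    = (\<Sum>b\<in>UNIV. J b s z * (\<Sum>e\<in>UNIV. dy b (spray f' e) (\<Phi> z) * x e)) + (\<Sum>b\<in>UNIV. H b s z * x b)"
proof -
  have "(\<Sum>r\<in>UNIV. dy s (spray f r) z * (\<Sum>b\<in>UNIV. J b r z * x b))
      = (\<Sum>e\<in>UNIV. x e * (\<Sum>r\<in>UNIV. J e r z * dy s (spray f r) z))"
    using sum_swap_factors[of "\<lambda>r. dy s (spray f r) z" x "\<lambda>b r. J b r z"]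
    by (simp add: mult.commute)
  also have "\<dots> = (\<Sum>e\<in>UNIV. x e * (\<Sum>b\<in>UNIV. J b s z * dy b (spray f' e) (\<Phi> z))) + (\<Sum>b\<in>UNIV. H b s z * x b)"
    by (simp add: connection_change[OF z] distrib_left sum.distrib mult.commute)
  also have "(\<Sum>e\<in>UNIV. x e * (\<Sum>b\<in>UNIV. J b s z * dy b (spray f' e) (\<Phi> z)))
      = (\<Sum>b\<in>UNIV. J b s z * (\<Sum>e\<in>UNIV. dy b (spray f' e) (\<Phi> z) * x e))"
    unfolding sum_swap_factors[of x] by (simp add: mult.commute)
  finally show ?thesis .
qed

text \<open>The spray differentiates the Jacobian factors on both sides of the transformation law
  and so creates one Hessian term per index; the inhomogeneous connection law creates the same four
  with opposite sign.\<close>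

lemma dynamical_derivative_related:
  assumes T: "related T T'" "\<And>j i k l. smooth_on S (T j i k l)" "\<And>j i k l. smooth_on S' (T' j i k l)"
  shows "related (dynamical_derivative (spray f) T) (dynamical_derivative (spray f') T')"
  unfolding related_def
proof (intro ballI allI)
  fix z a j k l assume z: "z \<in> S"
  define X where "X b c d = T' b a c d (\<Phi> z)" for b c d
  define N' where "N' b e = dy b (spray f' e) (\<Phi> z)" for b e
  \<comment> \<open>\<open>HT\<close> belongs to the contravariant index; \<open>H1\<close>,
    \<open>H2\<close>, \<open>H3\<close> belong to the three covariant ones.\<close>
  define HT where "HT = (\<Sum>i\<in>UNIV. H a i z * T j i k l z)"
  define H1 where "H1 = (\<Sum>b\<in>UNIV. H b j z * (\<Sum>c\<in>UNIV. J c k z * (\<Sum>d\<in>UNIV. J d l z * X b c d)))"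
  define H2 where "H2 = (\<Sum>b\<in>UNIV. J b j z * (\<Sum>c\<in>UNIV. H c k z * (\<Sum>d\<in>UNIV. J d l z * X b c d)))"
  define H3 where "H3 = (\<Sum>b\<in>UNIV. J b j z * (\<Sum>c\<in>UNIV. J c k z * (\<Sum>d\<in>UNIV. H d l z * X b c d)))"
  have rel: "(\<Sum>i\<in>UNIV. J a i z * T j i k l z) = pull X j k l z" for j k l
    using relatedD[OF T(1) z] unfolding X_def .
  note conn = connection_pull[OF z, folded N'_def]

  have "(\<Sum>i\<in>UNIV. J a i z * spray_derivative (spray f) (T j i k l) z) + HT
      = spray_derivative (spray f) (\<lambda>z. \<Sum>i\<in>UNIV. J a i z * T j i k l z) z"
    unfolding HT_def using z
    by (simp add: spray_derivative_rules smooth_on_mult[OF open_S] smooth_J T(2) spray_derivative_J sum.distrib)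
  also have "\<dots> = spray_derivative (spray f) (\<lambda>z. \<Sum>b\<in>UNIV. J b j z * (\<Sum>c\<in>UNIV. J c k z *
      (\<Sum>d\<in>UNIV. J d l z * T' b a c d (\<Phi> z)))) z"
    using relatedD[OF T(1)] by (intro spray_derivative_cong[OF z]) (simp add: pull_def)
  also have "\<dots> = pull (\<lambda>b c d. spray_derivative (spray f') (T' b a c d) (\<Phi> z)) j k l z + H1 + H2 + H3"
    using z by (simp add: spray_derivative_rules smooth_intros smooth_J smooth_pullback T(3) spray_derivative_J
       spray_derivative_spray_pullback sum.distrib distrib_left H1_def H2_def H3_def X_def pull_def)
  finally have 0: "(\<Sum>i\<in>UNIV. J a i z * spray_derivative (spray f) (T j i k l) z) + HT
      = pull (\<lambda>b c d. spray_derivative (spray f') (T' b a c d) (\<Phi> z)) j k l z + H1 + H2 + H3" .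

  have "(\<Sum>i\<in>UNIV. J a i z * (\<Sum>r\<in>UNIV. T j r k l z * dy r (spray f i) z))
      = (\<Sum>r\<in>UNIV. T j r k l z * ((\<Sum>e\<in>UNIV. J e r z * N' e a) + H a r z))"
    unfolding sum_swap_factors[of "\<lambda>i. J a i z"] by (simp add: connection_change[OF z] N'_def)
  also have "\<dots> = (\<Sum>r\<in>UNIV. T j r k l z * (\<Sum>e\<in>UNIV. N' e a * J e r z)) + HT"
    by (simp add: distrib_left sum.distrib HT_def mult.commute)
  also have "(\<Sum>r\<in>UNIV. T j r k l z * (\<Sum>e\<in>UNIV. N' e a * J e r z))
      = (\<Sum>e\<in>UNIV. N' e a * pull (\<lambda>b c d. T' b e c d (\<Phi> z)) j k l z)"
    unfolding sum_swap_factors[of "\<lambda>r. T j r k l z"] relatedD[OF T(1) z, symmetric]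
    by (simp add: mult.commute)
  also have "\<dots> = pull (\<lambda>b c d. \<Sum>e\<in>UNIV. T' b e c d (\<Phi> z) * N' e a) j k l z"
    unfolding pull_sum by (simp add: mult.commute)
  finally have up: "(\<Sum>i\<in>UNIV. J a i z * (\<Sum>r\<in>UNIV. T j r k l z * dy r (spray f i) z))
      = pull (\<lambda>b c d. \<Sum>e\<in>UNIV. T' b e c d (\<Phi> z) * N' e a) j k l z + HT" .

  have low: "(\<Sum>i\<in>UNIV. J a i z * (\<Sum>r\<in>UNIV. t r i * dy m (spray f r) z))
      = (\<Sum>r\<in>UNIV. dy m (spray f r) z * (\<Sum>i\<in>UNIV. J a i z * t r i))" for t m
    using sum_swap_factors[of "\<lambda>i. J a i z" "\<lambda>r. dy m (spray f r) z" t] by (simp add: mult.commute)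
  have 1: "(\<Sum>i\<in>UNIV. J a i z * (\<Sum>r\<in>UNIV. T r i k l z * dy j (spray f r) z))
      = pull (\<lambda>b c d. \<Sum>e\<in>UNIV. X e c d * N' b e) j k l z + H1"
    unfolding low rel unfolding pull_def conn H1_def sum_swap_factors[of "N' b" for b]
    by (simp add: mult.commute)
  have 2: "(\<Sum>i\<in>UNIV. J a i z * (\<Sum>r\<in>UNIV. T j i r l z * dy k (spray f r) z))
      = pull (\<lambda>b c d. \<Sum>e\<in>UNIV. X b e d * N' c e) j k l z + H2"
    unfolding low rel unfolding pull_def H2_def sum_swap_factors[of "\<lambda>r. dy k (spray f r) z"] conn
      sum_swap_factors[of "N' b" for b]
    by (simp add: mult.commute distrib_left sum.distrib)
  have 3: "(\<Sum>i\<in>UNIV. J a i z * (\<Sum>r\<in>UNIV. T j i k r z * dy l (spray f r) z))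
      = pull (\<lambda>b c d. \<Sum>e\<in>UNIV. X b c e * N' d e) j k l z + H3"
    unfolding low rel unfolding pull_def H3_def sum_swap_factors[of "\<lambda>r. dy l (spray f r) z"] conn
    by (simp add: mult.commute distrib_left sum.distrib)
  have "(\<Sum>i\<in>UNIV. J a i z * dynamical_derivative (spray f) T j i k l z)
      = pull (\<lambda>b c d. spray_derivative (spray f') (T' b a c d) (\<Phi> z)) j k l z
        + pull (\<lambda>b c d. \<Sum>e\<in>UNIV. T' b e c d (\<Phi> z) * N' e a) j k l z
        - pull (\<lambda>b c d. \<Sum>e\<in>UNIV. X e c d * N' b e) j k l z
        - pull (\<lambda>b c d. \<Sum>e\<in>UNIV. X b e d * N' c e) j k l z
        - pull (\<lambda>b c d. \<Sum>e\<in>UNIV. X b c e * N' d e) j k l z"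
    unfolding dynamical_derivative_def right_diff_distrib distrib_left sum.distrib sum_subtractf up 1 2 3
    using 0 by simp
  then show "(\<Sum>i\<in>UNIV. J a i z * dynamical_derivative (spray f) T j i k l z)
      = pull (\<lambda>b c d. dynamical_derivative (spray f') T' b a c d (\<Phi> z)) j k l z"
    unfolding pull_add pull_diff by (simp add: dynamical_derivative_def X_def N'_def)
qed

lemma douglas_tilde_related: "related (douglas_tilde f) (douglas_tilde f')"
proof -
  have "related (dynamical_derivative (spray f) (douglas_of (spray f)))
      (dynamical_derivative (spray f') (douglas_of (spray f')))"
    using vertical_douglas tgt.vertical_douglas
    by (intro dynamical_derivative_related douglas_related) (simp_all add: vertical_tensor_def)
  then show ?thesis
    using \<Phi>_in by (simp add: related_def douglas_tilde_eq tgt.douglas_tilde_eq)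
qed

lemma berwald_hderiv0_douglas_tilde_related:
  "related (berwald_hderiv0 f (douglas_tilde f)) (berwald_hderiv0 f' (douglas_tilde f'))"
proof -
  have "related (dynamical_derivative (spray f) (douglas_tilde f))
      (dynamical_derivative (spray f') (douglas_tilde f'))"
    by (intro dynamical_derivative_related douglas_tilde_related smooth_douglas_tilde tgt.smooth_douglas_tilde)
  then show ?thesis
    using \<Phi>_in
    by (simp add: related_def berwald_hderiv0_eq tgt.berwald_hderiv0_eq smooth_douglas_tilde tgt.smooth_douglas_tilde)
qed

text \<open>With the same number \<open>r\<close> on both sides the combination is tensorial, and
  \<open>y\<close> transforms as a vector; dividing by a nonzero component of the new
  \<open>y\<close> leaves the covariant law for the coefficient.\<close>

lemma radial_related:
  assumes z: "z \<in> S" and T: "related T T'" "related V V'"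
    and u: "\<And>j i k l. T j i k l z + r * V j i k l z = u j k l * snd z $ i"
    and u': "\<And>j i k l. T' j i k l (\<Phi> z) + r * V' j i k l (\<Phi> z) = u' j k l * snd (\<Phi> z) $ i"
  shows "u j k l = pull u' j k l z"
proof -
  obtain a where a: "snd (\<Phi> z) $ a \<noteq> 0"
    using tgt.slit[OF \<Phi>_in[OF z]] by (auto simp: vec_eq_iff)
  have "u j k l * snd (\<Phi> z) $ a = (\<Sum>i\<in>UNIV. J a i z * (T j i k l z + r * V j i k l z))"
    unfolding u by (simp add: \<Phi>_def sum_distrib_left mult.left_commute)
  also have "\<dots> = (\<Sum>i\<in>UNIV. J a i z * T j i k l z) + r * (\<Sum>i\<in>UNIV. J a i z * V j i k l z)"
    by (simp add: distrib_left sum.distrib sum_distrib_left mult.left_commute)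
  also have "\<dots> = pull (\<lambda>b c d. u' b c d * snd (\<Phi> z) $ a) j k l z"
    unfolding relatedD[OF T(1) z] relatedD[OF T(2) z] pull_mult pull_add u' ..
  also have "\<dots> = pull u' j k l z * snd (\<Phi> z) $ a"
    using pull_mult[of "snd (\<Phi> z) $ a" u' j k l z] by (simp add: mult.commute)
  finally show ?thesis using a by simp
qed

end

section \<open>Finsler metrics on the manifold\<close>

lemma atlas_chart: "smooth_atlas A \<Longrightarrow> c \<in> A \<Longrightarrow> is_chart c"
  by (simp add: smooth_atlas_def)

lemma bundle_point:
  assumes "smooth_atlas A" "c \<in> A" "z \<in> (snd c ` fst c) \<times> UNIV"
  shows "bundle_point A c z \<in> tangent_bundle A" "fst (bundle_point A c z) \<in> fst c"
    "bundle_chart c (bundle_point A c z) = z"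
proof -
  have z: "z \<in> bundle_chart c ` {v \<in> tangent_bundle A. fst v \<in> fst c}"
    using bundle_chart_bij[OF assms(1,2)] assms(3) by (simp add: bij_betw_def)
  show "bundle_point A c z \<in> tangent_bundle A" "fst (bundle_point A c z) \<in> fst c"
    using inv_into_into[OF z] by (simp_all add: bundle_point_def)
  show "bundle_chart c (bundle_point A c z) = z"
    using f_inv_into_f[OF z] by (simp add: bundle_point_def)
qed

lemma bundle_point_chart:
  assumes "smooth_atlas A" "c \<in> A" "v \<in> tangent_bundle A" "fst v \<in> fst c"
  shows "bundle_point A c (bundle_chart c v) = v"
  using bundle_chart_bij[OF assms(1,2)] assms(3,4) unfolding bundle_point_def bij_betw_def
  by (intro inv_into_f_f) simp_all

lemma tangent_bundle_scale:
  assumes A: "smooth_atlas A" and v: "(p, \<xi>) \<in> tangent_bundle A"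
  shows "(p, \<lambda>c. t *\<^sub>R \<xi> c) \<in> tangent_bundle A"
proof -
  have 1: "t *\<^sub>R \<xi> c' = frechet_derivative (transition c c') (at (snd c p)) (t *\<^sub>R \<xi> c)"
    if "c \<in> A" "c' \<in> A" "p \<in> fst c \<inter> fst c'" for c c'
  proof -
    have "frechet_derivative (transition c c') (at (snd c p)) (t *\<^sub>R \<xi> c)
        = t *\<^sub>R frechet_derivative (transition c c') (at (snd c p)) (\<xi> c)"
      by (rule linear_cmul[OF has_derivative_linear[OF transition_has_derivative[OF A that]]])
    also have "frechet_derivative (transition c c') (at (snd c p)) (\<xi> c) = \<xi> c'"
      using tangent_bundle_trans[OF v that(1,2)] that(3) by simp
    finally show ?thesis by (rule sym)
  qed
  have 2: "t *\<^sub>R \<xi> c = 0" if "\<not> (c \<in> A \<and> p \<in> fst c)" for c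
    using tangent_bundle_zero[OF v that] by simp
  show ?thesis
    unfolding tangent_bundle_def mem_Collect_eq prod.case
    by (intro conjI ballI allI impI; (rule 1 | rule 2); assumption)
qed

lemma bundle_point_scale:
  assumes A: "smooth_atlas A" and c: "c \<in> A" and x: "x \<in> snd c ` fst c"
    and v: "bundle_point A c (x, y) = (p, \<xi>)"
  shows "bundle_point A c (x, t *\<^sub>R y) = (p, \<lambda>c. t *\<^sub>R \<xi> c)"
proof -
  have z: "(x, y) \<in> (snd c ` fst c) \<times> UNIV" using x by simp
  have *: "(p, \<xi>) \<in> tangent_bundle A" "p \<in> fst c" "bundle_chart c (p, \<xi>) = (x, y)"
    using bundle_point[OF A c z] unfolding v by simp_all
  have "(x, t *\<^sub>R y) = bundle_chart c (p, \<lambda>c. t *\<^sub>R \<xi> c)"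
    using *(3) by (simp add: bundle_chart_def)
  then show ?thesis
    using bundle_point_chart[OF A c tangent_bundle_scale[OF A *(1)]] *(2) by simp
qed

lemma local_rep_scale:
  assumes A: "smooth_atlas A" and c: "c \<in> A" and F: "pos_homogeneous1 A F"
    and x: "x \<in> snd c ` fst c" and t: "t > 0"
  shows "local_rep A F c (x, t *\<^sub>R y) = t * local_rep A F c (x, y)"
proof -
  obtain p \<xi> where v: "bundle_point A c (x, y) = (p, \<xi>)" by (rule prod.exhaust)
  have "(p, \<xi>) \<in> tangent_bundle A"
    using bundle_point(1)[OF A c, of "(x, y)"] x unfolding v by simp
  then show ?thesis
    using F t unfolding pos_homogeneous1_def local_rep_def bundle_point_scale[OF A c x v] v by blast
qed

lemma open_slit_domain: "is_chart c \<Longrightarrow> open (slit_domain c)"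
  unfolding slit_domain_def is_chart_def by (intro open_Times) auto

text \<open>Euler's identity results from differentiating \<open>f (x, t y) = t f (x, y)\<close> at
  \<open>t = 1\<close>.\<close>

lemma homog_local_rep:
  assumes A: "smooth_atlas A" and c: "c \<in> A" and F: "pos_homogeneous1 A F"
    and s: "smooth_on (slit_domain c) (local_rep A F c)"
  shows "homog_on (slit_domain c) 1 (local_rep A F c)"
  unfolding homog_on_def
proof
  fix z assume z: "z \<in> slit_domain c"
  let ?f = "local_rep A F c"
  obtain x y where xy: "z = (x, y)" by (rule prod.exhaust)
  have x: "x \<in> snd c ` fst c" using z by (simp add: slit_domain_def xy)
  have "((\<lambda>t::real. (x, t *\<^sub>R y)) has_derivative (\<lambda>t. t *\<^sub>R (0, y))) (at 1)"
    by (auto intro!: derivative_eq_intros)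
  moreover have "(?f has_derivative (\<lambda>w. dd w ?f z)) (at (x, 1 *\<^sub>R y))"
    using has_derivative_dd[OF smooth_on_differentiable[OF s z]] by (simp add: xy)
  ultimately have 0: "((\<lambda>t::real. ?f (x, t *\<^sub>R y)) has_derivative (\<lambda>t. dd (t *\<^sub>R (0, y)) ?f z)) (at 1)"
    by (rule has_derivative_compose)
  \<comment> \<open>Homogeneity is available for positive \<open>t\<close> only, so the two
    functions of \<open>t\<close> are compared on the open half-line around 1.\<close>
  have 1: "((\<lambda>t::real. t * ?f (x, y)) has_derivative (\<lambda>t. dd (t *\<^sub>R (0, y)) ?f z)) (at 1)"
    by (rule has_derivative_transform_within_open[OF 0, of "{0<..}"])
      (simp_all add: local_rep_scale[OF A c F x])
  have "((\<lambda>t::real. t * ?f (x, y)) has_derivative (\<lambda>t. t * ?f (x, y))) (at 1)"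
    by (auto intro!: derivative_eq_intros)
  from fun_cong[OF has_derivative_unique[OF 1 this], of 1]
  show "dd (0, snd z) ?f z = 1 * ?f z" by (simp add: xy)
qed

lemma finsler_region_chart:
  assumes A: "smooth_atlas A" and F: "finsler_metric A F" and c: "c \<in> A"
  shows "finsler_region (slit_domain c) (local_rep A F c)"
proof unfold_locales
  show "open (slit_domain c)" by (rule open_slit_domain[OF atlas_chart[OF A c]])
  show "snd z \<noteq> 0" if "z \<in> slit_domain c" for z using that by (auto simp: slit_domain_def)
  show s: "smooth_on (slit_domain c) (local_rep A F c)"
    using F c by (simp add: finsler_metric_def smooth_on_TM0_def)
  show "homog_on (slit_domain c) 1 (local_rep A F c)"
    using F by (intro homog_local_rep A c s) (simp add: finsler_metric_def)
  show "0 < (\<Sum>i\<in>UNIV. \<Sum>j\<in>UNIV. fundamental_tensor (local_rep A F c) z $ i $ j * w $ i * w $ j)"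
    if "z \<in> slit_domain c" "w \<noteq> 0" for z w
    using F c that by (simp add: finsler_metric_def)
qed

lemma finsler_region_subset:
  assumes "finsler_region S f" "open T" "T \<subseteq> S"
  shows "finsler_region T f"
proof -
  interpret finsler_region S f by fact
  show ?thesis
  proof unfold_locales
    show "smooth_on T f" by (rule smooth_on_subset[OF smooth_f assms(3)])
    show "homog_on T 1 f" using homog_f assms(3) by (auto simp: homog_on_def)
  qed (use assms(2,3) slit positive in auto)
qed

section \<open>Transition maps as changes of coordinates\<close>

definition overlap :: "('m, 'n::finite) chart \<Rightarrow> ('m, 'n) chart \<Rightarrow> 'n coords set" where
  "overlap c c' = (snd c ` (fst c \<inter> fst c')) \<times> (UNIV - {0})"

lemma matrix_dd_transition:
  assumes "smooth_atlas A" "c \<in> A" "c' \<in> A" "p \<in> fst c" "p \<in> fst c'"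
  shows "(\<chi> a k. dd (axis k 1) (transition c c') (snd c p) $ a) *v v
    = frechet_derivative (transition c c') (at (snd c p)) v"
proof -
  have "linear (frechet_derivative (transition c c') (at (snd c p)))"
    using assms by (intro has_derivative_linear[OF transition_has_derivative[OF assms(1-3)]]) simp
  from fun_cong[OF matrix_vector_mul(2)[OF this], of v] show ?thesis
    by (simp add: matrix_def dd_def)
qed

text \<open>By the cocycle identity the differential of the reverse transition is a left inverse, so
  the kernel is trivial.\<close>

lemma invertible_transition:
  assumes A: "smooth_atlas A" and c: "c \<in> A" "c' \<in> A" and p: "p \<in> fst c" "p \<in> fst c'"
  shows "invertible (\<chi> a k. dd (axis k 1) (transition c c') (snd c p) $ a)"
proof -
  have "x = 0" if "(\<chi> a k. dd (axis k 1) (transition c c') (snd c p) $ a) *v x = 0" for x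
  proof -
    have 0: "frechet_derivative (transition c c') (at (snd c p)) x = 0"
      using that by (simp add: matrix_dd_transition[OF A c p])
    have "linear (frechet_derivative (transition c' c) (at (snd c' p)))"
      using p by (intro has_derivative_linear[OF transition_has_derivative[OF A c(2,1)]]) simp
    from linear_0[OF this] show ?thesis
      using transition_cocycle[OF A c c(1) p p(1), of x] transition_self[OF atlas_chart[OF A c(1)] p(1)]
      by (simp add: 0)
  qed
  then show ?thesis by (simp add: invertible_left_inverse matrix_left_invertible_ker)
qed

lemma bundle_chart_change:
  assumes A: "smooth_atlas A" and c: "c \<in> A" "c' \<in> A"
    and v: "v \<in> tangent_bundle A" "fst v \<in> fst c" "fst v \<in> fst c'"
  shows "bundle_chart c' v = (transition c c' (fst (bundle_chart c v)),
    \<chi> a. \<Sum>k\<in>UNIV. dd (axis k 1) (transition c c') (fst (bundle_chart c v)) $ a * snd (bundle_chart c v) $ k)"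
proof -
  obtain p \<xi> where p: "v = (p, \<xi>)" by (rule prod.exhaust)
  have *: "p \<in> fst c" "p \<in> fst c'" using v p by simp_all
  have "\<xi> c' = (\<chi> a k. dd (axis k 1) (transition c c') (snd c p) $ a) *v \<xi> c"
    using tangent_bundle_trans[of p \<xi> A c c'] v(1) c * unfolding p matrix_dd_transition[OF A c *] by blast
  then have "\<xi> c' = (\<chi> a. \<Sum>k\<in>UNIV. dd (axis k 1) (transition c c') (snd c p) $ a * \<xi> c $ k)"
    by (simp add: matrix_vector_mult_def)
  moreover have "transition c c' (snd c p) = snd c' p"
    using is_chart_inv[OF atlas_chart[OF A c(1)] *(1)] by (simp add: transition_def)
  ultimately show ?thesis by (simp add: bundle_chart_def p)
qed

lemma overlap_cases:
  assumes A: "smooth_atlas A" and c: "c \<in> A" "c' \<in> A" and z: "z \<in> overlap c c'"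
  obtains v where "v \<in> tangent_bundle A" "fst v \<in> fst c" "fst v \<in> fst c'" "snd v c \<noteq> 0" "z = bundle_chart c v"
proof -
  have z': "z \<in> (snd c ` fst c) \<times> UNIV" using z by (auto simp: overlap_def)
  let ?v = "bundle_point A c z"
  note b = bundle_point[OF A c(1) z']
  obtain q where q: "q \<in> fst c" "q \<in> fst c'" "fst z = snd c q" "snd z \<noteq> 0"
    using z unfolding overlap_def by force
  have "snd c (fst ?v) = snd c q" using b(3) q(3) by (metis bundle_chart_def fst_conv)
  then have "fst ?v = q"
    using is_chart_inv[OF atlas_chart[OF A c(1)]] b(2) q(1) by metis
  moreover have "snd ?v c = snd z" using b(3) by (metis bundle_chart_def snd_conv)
  ultimately show ?thesis using that[of ?v] b q by simp
qed

lemma chart_change_atlas: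
  assumes A: "smooth_atlas A" and F: "finsler_metric A F" and c: "c \<in> A" "c' \<in> A"
  shows "chart_change (overlap c c') (slit_domain c') (local_rep A F c) (local_rep A F c')
    (snd c ` (fst c \<inter> fst c')) (transition c c')"
proof -
  have ov: "open (snd c ` (fst c \<inter> fst c'))"
    by (rule open_chart_overlap[OF atlas_chart[OF A c(1)] atlas_chart[OF A c(2)]])
  then have "open (overlap c c')" unfolding overlap_def by (intro open_Times) auto
  moreover have "overlap c c' \<subseteq> slit_domain c" by (auto simp: overlap_def slit_domain_def)
  ultimately have src: "finsler_region (overlap c c') (local_rep A F c)"
    by (rule finsler_region_subset[OF finsler_region_chart[OF A F c(1)]])
  let ?\<Phi> = "\<lambda>z. (transition c c' (fst z),
      \<chi> a. \<Sum>k\<in>UNIV. dd (axis k 1) (transition c c') (fst z) $ a * snd z $ k)"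
  have inv: "invertible (\<chi> a k. dd (axis k 1) (transition c c') x $ a)"
    if "x \<in> snd c ` (fst c \<inter> fst c')" for x
    using that invertible_transition[OF A c] by auto
  \<comment> \<open>Invertibility keeps nonzero vectors nonzero, so the tangent map lands in the
    slit domain of the second chart.\<close>
  have nz: "snd (?\<Phi> z) \<noteq> 0" if "z \<in> overlap c c'" for z
  proof
    assume "snd (?\<Phi> z) = 0"
    then have "(\<chi> a k. dd (axis k 1) (transition c c') (fst z) $ a) *v snd z = 0"
      by (simp add: matrix_vector_mult_def)
    moreover have "invertible (\<chi> a k. dd (axis k 1) (transition c c') (fst z) $ a)"
      using that by (intro inv) (auto simp: overlap_def)
    ultimately have "snd z = 0"
      by (simp add: invertible_left_inverse matrix_left_invertible_ker)
    then show False using that by (auto simp: overlap_def)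
  qed
  have \<Phi>: "?\<Phi> z \<in> slit_domain c' \<and> local_rep A F c z = local_rep A F c' (?\<Phi> z)"
    if z: "z \<in> overlap c c'" for z
  proof -
    obtain v where v: "v \<in> tangent_bundle A" "fst v \<in> fst c" "fst v \<in> fst c'" "z = bundle_chart c v"
      by (rule overlap_cases[OF A c z])
    have "?\<Phi> z = bundle_chart c' v"
      using bundle_chart_change[OF A c v(1-3)] v(4) by simp
    then show ?thesis
      using nz[OF z] v bundle_point_chart[OF A c(1) v(1,2)] bundle_point_chart[OF A c(2) v(1,3)]
      by (auto simp: slit_domain_def local_rep_def bundle_chart_def)
  qed
  show ?thesis
  proof (intro chart_change.intro chart_change_axioms.intro src finsler_region_chart[OF A F c(2)] ov inv)
    show "overlap c c' = snd c ` (fst c \<inter> fst c') \<times> (UNIV - {0})" by (simp add: overlap_def)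
    show "smooth_on (snd c ` (fst c \<inter> fst c')) (transition c c')"
      using A c by (simp add: smooth_atlas_def)
  qed (use \<Phi> in blast)+
qed

section \<open>The W-GDW equation on the manifold\<close>

lemma W_GDW_equationD:
  assumes "W_GDW_equation A F lam U" "c \<in> A" "z \<in> slit_domain c"
  shows "berwald_hderiv0 (local_rep A F c) (douglas_tilde (local_rep A F c)) j i k l z
      + local_rep A lam c z * local_rep A F c z * douglas_tilde (local_rep A F c) j i k l z
    = U c j k l z * snd z $ i"
  using assms unfolding W_GDW_equation_def Let_def by blast

text \<open>The coefficients \<open>U\<close> inherit the tensor law from the left-hand side, since \<open>y \<noteq> 0\<close>.\<close>

lemma W_GDW_equation_tensor:
  assumes A: "smooth_atlas A" and F: "finsler_metric A F" and W: "W_GDW_equation A F lam U"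
  shows "tensor_field3 A U"
  unfolding tensor_field3_def
proof (intro ballI impI allI)
  fix c c' v j k l
  assume c: "c \<in> A" "c' \<in> A" and v: "v \<in> tangent_bundle A" "fst v \<in> fst c \<inter> fst c' \<and> snd v c \<noteq> 0"
  interpret chart_change "overlap c c'" "slit_domain c'" "local_rep A F c" "local_rep A F c'"
    "snd c ` (fst c \<inter> fst c')" "transition c c'"
    by (rule chart_change_atlas[OF A F c])
  define z where "z = bundle_chart c v"
  have z: "z \<in> overlap c c'" using v by (auto simp: z_def overlap_def bundle_chart_def)
  then have zc: "z \<in> slit_domain c" by (auto simp: overlap_def slit_domain_def)
  have \<Phi>z: "\<Phi> z = bundle_chart c' v"
    using bundle_chart_change[OF A c v(1)] v(2) by (simp add: \<Phi>_def J_def z_def)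
  \<comment> \<open>Both factors are functions on the tangent bundle, and both coordinate
    representations are evaluated at the same vector \<open>v\<close>; this product is the common
    \<open>r\<close> of \<open>radial_related\<close>.\<close>
  have lam: "local_rep A lam c z * local_rep A F c z = local_rep A lam c' (\<Phi> z) * local_rep A F c' (\<Phi> z)"
    using v(2) bundle_point_chart[OF A c(1) v(1)] bundle_point_chart[OF A c(2) v(1)]
    unfolding \<Phi>z local_rep_def by (simp add: z_def)
  have "U c j k l z = pull (\<lambda>j k l. U c' j k l (\<Phi> z)) j k l z"
    by (rule radial_related[OF z berwald_hderiv0_douglas_tilde_related douglas_tilde_related
          W_GDW_equationD[OF W c(1) zc] W_GDW_equationD[OF W c(2) \<Phi>_in[OF z], folded lam]])
  moreover have "jacobian c c' (fst v) a j = J a j z" for a j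
    by (simp add: jacobian_def J_def dd_def z_def bundle_chart_def)
  ultimately show "U c j k l (bundle_chart c v) = (\<Sum>a\<in>UNIV. \<Sum>b\<in>UNIV. \<Sum>d\<in>UNIV.
      jacobian c c' (fst v) a j * jacobian c c' (fst v) b k * jacobian c c' (fst v) d l *
      U c' a b d (bundle_chart c' v))"
    unfolding \<Phi>z by (simp add: z_def[symmetric] pull_def sum_distrib_left mult.assoc)
qed

text \<open>One construction serves both regularity notions: smoothness is claimed as an implication
  from that of \<open>lam\<close>. The tensor law is left to
  \<open>W_GDW_equation_tensor\<close>.\<close>

lemma W_GDW_equation_projective:
  assumes A: "smooth_atlas A" and F: "finsler_metric A F" and Fbar: "finsler_metric A Fbar"
    and pe: "projectively_equivalent A F Fbar" and W: "W_GDW_equation A F lam U"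
  shows "\<exists>lam' U'. W_GDW_equation A Fbar lam' U' \<and> (smooth_on_TM0 A lam \<longrightarrow>
    smooth_on_TM0 A lam' \<and> (\<forall>c\<in>A. \<forall>j k l. smooth_on (slit_domain c) (U' c j k l)))"
proof -
  obtain P where P: "\<And>c z i. c \<in> A \<Longrightarrow> z \<in> slit_domain c \<Longrightarrow>
      spray (local_rep A Fbar c) i z = spray (local_rep A F c) i z + local_rep A P c z * snd z $ i"
    using pe unfolding projectively_equivalent_def by blast
  \<comment> \<open>Chosen so that \<open>lam' * Fbar\<close> is \<open>lam * F + 2 * P\<close>. On
    the zero section, where \<open>Fbar\<close> vanishes, the quotient is 0 by convention and the
    equation is not imposed.\<close>
  define lam' where "lam' v = (lam v * F v + 2 * P v) / Fbar v" for v
  define L where "L c j i k l z = berwald_hderiv0 (local_rep A Fbar c) (douglas_tilde (local_rep A Fbar c)) j i k l z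
      + local_rep A lam' c z * local_rep A Fbar c z * douglas_tilde (local_rep A Fbar c) j i k l z"
    for c j i k l z
  \<comment> \<open>Only existence of the factor is established, separately for each index triple;
    \<open>y\<close> being nonzero makes it unique.\<close>
  define U' where "U' c j k l z = (SOME u. \<forall>i. L c j i k l z = u * snd z $ i)" for c j k l z
  have P_smooth: "smooth_on (slit_domain c) (local_rep A P c)"
    and change: "projective_change (slit_domain c) (spray (local_rep A F c)) (local_rep A P c)
      (spray (local_rep A Fbar c))" if c: "c \<in> A" for c
  proof -
    interpret f: finsler_region "slit_domain c" "local_rep A F c" by (rule finsler_region_chart[OF A F c])
    interpret g: finsler_region "slit_domain c" "local_rep A Fbar c" by (rule finsler_region_chart[OF A Fbar c])
    have eq: "spray (local_rep A Fbar c) i z - spray (local_rep A F c) i z = local_rep A P c z * snd z $ i"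
      if "z \<in> slit_domain c" for z i
      using P[OF c that] by simp
    have s: "smooth_on (slit_domain c) (\<lambda>z. spray (local_rep A Fbar c) i z - spray (local_rep A F c) i z)" for i
      by (intro f.smooth_intros f.smooth_spray g.smooth_spray)
    \<comment> \<open>\<open>P y\<close> is a difference of smooth sprays of degree 2, so
      \<open>P\<close> is smooth and satisfies Euler's identity of degree 1.\<close>
    show P: "smooth_on (slit_domain c) (local_rep A P c)"
      by (rule f.smooth_radial_factor[OF s eq])
    have h: "homog_on (slit_domain c) 2 (\<lambda>z. spray (local_rep A Fbar c) i z - spray (local_rep A F c) i z)" for i
      by (intro f.homog_diff f.smooth_spray g.smooth_spray f.homog_spray g.homog_spray)
    have "homog_on (slit_domain c) (1 + 1) (\<lambda>z. local_rep A P c z * snd z $ i)" for i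
      unfolding one_add_one by (rule f.homog_transform[OF h[of i]]) (simp add: eq)
    from f.homog_radial_factor[OF P this]
    show "projective_change (slit_domain c) (spray (local_rep A F c)) (local_rep A P c)
      (spray (local_rep A Fbar c))"
      using P eq by unfold_locales (auto simp: algebra_simps)
  qed
  have ex: "\<exists>u. \<forall>i. L c j i k l z = u * snd z $ i" if c: "c \<in> A" and z: "z \<in> slit_domain c" for c j k l z
  proof -
    interpret f: finsler_region "slit_domain c" "local_rep A F c" by (rule finsler_region_chart[OF A F c])
    interpret g: finsler_region "slit_domain c" "local_rep A Fbar c" by (rule finsler_region_chart[OF A Fbar c])
    interpret p: projective_change "slit_domain c" "spray (local_rep A F c)" "local_rep A P c"
      "spray (local_rep A Fbar c)" by (rule change[OF c])
    let ?c = "local_rep A lam c z * local_rep A F c z"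
    have "local_rep A lam' c z * local_rep A Fbar c z = ?c + 2 * local_rep A P c z"
      using g.nonzero[OF z] by (simp add: local_rep_def lam'_def)
    moreover obtain u where u: "\<And>i. berwald_hderiv0 (local_rep A Fbar c) (douglas_tilde (local_rep A Fbar c)) j i k l z
        + (?c + 2 * local_rep A P c z) * douglas_tilde (local_rep A Fbar c) j i k l z
      = berwald_hderiv0 (local_rep A F c) (douglas_tilde (local_rep A F c)) j i k l z
        + ?c * douglas_tilde (local_rep A F c) j i k l z + u * snd z $ i"
      using p.second_derivative_change[OF z, of j k l ?c]
      unfolding f.douglas_tilde_eq[OF z] g.douglas_tilde_eq[OF z]
        f.berwald_hderiv0_douglas_tilde[OF z] g.berwald_hderiv0_douglas_tilde[OF z] by blast
    ultimately have "L c j i k l z = (U c j k l z + u) * snd z $ i" for i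
      unfolding L_def using u W_GDW_equationD[OF W c z] by (simp add: distrib_right)
    then show ?thesis by blast
  qed
  have L_eq: "L c j i k l z = U' c j k l z * snd z $ i" if "c \<in> A" "z \<in> slit_domain c" for c j i k l z
    using someI_ex[OF ex[OF that]] unfolding U'_def by blast
  then have "W_GDW_equation A Fbar lam' U'"
    unfolding W_GDW_equation_def Let_def L_def by blast
  moreover have "smooth_on (slit_domain c) (local_rep A lam' c)"
    and "smooth_on (slit_domain c) (U' c j k l)" if lam: "smooth_on_TM0 A lam" and c: "c \<in> A" for c j k l
  proof -
    interpret f: finsler_region "slit_domain c" "local_rep A F c" by (rule finsler_region_chart[OF A F c])
    interpret g: finsler_region "slit_domain c" "local_rep A Fbar c" by (rule finsler_region_chart[OF A Fbar c])
    have "smooth_on (slit_domain c) (\<lambda>z. (local_rep A lam c z * local_rep A F c z + 2 * local_rep A P c z)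
        / local_rep A Fbar c z)"
      using lam c by (intro smooth_on_divide f.open_S f.smooth_intros f.smooth_f g.smooth_f P_smooth g.nonzero)
        (simp_all add: smooth_on_TM0_def)
    then show *: "smooth_on (slit_domain c) (local_rep A lam' c)"
      by (simp add: local_rep_def[abs_def] lam'_def)
    \<comment> \<open>Smoothness is shown for the left-hand side \<open>L\<close> and passes to its
      radial factor, so the choice made in \<open>U'\<close> does no harm.\<close>
    have "smooth_on (slit_domain c) (L c j i k l)" for i
      unfolding L_def[abs_def]
      by (intro f.smooth_intros * g.smooth_f g.smooth_douglas_tilde g.smooth_berwald_hderiv0_douglas_tilde)
    then show "smooth_on (slit_domain c) (U' c j k l)"
      by (rule f.smooth_radial_factor) (rule L_eq[OF c])
  qed
  ultimately show ?thesis unfolding smooth_on_TM0_def by blast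
qed

theorem theorem4p1:
  fixes A :: "('m::{t2_space, second_countable_topology}, 'n::finite) chart set"
    and F Fbar :: "('m, 'n) tvector \<Rightarrow> real"
  assumes "smooth_atlas A"
    and "finsler_metric A F" and "finsler_metric A Fbar"
    and "projectively_equivalent A F Fbar"
  shows "(W_GDW_metric A F \<longrightarrow> W_GDW_metric A Fbar) \<and>
    (smooth_W_GDW_metric A F \<longrightarrow> smooth_W_GDW_metric A Fbar)"
  using W_GDW_equation_projective[OF assms] W_GDW_equation_tensor[OF assms(1,3)] assms(3)
  unfolding W_GDW_metric_def smooth_W_GDW_metric_def by meson

end
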